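(* Let $X$ be a toric Calabi–Yau manifold with Gross fibration $\mu:X\to B$. For $r=(q_1,q_2)\in B_0$, the Gross fiber $F_r=\mu^{-1}(r)$ bounds some non-constant stable disks of Maslov index zero in $X$ if and only if $q_2=0$.
   Context: $N\cong\mathbb Z^n$ is a lattice, $M=\mathrm{Hom}(N,\mathbb Z)$, $(\cdot,\cdot)$ the pairing. $\Sigma$ is a fan in $N_{\mathbb R}$ defining a smooth toric manifold $X=X_\Sigma$; $|\Sigma|$ is convex and contains no line; $v_0,\dots,v_{m-1}$ are the primitive ray generators. $X$ is Calabi–Yau: there is $\underline\nu\in M$ with $(\underline\nu,v_i)=1$ for all $i$. $\omega$ is a toric Kähler form with moment map $\mu_0:X\to P\subset M_{\mathbb R}$, and $w:X\to\mathbb C$ is the holomorphic function corresponding to $\underline\nu$. Fix $K_2>0$. The Gross fibration is $\mu:X\to B=(M_{\mathbb R}/\mathbb R\underline\nu)\times\mathbb R_{\ge-K_2^2}$, $\mu(x)=([\mu_0(x)],|w(x)-K_2|^2-K_2^2)$. $\Gamma\subset B$ is the set of critical values of $\mu$ and $B_0=B-\Gamma$; for $r\in B_0$, $F_r$ is a Lagrangian torus. A stable disk bounded by $L$ is a (pseudo)holomorphic map $u:(S,\partial S)\to(X,L)$ from a genus-zero semi-stable Riemann surface $S$ (possibly with several disk and sphere components) with non-empty connected boundary, such that every component contracted by $u$ contains at least three marked or singular points. The Maslov index is the usual one on $\pi_2(X,L)$.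
   Formalization: The fan is assumed to have at least two rays (m ≥ 2): for X = ℂ, or ℂ×(ℂ* )^{n−1}, regular fibers over q_2 = 0 bound no non-constant disk of Maslov index zero. The moment map is read as being onto the moment polyhedron P. *)

theory Defs
  imports "HOL-Complex_Analysis.Complex_Analysis"
begin

section \<open>Smooth functions and manifolds given by an atlas\<close>

text \<open>\<open>Ck_on k S f\<close> says that \<open>f\<close> is \<open>k\<close> times continuously differentiable on the open set \<open>S\<close>.\<close>

primrec Ck_on :: "nat \<Rightarrow> 'a::real_normed_vector set \<Rightarrow> ('a \<Rightarrow> 'b::real_normed_vector) \<Rightarrow> bool" where
  "Ck_on 0 S f = continuous_on S f"
| "Ck_on (Suc k) S f =
     ((\<forall>x\<in>S. f differentiable (at x)) \<and> (\<forall>v. Ck_on k S (\<lambda>x. frechet_derivative f (at x) v)))"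

definition smooth_on :: "'a::real_normed_vector set \<Rightarrow> ('a \<Rightarrow> 'b::real_normed_vector) \<Rightarrow> bool" where
  "smooth_on S f \<longleftrightarrow> (\<forall>k. Ck_on k S f)"

text \<open>A complex manifold is given by a set of charts \<open>(U, \<phi>)\<close>, where \<open>\<phi>\<close> maps \<open>U\<close> bijectively
  onto an open subset of the complex coordinate space. Vectors, forms and frames are given by their
  local representatives in all charts, together with the transformation law under changes of chart.\<close>

type_synonym ('x, 'n) chart = "'x set \<times> ('x \<Rightarrow> complex ^ 'n)"

definition coord_inv :: "('x, 'n::finite) chart \<Rightarrow> complex ^ 'n \<Rightarrow> 'x" where
  "coord_inv c = inv_into (fst c) (snd c)"

definition in_coords :: "('x, 'n::finite) chart \<Rightarrow> ('x, 'n) chart \<Rightarrow> ('x \<Rightarrow> 'x) \<Rightarrow> complex ^ 'n \<Rightarrow> complex ^ 'n" where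
  "in_coords c c' f = snd c' \<circ> f \<circ> coord_inv c"

definition smooth_fun :: "('x, 'n::finite) chart set \<Rightarrow> ('x \<Rightarrow> 'b::real_normed_vector) \<Rightarrow> bool" where
  "smooth_fun At f \<longleftrightarrow> (\<forall>c\<in>At. smooth_on (snd c ` fst c) (f \<circ> coord_inv c))"

type_synonym ('x, 'n) two_form =
  "('x, 'n) chart \<Rightarrow> complex ^ 'n \<Rightarrow> complex ^ 'n \<Rightarrow> complex ^ 'n \<Rightarrow> real"

definition preserves_form :: "('x, 'n::finite) chart set \<Rightarrow> ('x, 'n) two_form \<Rightarrow> ('x \<Rightarrow> 'x) \<Rightarrow> bool" where
  "preserves_form At \<omega> f \<longleftrightarrow>
     (\<forall>c\<in>At. \<forall>c'\<in>At. \<forall>x\<in>fst c. f x \<in> fst c' \<longrightarrow>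
        (let D = frechet_derivative (in_coords c c' f) (at (snd c x)) in
         \<forall>u v. \<omega> c (snd c x) u v = \<omega> c' (snd c' (f x)) (D u) (D v)))"

text \<open>The transformation law under changes of chart is invariance under the identity map.\<close>

definition smooth_two_form :: "('x, 'n::finite) chart set \<Rightarrow> ('x, 'n) two_form \<Rightarrow> bool" where
  "smooth_two_form At \<omega> \<longleftrightarrow>
     (\<forall>c\<in>At.
        (\<forall>z \<in> snd c ` fst c. bilinear (\<omega> c z) \<and> (\<forall>u. \<omega> c z u u = 0)) \<and>
        (\<forall>u v. smooth_on (snd c ` fst c) (\<lambda>z. \<omega> c z u v))) \<and>
     preserves_form At \<omega> (\<lambda>x. x)"

definition closed_two_form :: "('x, 'n::finite) chart set \<Rightarrow> ('x, 'n) two_form \<Rightarrow> bool" where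
  "closed_two_form At \<omega> \<longleftrightarrow>
     (\<forall>c\<in>At. \<forall>z \<in> snd c ` fst c. \<forall>u v w.
        frechet_derivative (\<lambda>z. \<omega> c z v w) (at z) u +
        frechet_derivative (\<lambda>z. \<omega> c z w u) (at z) v +
        frechet_derivative (\<lambda>z. \<omega> c z u v) (at z) w = 0)"

definition kaehler_form :: "('x, 'n::finite) chart set \<Rightarrow> ('x, 'n) two_form \<Rightarrow> bool" where
  "kaehler_form At \<omega> \<longleftrightarrow>
     smooth_two_form At \<omega> \<and> closed_two_form At \<omega> \<and>
     (\<forall>c\<in>At. \<forall>z \<in> snd c ` fst c. \<forall>u v.
        \<omega> c z (\<i> *s u) (\<i> *s v) = \<omega> c z u v \<and> (u \<noteq> 0 \<longrightarrow> \<omega> c z u (\<i> *s u) > 0))"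

text \<open>Continuity of a map into the manifold on a subset of the plane, and holomorphy on an open
  subset of the plane.\<close>

definition cont_into :: "('x, 'n::finite) chart set \<Rightarrow> complex set \<Rightarrow> (complex \<Rightarrow> 'x) \<Rightarrow> bool" where
  "cont_into At D f \<longleftrightarrow>
     (\<forall>p\<in>D. \<exists>c\<in>At. \<exists>e>0. f ` (D \<inter> ball p e) \<subseteq> fst c \<and> continuous_on (D \<inter> ball p e) (snd c \<circ> f))"

definition holo_into :: "('x, 'n::finite) chart set \<Rightarrow> complex set \<Rightarrow> (complex \<Rightarrow> 'x) \<Rightarrow> bool" where
  "holo_into At D f \<longleftrightarrow>
     (\<forall>p\<in>D. \<exists>c\<in>At. \<exists>e>0. ball p e \<subseteq> D \<and> f ` ball p e \<subseteq> fst c \<and>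
        (\<forall>j. (\<lambda>z. snd c (f z) $ j) holomorphic_on ball p e))"

section \<open>Maslov index\<close>

text \<open>A continuous complex frame of the pulled back tangent bundle over \<open>D\<close>: the columns
  of \<open>E c p\<close> are the frame vectors at \<open>p\<close> written in the chart \<open>c\<close>.\<close>

definition tangent_frame ::
  "('x, 'n::finite) chart set \<Rightarrow> complex set \<Rightarrow> (complex \<Rightarrow> 'x) \<Rightarrow>
   (('x, 'n) chart \<Rightarrow> complex \<Rightarrow> complex ^ 'n ^ 'n) \<Rightarrow> bool" where
  "tangent_frame At D f E \<longleftrightarrow>
     (\<forall>c\<in>At. continuous_on {p\<in>D. f p \<in> fst c} (E c) \<and>
        (\<forall>p\<in>D. f p \<in> fst c \<longrightarrow> det (E c p) \<noteq> 0)) \<and>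
     (\<forall>c\<in>At. \<forall>c'\<in>At. \<forall>p\<in>D. f p \<in> fst c \<inter> fst c' \<longrightarrow>
        (\<forall>j. column j (E c' p) =
           frechet_derivative (in_coords c c' (\<lambda>x. x)) (at (snd c (f p))) (column j (E c p))))"

text \<open>For an embedded submanifold this is the tangent space.\<close>

definition tangent_set :: "'a::real_normed_vector set \<Rightarrow> 'a \<Rightarrow> 'a set" where
  "tangent_set S z =
     {v. \<exists>\<gamma>::real \<Rightarrow> 'a. range \<gamma> \<subseteq> S \<and> \<gamma> 0 = z \<and> (\<gamma> has_vector_derivative v) (at 0)}"

text \<open>The columns of \<open>F\<close> form a real basis of the totally real subspace \<open>V\<close>.\<close>

definition real_basis :: "complex ^ 'n ^ 'n \<Rightarrow> (complex ^ 'n::finite) set \<Rightarrow> bool" where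
  "real_basis F V \<longleftrightarrow>
     det F \<noteq> 0 \<and> V = range (\<lambda>a::real ^ 'n. F *v (\<chi> j. complex_of_real (a $ j)))"

text \<open>The squared phase does not depend on the choice of the real basis.\<close>

definition det_sq_phase :: "(complex ^ 'n::finite) set \<Rightarrow> complex" where
  "det_sq_phase V =
     (THE s. \<exists>F. real_basis F V \<and> s = (det F)\<^sup>2 / complex_of_real ((norm (det F))\<^sup>2))"

definition unit_circle :: "real \<Rightarrow> complex" where
  "unit_circle t = exp (of_real (2 * pi * t) * \<i>)"

definition framed_tangent ::
  "('x, 'n::finite) chart set \<Rightarrow> 'x set \<Rightarrow> (complex \<Rightarrow> 'x) \<Rightarrow>
   (('x, 'n) chart \<Rightarrow> complex \<Rightarrow> complex ^ 'n ^ 'n) \<Rightarrow> complex \<Rightarrow> (complex ^ 'n) set" where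
  "framed_tangent At L f E p =
     {a. \<exists>c\<in>At. f p \<in> fst c \<and> E c p *v a \<in> tangent_set (snd c ` (L \<inter> fst c)) (snd c (f p))}"

text \<open>Maslov index of a disk \<open>(D\<^sup>2, S\<^sup>1) \<rightarrow> (X, L)\<close>: trivialise the pulled back tangent bundle over
  the closed disk and take the Maslov index of the resulting loop of tangent spaces of \<open>L\<close>. It does
  not depend on the frame.\<close>

definition disk_maslov :: "('x, 'n::finite) chart set \<Rightarrow> 'x set \<Rightarrow> (complex \<Rightarrow> 'x) \<Rightarrow> int" where
  "disk_maslov At L f =
     (THE k. \<exists>E. tangent_frame At (cball 0 1) f E \<and>
        winding_number (\<lambda>t. det_sq_phase (framed_tangent At L f E (unit_circle t))) 0 = of_int k)"

text \<open>The Riemann sphere is \<open>complex option\<close>, with \<open>None\<close> the point at infinity;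
  \<open>at_infinity_coord\<close> is the inverse of the coordinate centred there.\<close>

definition at_infinity_coord :: "complex \<Rightarrow> complex option" where
  "at_infinity_coord z = (if z = 0 then None else Some (inverse z))"

text \<open>First Chern number of the pulled back tangent bundle of a sphere, as the degree of the clutching
  function, along the equator, between frames \<open>E\<close> and \<open>F\<close> over the two closed hemispheres. The sign is
  such that the tangent bundle of the sphere has degree \<open>2\<close>.\<close>

definition sphere_chern :: "('x, 'n::finite) chart set \<Rightarrow> (complex option \<Rightarrow> 'x) \<Rightarrow> int" where
  "sphere_chern At g =
     (THE k. \<exists>E F. tangent_frame At (cball 0 1) (g \<circ> Some) E \<and>
        tangent_frame At (cball 0 1) (g \<circ> at_infinity_coord) F \<and>
        winding_number (\<lambda>t. let p = unit_circle t; c = (SOME c. c \<in> At \<and> g (Some p) \<in> fst c)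
           in det (F c (inverse p)) / det (E c p)) 0 = of_int k)"

section \<open>Stable disks\<close>

text \<open>A semi-stable Riemann surface of genus zero with connected non-empty boundary. By uniformisation
  each component is the closed unit disk or the Riemann sphere. A point is a pair of a component and a
  point of the Riemann sphere; a node is the pair of points that it identifies, which are both boundary
  points or both interior points. Genus zero means that the dual graph of components and nodes
  is a tree.\<close>

record nodal_disk =
  disks :: "nat set"
  spheres :: "nat set"
  nodes :: "(nat \<times> complex option) set set"
  marked :: "(nat \<times> complex option) set"

definition comps_of :: "nodal_disk \<Rightarrow> nat set" where
  "comps_of S = disks S \<union> spheres S"

definition carrier_of :: "nodal_disk \<Rightarrow> nat \<Rightarrow> complex option set" where
  "carrier_of S i = (if i \<in> disks S then Some ` cball 0 1 else UNIV)"

definition boundary_points :: "nodal_disk \<Rightarrow> (nat \<times> complex option) set" where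
  "boundary_points S = disks S \<times> Some ` sphere 0 1"

definition interior_points :: "nodal_disk \<Rightarrow> (nat \<times> complex option) set" where
  "interior_points S = disks S \<times> Some ` ball 0 1 \<union> spheres S \<times> UNIV"

definition adjacent :: "(nat \<times> complex option) set set \<Rightarrow> (nat \<times> nat) set" where
  "adjacent N = {(i, j). \<exists>p q. {(i, p), (j, q)} \<in> N}"

definition semistable_disk :: "nodal_disk \<Rightarrow> bool" where
  "semistable_disk S \<longleftrightarrow>
     finite (comps_of S) \<and> disks S \<inter> spheres S = {} \<and> disks S \<noteq> {} \<and>
     finite (nodes S) \<and>
     (\<forall>e \<in> nodes S. card e = 2 \<and> (e \<subseteq> boundary_points S \<or> e \<subseteq> interior_points S)) \<and>
     disjoint (nodes S) \<and>
     finite (marked S) \<and> marked S \<subseteq> boundary_points S \<union> interior_points S \<and>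
     marked S \<inter> \<Union>(nodes S) = {} \<and>
     (\<forall>i \<in> comps_of S. \<forall>j \<in> comps_of S. (i, j) \<in> (adjacent (nodes S))\<^sup>*) \<and>
     card (comps_of S) = card (nodes S) + 1 \<and>
     (\<forall>i \<in> disks S. \<forall>j \<in> disks S. (i, j) \<in> (adjacent {e \<in> nodes S. e \<subseteq> boundary_points S})\<^sup>*)"

definition stable_disk ::
  "('x, 'n::finite) chart set \<Rightarrow> 'x set \<Rightarrow> nodal_disk \<Rightarrow> (nat \<Rightarrow> complex option \<Rightarrow> 'x) \<Rightarrow> bool" where
  "stable_disk At L S u \<longleftrightarrow>
     semistable_disk S \<and>
     (\<forall>i \<in> disks S. cont_into At (cball 0 1) (u i \<circ> Some) \<and> holo_into At (ball 0 1) (u i \<circ> Some) \<and>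
        u i ` Some ` sphere 0 1 \<subseteq> L) \<and>
     (\<forall>i \<in> spheres S. holo_into At UNIV (u i \<circ> Some) \<and> holo_into At UNIV (u i \<circ> at_infinity_coord)) \<and>
     (\<forall>e \<in> nodes S. \<forall>(i, p) \<in> e. \<forall>(j, q) \<in> e. u i p = u j q) \<and>
     (\<forall>i \<in> comps_of S. u i constant_on carrier_of S i \<longrightarrow>
        card {p. (i, p) \<in> marked S \<union> \<Union>(nodes S)} \<ge> 3)"

definition nonconstant :: "nodal_disk \<Rightarrow> (nat \<Rightarrow> complex option \<Rightarrow> 'x) \<Rightarrow> bool" where
  "nonconstant S u \<longleftrightarrow>
     \<not> (\<exists>x. \<forall>i \<in> comps_of S. \<forall>p \<in> carrier_of S i. u i p = x)"

text \<open>The Maslov index of the class in \<open>\<pi>\<^sub>2(X, L)\<close> of a stable disk: the class is the sum of the classes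
  of the components, and on the image of \<open>\<pi>\<^sub>2(X)\<close> the Maslov index is twice the first Chern number.\<close>

definition maslov_index ::
  "('x, 'n::finite) chart set \<Rightarrow> 'x set \<Rightarrow> nodal_disk \<Rightarrow> (nat \<Rightarrow> complex option \<Rightarrow> 'x) \<Rightarrow> int" where
  "maslov_index At L S u =
     (\<Sum>i \<in> disks S. disk_maslov At L (u i \<circ> Some)) + 2 * (\<Sum>i \<in> spheres S. sphere_chern At (u i))"

definition bounds_stable_disk_of_index :: "('x, 'n::finite) chart set \<Rightarrow> 'x set \<Rightarrow> int \<Rightarrow> bool" where
  "bounds_stable_disk_of_index At L k \<longleftrightarrow>
     (\<exists>S u. stable_disk At L S u \<and> nonconstant S u \<and> maslov_index At L S u = k)"

section \<open>Fans and toric manifolds\<close>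

text \<open>\<open>N\<close> and \<open>M\<close> are both \<open>int ^ 'n\<close>, \<open>N\<^sub>\<real>\<close> and \<open>M\<^sub>\<real>\<close> are \<open>real ^ 'n\<close>, and the pairing is the inner
  product.\<close>

definition rvec :: "int ^ 'n::finite \<Rightarrow> real ^ 'n" where
  "rvec v = (\<chi> i. of_int (v $ i))"

definition rational_polyhedral_cone :: "(real ^ 'n::finite) set \<Rightarrow> bool" where
  "rational_polyhedral_cone \<sigma> \<longleftrightarrow> (\<exists>V. finite V \<and> \<sigma> = convex_cone hull (rvec ` V))"

definition fan :: "(real ^ 'n::finite) set set \<Rightarrow> bool" where
  "fan \<Sigma> \<longleftrightarrow>
     finite \<Sigma> \<and> \<Sigma> \<noteq> {} \<and>
     (\<forall>\<sigma>\<in>\<Sigma>. rational_polyhedral_cone \<sigma> \<and> \<sigma> \<inter> uminus ` \<sigma> = {0}) \<and>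
     (\<forall>\<sigma>\<in>\<Sigma>. \<forall>\<tau>. \<tau> face_of \<sigma> \<and> \<tau> \<noteq> {} \<longrightarrow> \<tau> \<in> \<Sigma>) \<and>
     (\<forall>\<sigma>\<in>\<Sigma>. \<forall>\<sigma>'\<in>\<Sigma>. (\<sigma> \<inter> \<sigma>') face_of \<sigma> \<and> (\<sigma> \<inter> \<sigma>') face_of \<sigma>')"

text \<open>The rows of \<open>B\<close> form a basis of \<open>N\<close>, a part of which generates \<open>\<sigma>\<close>; the rows of \<open>A\<close> form
  the dual basis of \<open>M\<close>.\<close>

definition adapted_bases :: "(real ^ 'n::finite) set \<Rightarrow> int ^ 'n ^ 'n \<Rightarrow> int ^ 'n ^ 'n \<Rightarrow> bool" where
  "adapted_bases \<sigma> A B \<longleftrightarrow>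
     A ** transpose B = mat 1 \<and> (\<exists>J. \<sigma> = convex_cone hull ((\<lambda>j. rvec (B $ j)) ` J))"

definition smooth_fan :: "(real ^ 'n::finite) set set \<Rightarrow> bool" where
  "smooth_fan \<Sigma> \<longleftrightarrow> fan \<Sigma> \<and> (\<forall>\<sigma>\<in>\<Sigma>. \<exists>A B. adapted_bases \<sigma> A B)"

definition primitive :: "int ^ 'n::finite \<Rightarrow> bool" where
  "primitive v \<longleftrightarrow> (\<forall>k w. v = k *s w \<longrightarrow> \<bar>k\<bar> = 1)"

definition ray_generators :: "(real ^ 'n::finite) set set \<Rightarrow> (int ^ 'n) set" where
  "ray_generators \<Sigma> = {v. primitive v \<and> convex_cone hull {rvec v} \<in> \<Sigma>}"

definition dual_monoid :: "(real ^ 'n::finite) set \<Rightarrow> (int ^ 'n) set" where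
  "dual_monoid \<sigma> = {m. \<forall>y\<in>\<sigma>. rvec m \<bullet> y \<ge> 0}"

text \<open>The affine piece of a cone \<open>\<sigma>\<close> is the set of monoid homomorphisms from
  \<open>dual_monoid \<sigma>\<close> to \<open>(\<complex>, \<cdot>)\<close>, and the toric variety is glued from these pieces along restriction. A
  point lies in the piece of a unique smallest cone \<open>\<tau>\<close>, and it is represented here by its homomorphism
  on \<open>dual_monoid \<tau>\<close>, as a partial function on \<open>M\<close>. The cone is smallest exactly if only the
  characters orthogonal to \<open>\<tau>\<close> are nonzero at the point (the points of one \<open>\<tau>\<close> form the
  torus orbit of \<open>\<tau>\<close>). So \<open>the (x m)\<close> is the value at \<open>x\<close> of the character \<open>m\<close>, and the domain of \<open>x\<close>
  consists of the characters that are regular at \<open>x\<close>.\<close>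

type_synonym 'n tpoint = "int ^ 'n \<Rightarrow> complex option"

definition character :: "int ^ 'n::finite \<Rightarrow> 'n tpoint \<Rightarrow> complex" where
  "character m x = the (x m)"

definition toric_variety :: "(real ^ 'n::finite) set set \<Rightarrow> 'n tpoint set" where
  "toric_variety \<Sigma> =
     {x. \<exists>\<tau>\<in>\<Sigma>. dom x = dual_monoid \<tau> \<and> character 0 x = 1 \<and>
        (\<forall>m \<in> dual_monoid \<tau>. \<forall>m' \<in> dual_monoid \<tau>.
           character (m + m') x = character m x * character m' x) \<and>
        (\<forall>m \<in> dual_monoid \<tau>. character m x \<noteq> 0 \<longleftrightarrow> (\<forall>y\<in>\<tau>. rvec m \<bullet> y = 0))}"

definition affine_piece :: "(real ^ 'n::finite) set set \<Rightarrow> (real ^ 'n) set \<Rightarrow> 'n tpoint set" where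
  "affine_piece \<Sigma> \<sigma> = {x \<in> toric_variety \<Sigma>. dual_monoid \<sigma> \<subseteq> dom x}"

definition toric_atlas :: "(real ^ 'n::finite) set set \<Rightarrow> ('n tpoint, 'n) chart set" where
  "toric_atlas \<Sigma> =
     {(affine_piece \<Sigma> \<sigma>, \<lambda>x. \<chi> j. character (A $ j) x) | \<sigma> A. \<sigma> \<in> \<Sigma> \<and> (\<exists>B. adapted_bases \<sigma> A B)}"

text \<open>The action of the compact torus \<open>N\<^sub>\<real> / 2\<pi>N\<close>.\<close>

definition torus_act :: "real ^ 'n::finite \<Rightarrow> 'n tpoint \<Rightarrow> 'n tpoint" where
  "torus_act \<theta> x = (\<lambda>m. map_option (\<lambda>s. cis (rvec m \<bullet> \<theta>) * s) (x m))"

definition toric_kaehler_form :: "(real ^ 'n::finite) set set \<Rightarrow> ('n tpoint, 'n) two_form \<Rightarrow> bool" where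
  "toric_kaehler_form \<Sigma> \<omega> \<longleftrightarrow>
     kaehler_form (toric_atlas \<Sigma>) \<omega> \<and> (\<forall>\<theta>. preserves_form (toric_atlas \<Sigma>) \<omega> (torus_act \<theta>))"

text \<open>The velocity, in the chart \<open>c\<close>, of the one-parameter group generated by \<open>\<xi>\<close>.\<close>

definition fundamental_vector ::
  "('n::finite tpoint, 'n) chart \<Rightarrow> real ^ 'n \<Rightarrow> 'n tpoint \<Rightarrow> complex ^ 'n" where
  "fundamental_vector c \<xi> x = vector_derivative (\<lambda>t. snd c (torus_act (t *\<^sub>R \<xi>) x)) (at 0)"

text \<open>The sign is the one for which the image is cut out by the inequalities \<open>(m, v) \<ge> a v\<close> with \<open>v\<close>
  the ray generators (for \<open>\<complex>\<close> with its standard form, \<open>|z|\<^sup>2 / 2\<close> is a moment map).\<close>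

definition moment_map ::
  "(real ^ 'n::finite) set set \<Rightarrow> ('n tpoint, 'n) two_form \<Rightarrow> ('n tpoint \<Rightarrow> real ^ 'n) \<Rightarrow> bool" where
  "moment_map \<Sigma> \<omega> \<mu>\<^sub>0 \<longleftrightarrow>
     smooth_fun (toric_atlas \<Sigma>) \<mu>\<^sub>0 \<and>
     (\<forall>c \<in> toric_atlas \<Sigma>. \<forall>x \<in> fst c. \<forall>\<xi> v.
        frechet_derivative (\<lambda>z. \<mu>\<^sub>0 (coord_inv c z) \<bullet> \<xi>) (at (snd c x)) v =
        \<omega> c (snd c x) v (fundamental_vector c \<xi> x))"

definition moment_polyhedron ::
  "(real ^ 'n::finite) set set \<Rightarrow> (int ^ 'n \<Rightarrow> real) \<Rightarrow> (real ^ 'n) set" where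
  "moment_polyhedron \<Sigma> a = {m. \<forall>v \<in> ray_generators \<Sigma>. m \<bullet> rvec v \<ge> a v}"

section \<open>The Gross fibration\<close>

text \<open>Elements of \<open>M\<^sub>\<real> / \<real>\<nu>\<close> are cosets.\<close>

definition quot_class :: "int ^ 'n::finite \<Rightarrow> real ^ 'n \<Rightarrow> (real ^ 'n) set" where
  "quot_class \<nu> m = (+) m ` span {rvec \<nu>}"

definition gross_base :: "int ^ 'n::finite \<Rightarrow> real \<Rightarrow> ((real ^ 'n) set \<times> real) set" where
  "gross_base \<nu> K = range (quot_class \<nu>) \<times> {- K\<^sup>2..}"

definition gross_height :: "int ^ 'n::finite \<Rightarrow> real \<Rightarrow> 'n tpoint \<Rightarrow> real" where
  "gross_height \<nu> K x = (norm (character \<nu> x - complex_of_real K))\<^sup>2 - K\<^sup>2"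

definition gross_fibration ::
  "int ^ 'n::finite \<Rightarrow> real \<Rightarrow> ('n tpoint \<Rightarrow> real ^ 'n) \<Rightarrow> 'n tpoint \<Rightarrow> (real ^ 'n) set \<times> real" where
  "gross_fibration \<nu> K \<mu>\<^sub>0 x = (quot_class \<nu> (\<mu>\<^sub>0 x), gross_height \<nu> K x)"

text \<open>The points where the differential of the fibration, a map onto a quotient of \<open>M\<^sub>\<real> \<times> \<real>\<close>,
  is not surjective.\<close>

definition gross_critical_points ::
  "(real ^ 'n::finite) set set \<Rightarrow> int ^ 'n \<Rightarrow> real \<Rightarrow> ('n tpoint \<Rightarrow> real ^ 'n) \<Rightarrow> 'n tpoint set" where
  "gross_critical_points \<Sigma> \<nu> K \<mu>\<^sub>0 =
     {x. \<exists>c \<in> toric_atlas \<Sigma>. x \<in> fst c \<and>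
        \<not> (\<forall>m s. \<exists>v.
           quot_class \<nu> (frechet_derivative (\<mu>\<^sub>0 \<circ> coord_inv c) (at (snd c x)) v) = quot_class \<nu> m \<and>
           frechet_derivative (gross_height \<nu> K \<circ> coord_inv c) (at (snd c x)) v = s)}"

definition discriminant ::
  "(real ^ 'n::finite) set set \<Rightarrow> int ^ 'n \<Rightarrow> real \<Rightarrow> ('n tpoint \<Rightarrow> real ^ 'n) \<Rightarrow>
   ((real ^ 'n) set \<times> real) set" where
  "discriminant \<Sigma> \<nu> K \<mu>\<^sub>0 = gross_fibration \<nu> K \<mu>\<^sub>0 ` gross_critical_points \<Sigma> \<nu> K \<mu>\<^sub>0"

definition gross_fiber ::
  "(real ^ 'n::finite) set set \<Rightarrow> int ^ 'n \<Rightarrow> real \<Rightarrow> ('n tpoint \<Rightarrow> real ^ 'n) \<Rightarrow>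
   (real ^ 'n) set \<times> real \<Rightarrow> 'n tpoint set" where
  "gross_fiber \<Sigma> \<nu> K \<mu>\<^sub>0 r = {x \<in> toric_variety \<Sigma>. gross_fibration \<nu> K \<mu>\<^sub>0 x = r}"

end

theory Submission
  imports Defs
begin

text \<open>On a toric Calabi--Yau manifold the form \<open>w dz\<^sub>1 \<dots> dz\<^sub>n / (z\<^sub>1 \<dots> z\<^sub>n)\<close> is holomorphic and
  nowhere zero, and the regular Gross fibers are special Lagrangian for its quotient by \<open>w - K\<close>.
  Hence spheres have Chern number zero, and the Maslov index of a disk is twice the winding number of
  \<open>w - K\<close> along its boundary, that is, twice the number of zeros of \<open>w - K\<close> in the disk. In index zero
  there are none, and since \<open>|w - K|\<close> is constant on the boundary, \<open>w\<close> is constant on the whole stable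
  disk. If \<open>q\<^sub>2 \<noteq> 0\<close>, this constant is not \<open>0\<close>, so that the disk lies in the open orbit. There the
  moment map is strictly monotone along the noncompact directions of the torus; so all characters
  have constant modulus on the boundary, and the disk is constant. If \<open>q\<^sub>2 = 0\<close>, the fiber meets the
  interior of a toric divisor, and convexity of the support of the fan provides a torus invariant
  disk in that divisor, on which \<open>w = 0\<close>.\<close>

text \<open>Why the phase is that of w - K: torus directions orthogonal to \<nu> are tangent to the
  fiber and leave w unchanged, and inserting n - 1 of them into the volume form leaves a constant
  multiple of dw. A remaining tangent direction keeps |w - K| fixed, so on it dw is a real multiple
  of \<i> (w - K). Both indices are definite descriptions over frames of the pulled back tangent
  bundle, so frames over a disk have to exist; they are glued from coordinate frames over small
  boxes. The volume form evaluated on a frame is a nowhere zero function on the whole disk, hence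
  does not wind, and the frame drops out of the index. Tangent vectors are velocities of curves
  inside the fiber, so the kernel of the differential has to be realised by curves; a Brouwer fixed
  point argument does this. Identities of Laurent monomials are delicate on the divisors, since
  \<open>0 powi k\<close> is 0 and not a pole for negative k; those with determinants are proved on
  the open torus and extended by continuity.\<close>

no_notation fps_nth (infixl \<open>$\<close> 75)

section \<open>Charts of a toric manifold\<close>

definition ipair :: "int ^ 'n::finite \<Rightarrow> int ^ 'n \<Rightarrow> int" where
  "ipair m v = (\<Sum>i\<in>UNIV. m $ i * v $ i)"

lemma rvec_inner: "rvec m \<bullet> rvec v = of_int (ipair m v)"
  by (simp add: ipair_def rvec_def inner_vec_def)

lemma rvec_uminus: "rvec (- m) = - rvec m"
  by (simp add: rvec_def vec_eq_iff)

lemma rvec_zero [simp]: "rvec 0 = 0"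
  by (simp add: rvec_def vec_eq_iff)

lemma rvec_inject: "rvec a = rvec b \<longleftrightarrow> a = b"
  by (simp add: rvec_def vec_eq_iff)

lemma ipair_add: "ipair (m + m') v = ipair m v + ipair m' v"
  by (simp add: ipair_def algebra_simps sum.distrib)

lemma ipair_smult: "ipair (k *s m) v = k * ipair m v"
  by (simp add: ipair_def algebra_simps sum_distrib_left)

lemma ipair_smult_right: "ipair m (k *s v) = k * ipair m v"
  by (simp add: ipair_def algebra_simps sum_distrib_left)

lemma ipair_0 [simp]: "ipair 0 v = 0"
  by (simp add: ipair_def)

lemma ipair_uminus: "ipair (- m) v = - ipair m v"
  by (simp add: ipair_def sum_negf)

definition dual_bases :: "int ^ 'n ^ 'n \<Rightarrow> int ^ 'n ^ ('n::finite) \<Rightarrow> bool" where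
  "dual_bases A B \<longleftrightarrow> A ** transpose B = mat 1"

definition rmat :: "int ^ 'n ^ 'm \<Rightarrow> real ^ 'n ^ 'm" where
  "rmat A = (\<chi> i j. of_int (A $ i $ j))"

lemma rmat_mult: "rmat (A ** B) = rmat A ** rmat B"
  by (simp add: rmat_def matrix_matrix_mult_def vec_eq_iff)

lemma rmat_transpose: "rmat (transpose A) = transpose (rmat A)"
  by (simp add: rmat_def transpose_def vec_eq_iff)

lemma rmat_mat1: "rmat (mat 1) = mat 1"
  by (simp add: rmat_def mat_def vec_eq_iff)

lemma det_rmat: "det (rmat A) = of_int (det (A :: int ^ 'n ^ ('n::finite)))"
  by (simp add: det_def rmat_def)

lemma dual_bases_rmat: "dual_bases A B \<Longrightarrow> rmat A ** transpose (rmat B) = mat 1"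
  by (metis dual_bases_def rmat_mat1 rmat_mult rmat_transpose)

lemma dual_bases_rmat': "dual_bases A B \<Longrightarrow> transpose (rmat B) ** rmat A = mat 1"
  using dual_bases_rmat matrix_left_right_inverse by blast

lemma dual_bases_ipair:
  assumes "dual_bases A B" shows "ipair (A $ i) (B $ j) = (if i = j then 1 else 0)"
proof -
  have "(A ** transpose B) $ i $ j = (mat 1 :: int^'a^'a) $ i $ j"
    using assms by (simp add: dual_bases_def)
  thus ?thesis by (simp add: matrix_matrix_mult_def ipair_def transpose_def mat_def)
qed

lemma dual_bases_inner:
  assumes "dual_bases A B" shows "rvec (A $ i) \<bullet> rvec (B $ j) = (if i = j then 1 else 0)"
  using dual_bases_ipair[OF assms, of i j] by (simp add: rvec_inner)

lemma dual_bases_expand: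
  assumes "dual_bases A B" shows "y = (\<Sum>j\<in>UNIV. (rvec (A $ j) \<bullet> y) *\<^sub>R rvec (B $ j))"
proof -
  have "y = (transpose (rmat B) ** rmat A) *v y"
    by (simp add: dual_bases_rmat'[OF assms])
  also have "\<dots> = transpose (rmat B) *v (rmat A *v y)"
    by (simp add: matrix_vector_mul_assoc)
  also have "\<dots> = (\<Sum>j\<in>UNIV. (rvec (A $ j) \<bullet> y) *\<^sub>R rvec (B $ j))"
    by (simp add: vec_eq_iff matrix_vector_mult_def transpose_def inner_vec_def rmat_def rvec_def
        mult.commute)
  finally show ?thesis .
qed

text \<open>The expansion is proved over the reals, where a one-sided inverse of a square matrix is
  two-sided, and pulled back to the lattice by injectivity of \<open>rvec\<close>.\<close>

lemma dual_bases_expand_int: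
  assumes "dual_bases A B" shows "m = (\<Sum>j\<in>UNIV. ipair m (B $ j) *s A $ j)"
proof -
  have "transpose (transpose (rmat B) ** rmat A) = mat 1"
    by (simp add: dual_bases_rmat'[OF assms] transpose_mat)
  hence "rmat (transpose A) ** rmat B = mat 1"
    by (simp add: matrix_transpose_mul rmat_transpose transpose_transpose)
  hence "rvec m = (rmat (transpose A) ** rmat B) *v rvec m" by simp
  also have "\<dots> = transpose (rmat A) *v (rmat B *v rvec m)"
    by (simp add: matrix_vector_mul_assoc rmat_transpose)
  also have "\<dots> = rvec (\<Sum>j\<in>UNIV. ipair m (B $ j) *s A $ j)"
    by (simp add: vec_eq_iff matrix_vector_mult_def transpose_def inner_vec_def rmat_def rvec_def
        mult.commute ipair_def)
  finally show ?thesis by (simp only: rvec_inject)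
qed

lemma inner_expand:
  assumes "dual_bases A B"
  shows "rvec m \<bullet> y = (\<Sum>j\<in>UNIV. of_int (ipair m (B $ j)) * (rvec (A $ j) \<bullet> y))"
  by (subst dual_bases_expand[OF assms, of y]) (simp add: inner_sum_right rvec_inner mult.commute)

definition basis_cone :: "int ^ 'n ^ 'n \<Rightarrow> 'n set \<Rightarrow> (real ^ 'n::finite) set" where
  "basis_cone B I = convex_cone hull ((\<lambda>j. rvec (B $ j)) ` I)"

text \<open>In the coordinates given by the rows of \<open>A\<close> the cone becomes an orthant of
  a coordinate subspace. For the harder inclusion, the expansion of y in the rows of
  \<open>B\<close> has nonnegative coefficients that are supported in \<open>I\<close>.\<close>

lemma basis_cone_eq:
  assumes "dual_bases A B"
  shows "basis_cone B I =
    {y. (\<forall>j\<in>I. rvec (A $ j) \<bullet> y \<ge> 0) \<and> (\<forall>j. j \<notin> I \<longrightarrow> rvec (A $ j) \<bullet> y = 0)}" (is "_ = ?R")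
proof
  have cc: "convex_cone ?R"
    unfolding convex_cone_iff
    by (auto simp: inner_add_right intro!: exI[of _ 0])
  show "basis_cone B I \<subseteq> ?R" unfolding basis_cone_def
  proof (rule hull_minimal)
    show "(\<lambda>j. rvec (B $ j)) ` I \<subseteq> ?R" by (auto simp: dual_bases_inner[OF assms])
  qed (rule cc)
next
  have *: "c \<ge> 0 \<Longrightarrow> j \<in> I \<Longrightarrow> c *\<^sub>R rvec (B $ j) \<in> basis_cone B I" for c j
    unfolding basis_cone_def by (simp add: convex_cone_hull_mul hull_inc)
  have 0: "0 \<in> basis_cone B I" unfolding basis_cone_def by (rule convex_cone_hull_contains_0)
  have sums: "(\<And>i. i \<in> F \<Longrightarrow> f i \<in> basis_cone B I) \<Longrightarrow> (\<Sum>i\<in>F. f i) \<in> basis_cone B I" for F :: "'a set" and f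
  proof (induction F rule: infinite_finite_induct)
    case (insert i F)
    have "f i + (\<Sum>i\<in>F. f i) \<in> basis_cone B I"
      using insert.IH insert.prems unfolding basis_cone_def by (intro convex_cone_hull_add) auto
    thus ?case using insert.hyps by simp
  qed (simp_all add: 0)
  show "?R \<subseteq> basis_cone B I"
  proof
    fix y assume y: "y \<in> ?R"
    have "(\<Sum>j\<in>UNIV. (rvec (A $ j) \<bullet> y) *\<^sub>R rvec (B $ j)) \<in> basis_cone B I"
    proof (rule sums)
      fix i show "(rvec (A $ i) \<bullet> y) *\<^sub>R rvec (B $ i) \<in> basis_cone B I"
        using y * 0 by (cases "i \<in> I") auto
    qed
    thus "y \<in> basis_cone B I" using dual_bases_expand[OF assms, of y] by simp
  qed
qed

text \<open>Coordinates outside \<open>I\<close> are nonnegative on the larger cone, and their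
  weighted sum vanishes at an interior point of the segment, so they vanish at both ends.\<close>

lemma basis_cone_face:
  assumes "dual_bases A B" "I \<subseteq> J"
  shows "basis_cone B I face_of basis_cone B J"
  unfolding face_of_def
proof (intro conjI ballI impI)
  show "basis_cone B I \<subseteq> basis_cone B J" unfolding basis_cone_def
    by (intro hull_mono image_mono assms(2))
  show "convex (basis_cone B I)"
    by (simp add: basis_cone_def convex_convex_cone_hull)
next
  fix a b x assume a: "a \<in> basis_cone B J" and b: "b \<in> basis_cone B J"
    and x: "x \<in> basis_cone B I" "x \<in> open_segment a b"
  obtain u where u: "0 < u" "u < 1" "x = (1-u) *\<^sub>R a + u *\<^sub>R b"
    using x(2) by (auto simp: in_segment)
  have *: "rvec (A $ j) \<bullet> a = 0 \<and> rvec (A $ j) \<bullet> b = 0" if "j \<notin> I" for j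
  proof -
    have ge: "rvec (A $ j) \<bullet> a \<ge> 0" "rvec (A $ j) \<bullet> b \<ge> 0"
      using a b by (cases "j \<in> J"; simp add: basis_cone_eq[OF assms(1)])+
    have "(1-u) * (rvec (A $ j) \<bullet> a) + u * (rvec (A $ j) \<bullet> b) = 0"
      using x(1) that by (simp add: u(3) basis_cone_eq[OF assms(1)] inner_add_right)
    moreover have "(1-u) * (rvec (A $ j) \<bullet> a) \<ge> 0" "u * (rvec (A $ j) \<bullet> b) \<ge> 0"
      using ge u by auto
    ultimately have "(1-u) * (rvec (A $ j) \<bullet> a) = 0" "u * (rvec (A $ j) \<bullet> b) = 0" by linarith+
    thus ?thesis using u by simp
  qed
  show "a \<in> basis_cone B I" "b \<in> basis_cone B I"
    using a b * assms(2) by (auto simp: basis_cone_eq[OF assms(1)])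
qed

lemma basis_cone_dual:
  assumes "dual_bases A B"
  shows "dual_monoid (basis_cone B I) = {m. \<forall>j\<in>I. ipair m (B $ j) \<ge> 0}"
proof (safe)
  fix m j assume "m \<in> dual_monoid (basis_cone B I)" "j \<in> I"
  moreover from \<open>j \<in> I\<close> have "rvec (B $ j) \<in> basis_cone B I" by (simp add: basis_cone_def hull_inc)
  ultimately show "ipair m (B $ j) \<ge> 0" by (auto simp: dual_monoid_def rvec_inner)
next
  fix m assume *: "\<forall>j\<in>I. ipair m (B $ j) \<ge> 0"
  show "m \<in> dual_monoid (basis_cone B I)" unfolding dual_monoid_def
  proof safe
    fix y assume y: "y \<in> basis_cone B I"
    have "0 \<le> (\<Sum>j\<in>UNIV. of_int (ipair m (B $ j)) * (rvec (A $ j) \<bullet> y))"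
    proof (rule sum_nonneg)
      fix j
      show "0 \<le> of_int (ipair m (B $ j)) * (rvec (A $ j) \<bullet> y)"
        using y * by (cases "j \<in> I") (simp_all add: basis_cone_eq[OF assms])
    qed
    thus "0 \<le> rvec m \<bullet> y" using inner_expand[OF assms, of m y] by simp
  qed
qed

lemma dual_bases_orth:
  assumes "dual_bases A B"
  shows "(\<forall>i\<in>I. ipair (A $ j) (B $ i) = 0) \<longleftrightarrow> j \<notin> I"
  unfolding dual_bases_ipair[OF assms] by (metis zero_neq_one)

lemma basis_cone_orth:
  assumes "dual_bases A B"
  shows "(\<forall>y\<in>basis_cone B I. rvec m \<bullet> y = 0) \<longleftrightarrow> (\<forall>j\<in>I. ipair m (B $ j) = 0)"
proof safe
  fix j assume "\<forall>y\<in>basis_cone B I. rvec m \<bullet> y = 0" "j \<in> I"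
  moreover from \<open>j \<in> I\<close> have "rvec (B $ j) \<in> basis_cone B I" by (simp add: basis_cone_def hull_inc)
  ultimately show "ipair m (B $ j) = 0" by (auto simp: rvec_inner)
next
  fix y assume *: "\<forall>j\<in>I. ipair m (B $ j) = 0" and y: "y \<in> basis_cone B I"
  have "(\<Sum>j\<in>UNIV. of_int (ipair m (B $ j)) * (rvec (A $ j) \<bullet> y)) = 0"
  proof (intro sum.neutral ballI)
    fix j
    show "of_int (ipair m (B $ j)) * (rvec (A $ j) \<bullet> y) = 0"
      using y * by (cases "j \<in> I") (simp_all add: basis_cone_eq[OF assms])
  qed
  thus "rvec m \<bullet> y = 0" using inner_expand[OF assms, of m y] by simp
qed

section \<open>Laurent monomials as local expressions of characters\<close>

definition mon :: "int ^ 'n ^ 'n \<Rightarrow> int ^ 'n \<Rightarrow> complex ^ 'n \<Rightarrow> complex" where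
  "mon B m z = (\<Prod>j\<in>UNIV. z $ j powi ipair m (B $ j))"

text \<open>Absence of a pole at z: the exponent of \<open>z $ j\<close> in \<open>mon B m\<close>
  is the coefficient of m along the j-th vector of the basis dual to \<open>B\<close>. Since
  \<open>0 powi k\<close> is 0 for negative k, \<open>mon\<close> has a meaningless value at a pole,
  and regularity must be recorded separately.\<close>

definition regular_at :: "int ^ 'n ^ 'n \<Rightarrow> int ^ 'n \<Rightarrow> complex ^ 'n \<Rightarrow> bool" where
  "regular_at B m z \<longleftrightarrow> (\<forall>j. z $ j = 0 \<longrightarrow> ipair m (B $ j) \<ge> 0)"

text \<open>At a vanishing coordinate, exponents 1 and -1 would give \<open>0 powi 0 = 1\<close> on
  the left and 0 on the right; regularity of both factors excludes such cancellations.\<close>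

lemma mon_add:
  assumes "regular_at B m z" "regular_at B m' z"
  shows "mon B (m + m') z = mon B m z * mon B m' z"
  unfolding mon_def ipair_add prod.distrib[symmetric]
proof (rule prod.cong[OF refl])
  fix j show "z $ j powi (ipair m (B $ j) + ipair m' (B $ j)) =
    z $ j powi ipair m (B $ j) * z $ j powi ipair m' (B $ j)"
  proof (cases "z $ j = 0")
    case True
    hence "ipair m (B $ j) \<ge> 0" "ipair m' (B $ j) \<ge> 0" using assms by (auto simp: regular_at_def)
    thus ?thesis using True by (simp add: power_int_0_left_if)
  qed (simp add: power_int_add)
qed

lemma mon_eq_0: "mon B m z = 0 \<longleftrightarrow> (\<exists>j. z $ j = 0 \<and> ipair m (B $ j) \<noteq> 0)"
  by (auto simp: mon_def)

lemma mon_0 [simp]: "mon B 0 z = 1" by (simp add: mon_def)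

lemma mon_coord: "dual_bases A B \<Longrightarrow> mon B (A $ j) z = z $ j"
proof -
  assume "dual_bases A B"
  hence "mon B (A $ j) z = (\<Prod>i\<in>UNIV. if j = i then z $ i else 1)"
    unfolding mon_def by (intro prod.cong) (auto simp: dual_bases_ipair)
  thus ?thesis by simp
qed

text \<open>The inverse of \<open>coords A\<close>. The domain of the partial function is read off
  from the zero set of z, which determines the torus orbit.\<close>

definition pt :: "int ^ 'n ^ 'n \<Rightarrow> complex ^ 'n \<Rightarrow> 'n::finite tpoint" where
  "pt B z m = (if regular_at B m z then Some (mon B m z) else None)"

lemma character_pt: "regular_at B m z \<Longrightarrow> character m (pt B z) = mon B m z"
  by (simp add: pt_def character_def)

definition coords :: "int ^ 'n ^ 'n \<Rightarrow> 'n::finite tpoint \<Rightarrow> complex ^ 'n" where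
  "coords A x = (\<chi> j. character (A $ j) x)"

lemma dom_pt: "dom (pt B z) = {m. regular_at B m z}"
  by (auto simp: pt_def dom_def)

lemma regular_basis: "dual_bases A B \<Longrightarrow> regular_at B (A $ j) z"
  by (simp add: regular_at_def dual_bases_ipair)

lemma coords_pt: "dual_bases A B \<Longrightarrow> coords A (pt B z) = z"
  by (simp add: coords_def vec_eq_iff character_pt regular_basis mon_coord)

section \<open>The chart of a smooth cone\<close>

locale toric_chart =
  fixes \<Sigma> :: "(real ^ 'n::finite) set set" and \<sigma> A B J
  assumes smooth: "smooth_fan \<Sigma>" and cone: "\<sigma> \<in> \<Sigma>" and dual: "dual_bases A B"
    and cone_eq: "\<sigma> = basis_cone B J"
begin

lemma fan: "fan \<Sigma>" using smooth by (simp add: smooth_fan_def)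

lemma face_in: "I \<subseteq> J \<Longrightarrow> basis_cone B I \<in> \<Sigma>"
  using fan basis_cone_face[OF dual, of I J] cone_eq cone
  by (auto simp: fan_def basis_cone_def convex_cone_hull_nonempty)

text \<open>A cone of the fan inside \<sigma> is a face of it, and a face of a simplicial cone is
  spanned by the generators it contains: a generator that occurs in a point of the face must itself
  lie in the face.\<close>

lemma subcone:
  assumes "\<tau> \<in> \<Sigma>" "\<tau> \<subseteq> \<sigma>"
  obtains I where "I \<subseteq> J" "\<tau> = basis_cone B I"
proof
  have face: "\<tau> face_of \<sigma>"
    using fan assms cone by (auto simp: fan_def) (metis inf.absorb1)
  have cc: "convex_cone \<tau>"
    using fan assms(1) by (auto simp: fan_def rational_polyhedral_cone_def convex_cone_convex_cone_hull)
  let ?I = "{j\<in>J. rvec (B $ j) \<in> \<tau>}"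
  show "?I \<subseteq> J" by auto
  show "\<tau> = basis_cone B ?I"
  proof
    show "basis_cone B ?I \<subseteq> \<tau>" unfolding basis_cone_def
    proof (rule hull_minimal)
      show "(\<lambda>j. rvec (B $ j)) ` ?I \<subseteq> \<tau>" by auto
    qed (rule cc)
    show "\<tau> \<subseteq> basis_cone B ?I"
    proof
      fix y assume y: "y \<in> \<tau>"
      hence y\<sigma>: "y \<in> basis_cone B J" using assms cone_eq by auto
      have "rvec (B $ j) \<in> \<tau>" if j: "j \<in> J" "rvec (A $ j) \<bullet> y \<noteq> 0" for j
      proof -
        define c where "c = rvec (A $ j) \<bullet> y"
        have c: "c > 0" using y\<sigma> j unfolding basis_cone_eq[OF dual] c_def by force
        \<comment> \<open>The point y is the midpoint of a multiple of the generator and of the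
          doubled rest of its expansion; the face property puts both ends into \<tau>.\<close>
        define a b where "a = (2 * c) *\<^sub>R rvec (B $ j)" and "b = 2 *\<^sub>R (y - c *\<^sub>R rvec (B $ j))"
        have a: "a \<in> \<sigma>" and b: "b \<in> \<sigma>"
          using y\<sigma> j c unfolding cone_eq basis_cone_eq[OF dual] a_def b_def
          by (auto simp: inner_diff_right dual_bases_inner[OF dual] c_def)
        have mid: "y = (1 - 1/2) *\<^sub>R a + (1/2) *\<^sub>R b" by (simp add: a_def b_def algebra_simps)
        have "a \<in> \<tau>"
        proof (cases "a = b")
          case True thus ?thesis using mid y by (simp add: algebra_simps flip: scaleR_add_left)
        next
          case False
          hence "y \<in> open_segment a b" unfolding in_segment using mid by (auto intro!: exI[of _ "1/2"])
          thus ?thesis using face a b y unfolding face_of_def by blast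
        qed
        hence "(1 / (2*c)) *\<^sub>R a \<in> \<tau>" using c by (intro convex_cone_scaleR[OF cc]) auto
        thus ?thesis using c by (simp add: a_def)
      qed
      thus "y \<in> basis_cone B ?I" using y\<sigma> unfolding basis_cone_eq[OF dual] by auto
    qed
  qed
qed

text \<open>The orbit of \<open>pt B z\<close> belongs to the face spanned by the generators whose
  coordinates vanish; all of these have their index in \<open>J\<close>.\<close>

lemma pt_in: 
  assumes "\<And>j. j \<notin> J \<Longrightarrow> z $ j \<noteq> 0"
  shows "pt B z \<in> affine_piece \<Sigma> \<sigma>"
proof -
  let ?I = "{j. z $ j = 0}"
  let ?\<tau> = "basis_cone B ?I"
  have I: "?I \<subseteq> J" using assms by auto
  have dm: "dual_monoid ?\<tau> = {m. regular_at B m z}"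
    by (auto simp: basis_cone_dual[OF dual] regular_at_def)
  have "pt B z \<in> toric_variety \<Sigma>" unfolding toric_variety_def
  proof (intro CollectI bexI[of _ ?\<tau>] conjI ballI)
    show "dom (pt B z) = dual_monoid ?\<tau>" by (simp add: dm dom_pt)
    show "character 0 (pt B z) = 1" by (simp add: character_pt regular_at_def)
  next
    fix m m' assume "m \<in> dual_monoid ?\<tau>" "m' \<in> dual_monoid ?\<tau>"
    hence r: "regular_at B m z" "regular_at B m' z" by (auto simp: dm)
    hence "regular_at B (m + m') z" by (auto simp: regular_at_def ipair_add)
    with r show "character (m + m') (pt B z) = character m (pt B z) * character m' (pt B z)"
      by (simp add: character_pt mon_add)
  next
    fix m assume "m \<in> dual_monoid ?\<tau>"
    thus "(character m (pt B z) \<noteq> 0) = (\<forall>y\<in>?\<tau>. rvec m \<bullet> y = 0)"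
      by (auto simp: dm character_pt mon_eq_0 basis_cone_orth[OF dual])
  next
    show "?\<tau> \<in> \<Sigma>" using face_in I by simp
  qed
  moreover have "dual_monoid \<sigma> \<subseteq> dom (pt B z)"
    using I by (auto simp: dom_pt cone_eq basis_cone_dual[OF dual] regular_at_def)
  ultimately show ?thesis by (simp add: affine_piece_def)
qed

text \<open>The orbit cone of x is a face of \<sigma> whose index set \<open>I\<close> is the set of
  vanishing coordinates. Every character regular at x is an integral combination of the
  \<open>A $ j\<close> with nonnegative coefficients on \<open>I\<close>, so multiplicativity
  determines its value from the coordinates.\<close>

lemma piece_coords:
  assumes x: "x \<in> affine_piece \<Sigma> \<sigma>"
  shows "pt B (coords A x) = x" and "j \<notin> J \<Longrightarrow> coords A x $ j \<noteq> 0"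
proof -
  obtain \<tau> where \<tau>: "\<tau> \<in> \<Sigma>" "dom x = dual_monoid \<tau>" "character 0 x = 1"
    and mult: "\<And>m m'. m \<in> dual_monoid \<tau> \<Longrightarrow> m' \<in> dual_monoid \<tau> \<Longrightarrow>
           character (m + m') x = character m x * character m' x"
    and nz: "\<And>m. m \<in> dual_monoid \<tau> \<Longrightarrow> character m x \<noteq> 0 \<longleftrightarrow> (\<forall>y\<in>\<tau>. rvec m \<bullet> y = 0)"
    using x by (auto simp: affine_piece_def toric_variety_def)
  have sub: "dual_monoid \<sigma> \<subseteq> dual_monoid \<tau>" using x \<tau> by (auto simp: affine_piece_def)
  have dA: "A $ j \<in> dual_monoid \<sigma>" for j
    by (auto simp: cone_eq basis_cone_dual[OF dual] dual_bases_ipair[OF dual])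
  have dA': "- A $ j \<in> dual_monoid \<sigma>" if "j \<notin> J" for j
    using that by (auto simp: cone_eq basis_cone_dual[OF dual] dual_bases_ipair[OF dual] ipair_uminus)
  \<comment> \<open>The cone \<sigma> is cut out by characters of its own dual monoid:
    \<open>A $ j\<close> for all j, and also \<open>- A $ j\<close> for j outside \<open>J\<close>.
    The dual monoid of \<tau> is larger, so they are nonnegative on \<tau> too.\<close>
  have ts: "\<tau> \<subseteq> \<sigma>"
  proof
    fix y assume y: "y \<in> \<tau>"
    have "rvec (A $ j) \<bullet> y \<ge> 0" for j using sub dA y by (auto simp: dual_monoid_def)
    moreover have "rvec (A $ j) \<bullet> y \<le> 0" if "j \<notin> J" for j 
    proof -
      have "- A $ j \<in> dual_monoid \<tau>" using sub dA'[OF that] by auto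
      thus ?thesis using y by (auto simp: dual_monoid_def rvec_uminus)
    qed
    ultimately show "y \<in> \<sigma>" unfolding cone_eq basis_cone_eq[OF dual]
      by (auto intro: antisym)
  qed
  then obtain I where I: "I \<subseteq> J" "\<tau> = basis_cone B I" using \<tau> subcone by blast
  have dm: "dual_monoid \<tau> = {m. \<forall>j\<in>I. ipair m (B $ j) \<ge> 0}"
    by (simp add: I basis_cone_dual[OF dual])
  define z where "z = coords A x"
  have z0: "z $ j = 0 \<longleftrightarrow> j \<in> I" for j
  proof -
    have "A $ j \<in> dual_monoid \<tau>" using dA sub by auto
    from nz[OF this] show ?thesis
      by (simp add: z_def coords_def I basis_cone_orth[OF dual] dual_bases_orth[OF dual])
  qed
  show "j \<notin> J \<Longrightarrow> coords A x $ j \<noteq> 0" using z0[of j] I by (auto simp: z_def)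
  have reg: "dual_monoid \<tau> = {m. regular_at B m z}" by (auto simp: dm regular_at_def z0)
  have pow: "character (int k *s m) x = character m x ^ k \<and> int k *s m \<in> dual_monoid \<tau>" if "m \<in> dual_monoid \<tau>" for m k
  proof (induction k)
    case 0 show ?case using \<tau>(3) by (simp add: dm)
  next
    case (Suc k)
    have "int (Suc k) *s m = m + int k *s m" by (simp add: vec_eq_iff algebra_simps)
    thus ?case using Suc that mult[of m "int k *s m"] by (simp add: dm ipair_add)
  qed
  have inv: "character (- m) x = inverse (character m x)" if "m \<in> dual_monoid \<tau>" "- m \<in> dual_monoid \<tau>" for m
    using mult[OF that] \<tau>(3) by (metis add.right_inverse inverse_unique)
  have trm: "character (k *s A $ j) x = z $ j powi k \<and> k *s A $ j \<in> dual_monoid \<tau>" 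
    if "z $ j = 0 \<Longrightarrow> k \<ge> 0" for k j
  proof (cases "k \<ge> 0")
    case True
    then obtain n where n: "k = int n" using nonneg_int_cases by blast
    have "A $ j \<in> dual_monoid \<tau>" using dA sub by auto
    from pow[OF this, of n] show ?thesis by (simp add: n z_def coords_def)
  next
    case False
    \<comment> \<open>A negative exponent occurs only at a nonzero coordinate, that is for j outside
      \<open>I\<close>. There \<open>A $ j\<close> and its negative both lie in the dual monoid, and
      their values are inverse to each other.\<close>
    then obtain n where n: "k = - int n" by (metis int_cases2 nle_le of_nat_0_le_iff)
    have "j \<notin> I" using that False z0 by auto
    have m: "int n *s A $ j \<in> dual_monoid \<tau>" "character (int n *s A $ j) x = z $ j ^ n"
      using pow[of "A $ j" n] dA[of j] sub by (auto simp: z_def coords_def)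
    have m': "- (int n *s A $ j) \<in> dual_monoid \<tau>"
      using \<open>j \<notin> I\<close> by (auto simp: dm ipair_uminus ipair_smult dual_bases_ipair[OF dual])
    have "k *s A $ j = - (int n *s A $ j)" by (simp add: n vec_eq_iff)
    thus ?thesis using inv[OF m(1) m'] m m' by (simp add: n power_int_minus)
  qed
  have "character (\<Sum>j\<in>F. k j *s A $ j) x = (\<Prod>j\<in>F. z $ j powi k j) \<and> (\<Sum>j\<in>F. k j *s A $ j) \<in> dual_monoid \<tau>"
    if "\<And>j. z $ j = 0 \<Longrightarrow> k j \<ge> 0" and "finite F" for k F
    using that(2)
  proof (induction F)
    case empty thus ?case using \<tau>(3) by (simp add: dm)
  next
    case (insert j F)
    thus ?case using mult[of "k j *s A $ j" "\<Sum>j\<in>F. k j *s A $ j"] trm[of j "k j"] that(1)[of j]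
      by (simp add: dm ipair_add)
  qed
  from this[of _ UNIV] have val: "character m x = mon B m z" if "regular_at B m z" for m
    using that dual_bases_expand_int[OF dual, of m] by (simp add: mon_def regular_at_def) metis
  show "pt B (coords A x) = x"
  proof
    fix m show "pt B (coords A x) m = x m"
    proof (cases "regular_at B m z")
      case True
      hence "m \<in> dom x" using \<tau> reg by auto
      thus ?thesis using val[OF True] True by (auto simp: pt_def z_def[symmetric] character_def)
    next
      case False
      hence "m \<notin> dom x" using \<tau> reg by auto
      thus ?thesis using False by (auto simp: pt_def z_def[symmetric] domIff)
    qed
  qed
qed

definition "chart = (affine_piece \<Sigma> \<sigma>, coords A)"

text \<open>The affine piece of a smooth cone is a product of complex lines, one for each generator,
  and of punctured complex lines.\<close>

definition "coord_range = {z :: complex ^ 'n. \<forall>j. j \<notin> J \<longrightarrow> z $ j \<noteq> 0}"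

lemma image_chart: "snd chart ` fst chart = coord_range"
proof (safe)
  fix x assume "x \<in> fst chart" thus "snd chart x \<in> coord_range"
    using piece_coords(2) by (auto simp: chart_def coord_range_def)
next
  fix z assume "z \<in> coord_range"
  hence "pt B z \<in> fst chart" using pt_in by (auto simp: chart_def coord_range_def)
  moreover have "snd chart (pt B z) = z" by (simp add: chart_def coords_pt[OF dual])
  ultimately show "z \<in> snd chart ` fst chart" by (metis imageI)
qed

lemma inj_chart: "inj_on (snd chart) (fst chart)"
  by (rule inj_on_inverseI[of _ "pt B"]) (simp add: chart_def piece_coords)

lemma pt_chart [simp]: "x \<in> fst chart \<Longrightarrow> pt B (snd chart x) = x"
  by (simp add: chart_def piece_coords)

lemma chart_pt [simp]: "snd chart (pt B z) = z"
  by (simp add: chart_def coords_pt[OF dual])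

lemma pt_mem: "z \<in> coord_range \<Longrightarrow> pt B z \<in> fst chart"
  using pt_in by (auto simp: chart_def coord_range_def)

lemma chart_mem: "x \<in> fst chart \<Longrightarrow> snd chart x \<in> coord_range"
  using image_chart by auto

lemma coord_inv_chart [simp]: "z \<in> coord_range \<Longrightarrow> coord_inv chart z = pt B z"
  unfolding coord_inv_def by (rule inv_into_f_eq[OF inj_chart pt_mem]) auto

lemma coord_inv_at: "x \<in> fst chart \<Longrightarrow> coord_inv chart (snd chart x) = x"
  unfolding coord_inv_def by (rule inv_into_f_f[OF inj_chart])

lemma open_coord_range: "open coord_range"
proof -
  have "coord_range = (\<Inter>j\<in>-J. {z. z $ j \<noteq> 0})" by (auto simp: coord_range_def)
  moreover have "open {z :: complex ^ 'n. z $ j \<noteq> 0}" for j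
    by (intro open_Collect_neq continuous_intros)
  ultimately show ?thesis by (auto intro!: open_INT)
qed

lemma chart_in_atlas: "chart \<in> toric_atlas \<Sigma>"
proof -
  have "adapted_bases \<sigma> A B" using dual cone_eq
    unfolding adapted_bases_def dual_bases_def basis_cone_def by blast
  thus ?thesis using cone unfolding toric_atlas_def chart_def coords_def by blast
qed

lemma chart_toric: "x \<in> fst chart \<Longrightarrow> x \<in> toric_variety \<Sigma>"
  by (simp add: chart_def affine_piece_def)

end

lemma atlasE:
  assumes "c \<in> toric_atlas \<Sigma>" "smooth_fan \<Sigma>"
  obtains \<sigma> A B J where "toric_chart \<Sigma> \<sigma> A B J" "c = toric_chart.chart \<Sigma> \<sigma> A"
proof -
  from assms(1) obtain \<sigma> A B J where *: "\<sigma> \<in> \<Sigma>" "A ** transpose B = mat 1" "\<sigma> = convex_cone hull ((\<lambda>j. rvec (B $ j)) ` J)"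
    "c = (affine_piece \<Sigma> \<sigma>, \<lambda>x. \<chi> j. character (A $ j) x)"
    by (auto simp: toric_atlas_def adapted_bases_def)
  then interpret toric_chart \<Sigma> \<sigma> A B J using assms(2)
    by unfold_locales (simp_all add: dual_bases_def basis_cone_def)
  have "c = chart" unfolding *(4) chart_def by (simp add: coords_def fun_eq_iff)
  with toric_chart_axioms show ?thesis by (rule that)
qed

lemma chart_of_cone:
  fixes \<Sigma> :: "(real ^ 'n::finite) set set"
  assumes "smooth_fan \<Sigma>" "\<sigma> \<in> \<Sigma>"
  obtains A B J where "toric_chart \<Sigma> \<sigma> A B J"
proof -
  from assms obtain A B :: "int ^ 'n ^ 'n" and J
    where "A ** transpose B = mat 1" "\<sigma> = convex_cone hull ((\<lambda>j. rvec (B $ j)) ` J)"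
    unfolding smooth_fan_def adapted_bases_def by blast
  with assms have "toric_chart \<Sigma> \<sigma> A B J" by (simp add: toric_chart_def dual_bases_def basis_cone_def)
  thus ?thesis by (rule that)
qed

text \<open>The chart is that of the orbit cone of the point, so \<open>J\<close> is exactly the set
  of vanishing coordinates; in the chart of a larger cone only one inclusion holds.\<close>

lemma toric_variety_chart:
  assumes "smooth_fan \<Sigma>" "x \<in> toric_variety \<Sigma>"
  obtains \<sigma> A B J where "toric_chart \<Sigma> \<sigma> A B J" "x \<in> fst (toric_chart.chart \<Sigma> \<sigma> A)"
    "\<And>j. j \<in> J \<longleftrightarrow> coords A x $ j = 0"
proof -
  obtain \<tau> where \<tau>: "\<tau> \<in> \<Sigma>" "dom x = dual_monoid \<tau>" 
    and nz: "\<forall>m \<in> dual_monoid \<tau>. character m x \<noteq> 0 \<longleftrightarrow> (\<forall>y\<in>\<tau>. rvec m \<bullet> y = 0)"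
    using assms(2) by (auto simp: toric_variety_def)
  obtain A B J where c: "toric_chart \<Sigma> \<tau> A B J" using chart_of_cone[OF assms(1) \<tau>(1)] .
  interpret toric_chart \<Sigma> \<tau> A B J by fact
  have "x \<in> fst chart" using assms \<tau> by (simp add: chart_def affine_piece_def)
  moreover have "j \<in> J \<longleftrightarrow> coords A x $ j = 0" for j
  proof -
    have "A $ j \<in> dual_monoid \<tau>"
      by (auto simp: cone_eq basis_cone_dual[OF dual] dual_bases_ipair[OF dual])
    with nz have "character (A $ j) x \<noteq> 0 \<longleftrightarrow> (\<forall>y\<in>\<tau>. rvec (A $ j) \<bullet> y = 0)" by blast
    thus ?thesis
      by (simp add: coords_def cone_eq basis_cone_orth[OF dual] dual_bases_orth[OF dual])
  qed
  ultimately show ?thesis using that c by blast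
qed

section \<open>Monomials and changes of charts\<close>

text \<open>The formula also covers \<open>w = 0\<close>, where \<open>k = 0\<close> is the delicate
  case: the factor \<open>of_int k\<close> annihilates the power with exponent -1.\<close>

lemma has_derivative_power_int_nonneg:
  fixes w :: "'a::real_normed_field"
  assumes "w = 0 \<Longrightarrow> k \<ge> 0"
  shows "((\<lambda>w. w powi k) has_derivative (\<lambda>v. of_int k * w powi (k - 1) * v)) (at w)"
proof (cases "k \<ge> 0")
  case True
  then obtain n where n: "k = int n" using nonneg_int_cases by blast
  have *: "of_int k * w powi (k - 1) = of_nat n * w ^ (n - 1)"
  proof (cases n)
    case (Suc m) thus ?thesis by (simp add: n)
  qed (simp add: n)
  have "((\<lambda>w. w ^ n) has_derivative (\<lambda>v. of_nat n * w ^ (n - 1) * v)) (at w)"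
    by (auto intro!: derivative_eq_intros)
  thus ?thesis unfolding * unfolding n power_int_of_nat .
next
  case False
  hence "w \<noteq> 0" using assms by auto
  thus ?thesis by (auto intro!: derivative_eq_intros simp: mult_ac)
qed

lemma continuous_on_powi_nonneg:
  fixes f :: "'a::topological_space \<Rightarrow> 'b::real_normed_field"
  assumes "continuous_on S f" "\<And>z. z \<in> S \<Longrightarrow> f z = 0 \<Longrightarrow> k \<ge> 0"
  shows "continuous_on S (\<lambda>z. f z powi k)"
proof (cases "k \<ge> 0")
  case True
  thus ?thesis using assms(1) by (auto simp: power_int_nonneg_exp intro!: continuous_intros)
next
  case False
  hence "\<forall>z\<in>S. f z \<noteq> 0" using assms by auto
  thus ?thesis using assms(1) by (auto intro!: continuous_intros)
qed

text \<open>At a zero of f the exponent k - 1 can be negative only for \<open>k = 0\<close>, and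
  then the whole expression is constantly 0.\<close>

lemma continuous_on_powi_deriv:
  fixes f :: "'a::topological_space \<Rightarrow> 'b::real_normed_field"
  assumes "continuous_on S f" "\<And>z. z \<in> S \<Longrightarrow> f z = 0 \<Longrightarrow> k \<ge> 0"
  shows "continuous_on S (\<lambda>z. of_int k * f z powi (k - 1))"
proof (cases "k = 0")
  case False
  have "z \<in> S \<Longrightarrow> f z = 0 \<Longrightarrow> k - 1 \<ge> 0" for z using False assms(2)[of z] by linarith
  thus ?thesis by (intro continuous_intros continuous_on_powi_nonneg assms(1))
qed simp

text \<open>The partial derivative of \<open>mon B m\<close> with respect to \<open>z $ l\<close>.
  The factor of \<open>z $ l\<close> is split off instead of dividing \<open>mon\<close> by
  \<open>z $ l\<close>, so that the formula is right on the divisors as well.\<close>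

definition dmon :: "int ^ 'n ^ 'n \<Rightarrow> int ^ 'n \<Rightarrow> complex ^ 'n \<Rightarrow> 'n::finite \<Rightarrow> complex" where
  "dmon B m z l = of_int (ipair m (B $ l)) * z $ l powi (ipair m (B $ l) - 1) *
     (\<Prod>j\<in>UNIV - {l}. z $ j powi ipair m (B $ j))"

lemma has_derivative_mon:
  assumes "regular_at B m z"
  shows "(mon B m has_derivative (\<lambda>v. \<Sum>l\<in>UNIV. dmon B m z l * v $ l)) (at z)"
proof -
  have "((\<lambda>z. z $ j powi ipair m (B $ j)) has_derivative
      (\<lambda>v. of_int (ipair m (B $ j)) * z $ j powi (ipair m (B $ j) - 1) * v $ j)) (at z)" for j
  proof -
    have "((\<lambda>z. z $ j) has_derivative (\<lambda>v. v $ j)) (at z)"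
      by (rule bounded_linear_imp_has_derivative[OF bounded_linear_vec_nth])
    moreover have "((\<lambda>w. w powi ipair m (B $ j)) has_derivative
       (\<lambda>v. of_int (ipair m (B $ j)) * z $ j powi (ipair m (B $ j) - 1) * v)) (at (z $ j))"
      by (rule has_derivative_power_int_nonneg) (use assms in \<open>auto simp: regular_at_def\<close>)
    ultimately show ?thesis by (rule has_derivative_compose)
  qed
  from has_derivative_prod[where I = UNIV, OF this] show ?thesis
    unfolding mon_def[abs_def] dmon_def by (simp add: mult_ac)
qed

lemma continuous_on_mon:
  assumes "\<And>z. z \<in> S \<Longrightarrow> regular_at B m z"
  shows "continuous_on S (mon B m)"
  unfolding mon_def[abs_def]
  by (intro continuous_intros continuous_on_powi_nonneg) (use assms in \<open>auto simp: regular_at_def\<close>)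

lemma continuous_on_dmon:
  assumes "\<And>z. z \<in> S \<Longrightarrow> regular_at B m z"
  shows "continuous_on S (\<lambda>z. dmon B m z l)"
  unfolding dmon_def
  by (intro continuous_intros continuous_on_powi_nonneg continuous_on_powi_deriv)
    (use assms in \<open>auto simp: regular_at_def\<close>)

lemma dmon_nonzero:
  assumes "\<And>j. z $ j \<noteq> 0"
  shows "dmon B m z l = mon B m z * of_int (ipair m (B $ l)) / z $ l"
proof -
  have "mon B m z = z $ l powi ipair m (B $ l) * (\<Prod>j\<in>UNIV - {l}. z $ j powi ipair m (B $ j))"
    unfolding mon_def by (rule prod.remove) auto
  thus ?thesis using assms[of l] by (simp add: dmon_def power_int_diff)
qed

lemma has_derivative_vecI:
  fixes f :: "'a::euclidean_space \<Rightarrow> 'b::real_normed_vector ^ 'n::finite"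
  assumes "\<And>i. ((\<lambda>z. f z $ i) has_derivative (\<lambda>v. D v $ i)) (at z within S)"
  shows "(f has_derivative D) (at z within S)"
  unfolding has_derivative_within
proof
  have "linear (\<lambda>v. D v $ i)" for i using has_derivative_linear[OF assms] .
  hence "linear D" by (simp add: linear_iff vec_eq_iff)
  thus "bounded_linear D" by (simp add: linear_conv_bounded_linear)
  show "((\<lambda>y. (1 / norm (y - z)) *\<^sub>R (f y - (f z + D (y - z)))) \<longlongrightarrow> 0) (at z within S)"
  proof (rule vec_tendstoI)
    fix i show "((\<lambda>y. ((1 / norm (y - z)) *\<^sub>R (f y - (f z + D (y - z)))) $ i) \<longlongrightarrow> 0 $ i) (at z within S)"
      using assms[of i] by (simp add: has_derivative_within)
  qed
qed

text \<open>Points with a vanishing coordinate are limits of points of the open torus.\<close>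

lemma eq_from_torus:
  fixes f g :: "complex ^ 'n::finite \<Rightarrow> 'b::t2_space"
  assumes "open W" "z \<in> W" "continuous_on W f" "continuous_on W g"
    and "\<And>z. z \<in> W \<Longrightarrow> (\<And>j. z $ j \<noteq> 0) \<Longrightarrow> f z = g z"
  shows "f z = g z"
proof -
  define s where "s k = (\<chi> j. if z $ j = 0 then 1 / of_nat (Suc k) else z $ j)" for k
  have lim: "s \<longlonglongrightarrow> z"
    unfolding s_def
  proof (intro vec_tendstoI)
    fix i show "(\<lambda>k. (\<chi> j. if z $ j = 0 then 1 / of_nat (Suc k) else z $ j) $ i) \<longlonglongrightarrow> z $ i"
      using LIMSEQ_Suc[OF lim_1_over_n[where 'a=complex]] by (cases "z $ i = 0") auto
  qed
  have nz: "s k $ j \<noteq> 0" for k j by (auto simp: s_def simp del: of_nat_Suc)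
  have ev: "eventually (\<lambda>k. s k \<in> W) sequentially"
    using lim assms(1,2) by (rule topological_tendstoD)
  have "isCont f z" "isCont g z"
    using assms(1-4) by (auto simp: continuous_on_eq_continuous_at)
  hence "(\<lambda>k. f (s k)) \<longlonglongrightarrow> f z" "(\<lambda>k. g (s k)) \<longlonglongrightarrow> g z"
    using lim isCont_tendsto_compose by blast+
  moreover have "eventually (\<lambda>k. f (s k) = g (s k)) sequentially"
    using ev by (rule eventually_mono) (use assms(5) nz in auto)
  ultimately have "(\<lambda>k. g (s k)) \<longlonglongrightarrow> f z" "(\<lambda>k. g (s k)) \<longlonglongrightarrow> g z"
    using tendsto_cong by force+
  thus ?thesis by (rule LIMSEQ_unique)
qed

text \<open>This is the determinant of diag(a) M diag(b). On the open torus, Jacobians of monomial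
  maps and matrices of fundamental vectors have this shape, with M independent of z.\<close>

lemma det_scale_rows_columns:
  fixes M :: "complex ^ 'n ^ 'n::finite"
  shows "det (\<chi> k l. a k * M $ k $ l * b l) = prod a UNIV * det M * prod b UNIV"
proof -
  have "det (\<chi> k l. a k * M $ k $ l * b l) = det (\<chi> k. a k *s (\<chi> l. M $ k $ l * b l))"
    by (simp add: vector_scalar_mult_def mult.assoc)
  also have "\<dots> = prod a UNIV * det (\<chi> k l. M $ k $ l * b l)"
    by (simp add: det_rows_mul)
  also have "det (\<chi> k l. M $ k $ l * b l) = det (transpose (\<chi> l k. M $ k $ l * b l) :: complex^'n^'n)"
    by (rule arg_cong[of _ _ det]) (simp add: transpose_def)
  also have "\<dots> = det (\<chi> l. b l *s (\<chi> k. M $ k $ l))"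
    unfolding det_transpose by (rule arg_cong[of _ _ det]) (simp add: vector_scalar_mult_def vec_eq_iff)
  also have "\<dots> = prod b UNIV * det (transpose M)"
    by (simp add: det_rows_mul transpose_def)
  finally show ?thesis by simp
qed

lemma continuous_on_det [continuous_intros]:
  fixes f :: "'a::topological_space \<Rightarrow> 'b::real_normed_field ^ 'n ^ 'n::finite"
  assumes "continuous_on S f"
  shows "continuous_on S (\<lambda>x. det (f x))"
  unfolding det_def by (intro continuous_intros assms)

definition cmat :: "int ^ 'n ^ 'm \<Rightarrow> complex ^ 'n ^ 'm" where
  "cmat A = (\<chi> i j. of_int (A $ i $ j))"

lemma det_cmat: "det (cmat A) = of_int (det (A :: int ^ 'n ^ ('n::finite)))"
  by (simp add: det_def cmat_def)

lemma dual_bases_det: 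
  assumes "dual_bases A B" shows "det A * det B = 1" "det A * det A = 1" "det B = det A"
proof -
  show 1: "det A * det B = 1"
    using assms det_mul[of A "transpose B"] by (simp add: dual_bases_def)
  hence "\<bar>det A\<bar> = 1" "det A = 1 \<longrightarrow> det B = 1" "det A = -1 \<longrightarrow> det B = -1"
    using zmult_eq_1_iff by auto
  thus "det A * det A = 1" "det B = det A" by (auto simp: abs_if split: if_splits)
qed

text \<open>A generator pairs to 1 with its dual basis vector, which forces any integral factor of
  it to be a unit.\<close>

lemma ray_generators_of_cone:
  assumes "toric_chart \<Sigma> \<sigma> A B J" "j \<in> J"
  shows "B $ j \<in> ray_generators \<Sigma>"
proof -
  interpret toric_chart \<Sigma> \<sigma> A B J by fact
  have "primitive (B $ j)" unfolding primitive_def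
  proof (intro allI impI)
    fix k w assume "B $ j = k *s w"
    hence "k * ipair (A $ j) w = 1"
      using dual_bases_ipair[OF dual, of j j] by (simp add: ipair_smult_right)
    thus "\<bar>k\<bar> = 1" by (auto simp: zmult_eq_1_iff)
  qed
  moreover have "convex_cone hull {rvec (B $ j)} \<in> \<Sigma>"
    using face_in[of "{j}"] assms(2) by (simp add: basis_cone_def)
  ultimately show ?thesis by (simp add: ray_generators_def)
qed

text \<open>The coefficient of the form w dlog t_1 ... dlog t_n, with t the standard coordinates of
  the torus. The sign \<open>det A\<close>, which is 1 or -1, compares dlog t with dlog z, and each
  dlog contributes the -1 in an exponent. For j in \<open>J\<close> the Calabi--Yau condition makes
  the exponent 0, so the coefficient is regular and nonzero on the divisors.\<close>

definition vol :: "int ^ 'n ^ 'n \<Rightarrow> int ^ 'n ^ 'n \<Rightarrow> int ^ 'n \<Rightarrow> complex ^ 'n \<Rightarrow> complex" where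
  "vol A B \<nu> z = of_int (det A) * (\<Prod>j\<in>UNIV. z $ j powi (ipair \<nu> (B $ j) - 1))"

lemma vol_nonzero:
  assumes "\<And>j. z $ j \<noteq> 0"
  shows "vol A B \<nu> z = of_int (det A) * mon B \<nu> z / (\<Prod>j\<in>UNIV. z $ j)"
  using assms by (simp add: vol_def mon_def power_int_diff prod_dividef)

locale cy_chart = toric_chart +
  fixes \<nu>
  assumes cy: "\<And>v. v \<in> ray_generators \<Sigma> \<Longrightarrow> rvec \<nu> \<bullet> rvec v = 1"
begin

lemma height_1: "j \<in> J \<Longrightarrow> ipair \<nu> (B $ j) = 1"
  using cy[OF ray_generators_of_cone[OF toric_chart_axioms]] by (simp add: rvec_inner)

lemma regular_\<nu>: "z \<in> coord_range \<Longrightarrow> regular_at B \<nu> z"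
  using height_1 by (metis (mono_tags, lifting) coord_range_def mem_Collect_eq regular_at_def zero_le_one)

lemma regular_\<nu>_pt: "x \<in> fst chart \<Longrightarrow> character \<nu> x = mon B \<nu> (snd chart x)"
  using regular_\<nu>[OF chart_mem] pt_chart character_pt by metis

lemma mon_\<nu>_zero: "z \<in> coord_range \<Longrightarrow> mon B \<nu> z = 0 \<longleftrightarrow> (\<exists>j. z $ j = 0)"
  using height_1 by (force simp: mon_eq_0 coord_range_def)

lemma vol_nz: "z \<in> coord_range \<Longrightarrow> vol A B \<nu> z \<noteq> 0"
  using height_1 dual_bases_det[OF dual] by (force simp: vol_def coord_range_def)

lemma vol_cont: "continuous_on coord_range (vol A B \<nu>)"
proof -
  have "0 \<le> ipair \<nu> (B $ j) - 1" if "z \<in> coord_range" "z $ j = 0" for j z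
  proof -
    have "j \<in> J" using that by (auto simp: coord_range_def)
    thus ?thesis using height_1 by simp
  qed
  thus ?thesis unfolding vol_def[abs_def]
    by (intro continuous_intros continuous_on_powi_nonneg)
qed

end

locale chart_change = c: cy_chart \<Sigma> \<sigma> A B J \<nu> + c': cy_chart \<Sigma> \<sigma>' A' B' J' \<nu>
  for \<Sigma> :: "(real ^ 'n::finite) set set" and \<sigma> A B J \<nu> \<sigma>' A' B' J'
begin

definition "overlap = snd c.chart ` (fst c.chart \<inter> fst c'.chart)"

definition trans_map :: "complex ^ 'n \<Rightarrow> complex ^ 'n" where
  "trans_map z = (\<chi> k. mon B (A' $ k) z)"

definition jac :: "complex ^ 'n \<Rightarrow> complex ^ 'n ^ 'n" where
  "jac z = (\<chi> k l. dmon B (A' $ k) z l)"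

lemma overlap_eq: "overlap = {z \<in> c.coord_range. \<forall>m \<in> dual_monoid \<sigma>'. regular_at B m z}"
proof safe
  fix z assume "z \<in> overlap"
  then obtain x where x: "x \<in> fst c.chart" "x \<in> fst c'.chart" "z = snd c.chart x"
    by (auto simp: overlap_def)
  show "z \<in> c.coord_range" using x c.chart_mem by simp
  fix m assume "m \<in> dual_monoid \<sigma>'"
  hence "m \<in> dom x" using x by (auto simp: c'.chart_def affine_piece_def)
  moreover have "x = pt B z" using x by simp
  ultimately show "regular_at B m z" using dom_pt[of B z] by auto
next
  fix z assume z: "z \<in> c.coord_range" "\<forall>m \<in> dual_monoid \<sigma>'. regular_at B m z"
  have x: "pt B z \<in> fst c.chart" using c.pt_mem z by simp
  hence "pt B z \<in> fst c'.chart" using z c.chart_toric[OF x] by (auto simp: c'.chart_def affine_piece_def dom_pt)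
  with x show "z \<in> overlap" by (auto simp: overlap_def intro!: image_eqI[of _ _ "pt B z"])
qed

lemma overlap_sub: "overlap \<subseteq> c.coord_range" by (auto simp: overlap_eq)

text \<open>Regularity depends only on which coordinates vanish and is easier for fewer of them;
  near z no nonzero coordinate becomes zero.\<close>

lemma open_overlap: "open overlap"
proof (subst open_subopen, intro ballI)
  fix z assume z: "z \<in> overlap"
  let ?U = "{z' :: complex ^ 'n. \<forall>j\<in>{j. z $ j \<noteq> 0}. z' $ j \<noteq> 0}"
  have eq: "?U = (\<Inter>j\<in>{j. z $ j \<noteq> 0}. {z'. z' $ j \<noteq> 0})" by auto
  have "open ?U" unfolding eq
    by (intro open_INT finite ballI open_Collect_neq continuous_intros)
  moreover have "?U \<subseteq> overlap" using z by (auto simp: overlap_eq c.coord_range_def regular_at_def)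
  ultimately show "\<exists>T. open T \<and> z \<in> T \<and> T \<subseteq> overlap" by blast
qed

lemma regular_A': "z \<in> overlap \<Longrightarrow> regular_at B (A' $ k) z"
proof -
  have "A' $ k \<in> dual_monoid \<sigma>'"
    by (simp add: c'.cone_eq basis_cone_dual[OF c'.dual] dual_bases_ipair[OF c'.dual])
  thus "z \<in> overlap \<Longrightarrow> regular_at B (A' $ k) z" by (auto simp: overlap_eq)
qed

lemma in_coords_eq: "z \<in> overlap \<Longrightarrow> in_coords c.chart c'.chart (\<lambda>x. x) z = trans_map z"
  using overlap_sub regular_A'
  by (auto simp: in_coords_def trans_map_def vec_eq_iff c'.chart_def coords_def character_pt
      c.coord_inv_chart[folded c'.chart_def] subset_iff)

lemma trans_map_coord: "x \<in> fst c.chart \<Longrightarrow> x \<in> fst c'.chart \<Longrightarrow> trans_map (snd c.chart x) = snd c'.chart x"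
  using in_coords_eq[of "snd c.chart x"] c.coord_inv_at[of x]
  by (auto simp: in_coords_def overlap_def)

lemma has_derivative_trans_map: "z \<in> overlap \<Longrightarrow> (trans_map has_derivative (\<lambda>v. jac z *v v)) (at z)"
proof (rule has_derivative_vecI)
  fix i assume "z \<in> overlap"
  from has_derivative_mon[OF regular_A'[OF this, of i]]
  show "((\<lambda>z. trans_map z $ i) has_derivative (\<lambda>v. (jac z *v v) $ i)) (at z)"
    by (simp add: trans_map_def jac_def matrix_vector_mult_def)
qed

lemma has_derivative_in_coords:
  assumes "z \<in> overlap"
  shows "(in_coords c.chart c'.chart (\<lambda>x. x) has_derivative (\<lambda>v. jac z *v v)) (at z)"
  by (rule has_derivative_transform_within_open[OF has_derivative_trans_map[OF assms] open_overlap assms])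
    (simp add: in_coords_eq)

lemma continuous_on_jac: "continuous_on overlap jac"
  unfolding jac_def[abs_def]
  by (intro continuous_on_vec_lambda continuous_on_dmon regular_A')

lemma mon_trans_map: "z \<in> overlap \<Longrightarrow> mon B' \<nu> (trans_map z) = mon B \<nu> z"
proof -
  assume "z \<in> overlap"
  then obtain x where x: "x \<in> fst c.chart" "x \<in> fst c'.chart" "z = snd c.chart x"
    by (auto simp: overlap_def)
  thus ?thesis using c.regular_\<nu>_pt[of x] c'.regular_\<nu>_pt[of x] trans_map_coord[of x] by simp
qed

lemma trans_map_range: "z \<in> overlap \<Longrightarrow> trans_map z \<in> c'.coord_range"
  using trans_map_coord c'.chart_mem by (auto simp: overlap_def)

lemma continuous_on_trans_map: "continuous_on overlap trans_map"
  unfolding trans_map_def[abs_def]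
  by (intro continuous_on_vec_lambda continuous_on_mon regular_A')

text \<open>Where no coordinate vanishes, the logarithmic Jacobian is the constant unimodular matrix
  \<open>A' ** transpose B\<close>, and the rest is bookkeeping of products;
  \<open>eq_from_torus\<close> carries the identity to the divisors. This rule makes
  \<open>vol\<close> a global form.\<close>

lemma det_jac: 
  assumes "z \<in> overlap" 
  shows "det (jac z) * vol A' B' \<nu> (trans_map z) = vol A B \<nu> z"
proof (rule eq_from_torus[OF open_overlap assms])
  show "continuous_on overlap (\<lambda>z. det (jac z) * vol A' B' \<nu> (trans_map z))"
    using trans_map_range
    by (intro continuous_intros continuous_on_jac continuous_on_trans_map
         continuous_on_compose2[OF c'.vol_cont]) auto
  show "continuous_on overlap (vol A B \<nu>)"
    using continuous_on_subset[OF c.vol_cont overlap_sub] .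
next
  fix z assume z: "z \<in> overlap" and nz: "\<And>j. z $ j \<noteq> 0"
  have nz': "trans_map z $ k \<noteq> 0" for k by (simp add: trans_map_def mon_eq_0 nz)
  have "jac z = (\<chi> k l. trans_map z $ k * cmat (A' ** transpose B) $ k $ l * (1 / z $ l))"
    by (simp add: jac_def dmon_nonzero[OF nz] trans_map_def cmat_def vec_eq_iff matrix_matrix_mult_def
        transpose_def ipair_def)
  hence "det (jac z) = (\<Prod>k\<in>UNIV. trans_map z $ k) * of_int (det A' * det B) / (\<Prod>j\<in>UNIV. z $ j)"
    by (simp only: det_scale_rows_columns det_cmat) (simp add: det_mul prod_dividef)
  moreover have "(\<Prod>k\<in>UNIV. trans_map z $ k) \<noteq> 0" using nz' by simp
  moreover have "complex_of_int (det A') * of_int (det A') = 1"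
    using dual_bases_det(2)[OF c'.dual] by (metis of_int_1 of_int_mult)
  ultimately show "det (jac z) * vol A' B' \<nu> (trans_map z) = vol A B \<nu> z"
    using dual_bases_det(3)[OF c.dual] 
    by (simp add: vol_nonzero[OF nz] vol_nonzero[OF nz'] mon_trans_map[OF z])
qed

end

section \<open>Frames over the disk\<close>

text \<open>By Cramer's rule this is the matrix \<open>M\<^sup>-\<^sup>1 N\<close>; the formula makes its continuity evident.\<close>

definition matrix_ldiv :: "complex ^ 'n ^ 'n \<Rightarrow> complex ^ 'n ^ 'n \<Rightarrow> complex ^ 'n ^ ('n::finite)" where
  "matrix_ldiv M N = (\<chi> k j. det (\<chi> i l. if l = k then N $ i $ j else M $ i $ l) / det M)"

lemma matrix_ldiv_iff:
  assumes "det M \<noteq> 0"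
  shows "M ** X = N \<longleftrightarrow> X = matrix_ldiv M N"
proof -
  have col: "(M ** X) $ i $ j = (M *v column j X) $ i" for i j
    by (simp add: matrix_matrix_mult_def matrix_vector_mult_def column_def)
  have "M ** X = N \<longleftrightarrow> (\<forall>j. M *v column j X = column j N)"
    by (simp add: vec_eq_iff col) (simp add: column_def, metis)
  also have "\<dots> \<longleftrightarrow> (\<forall>j. column j X = column j (matrix_ldiv M N))"
  proof -
    have "column j (matrix_ldiv M N) =
        (\<chi> k. det (\<chi> i l. if l = k then column j N $ i else M $ i $ l) / det M)" for j
      by (simp add: column_def matrix_ldiv_def cong: if_cong)
    thus ?thesis by (simp only: cramer[OF assms])
  qed
  also have "\<dots> \<longleftrightarrow> X = matrix_ldiv M N" by (auto simp: vec_eq_iff column_def)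
  finally show ?thesis .
qed

lemma continuous_on_matrix_ldiv:
  assumes "continuous_on S f" "continuous_on S g" "\<And>p. p \<in> S \<Longrightarrow> det (f p) \<noteq> 0"
  shows "continuous_on S (\<lambda>p. matrix_ldiv (f p) (g p))"
proof -
  have "continuous_on S (\<lambda>p. if l = k then g p $ i $ j else f p $ i $ l)" for i j k l
    using assms by (cases "l = k") (auto intro!: continuous_intros)
  thus ?thesis unfolding matrix_ldiv_def
    by (intro continuous_on_vec_lambda continuous_on_divide continuous_on_det assms(1))
      (use assms(3) in auto)
qed

lemma continuous_on_matrix_mult [continuous_intros]:
  fixes f g :: "_ \<Rightarrow> complex ^ 'n ^ 'n::finite"
  assumes "continuous_on S f" "continuous_on S g"
  shows "continuous_on S (\<lambda>p. f p ** g p)"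
  unfolding matrix_matrix_mult_def
  by (intro continuous_on_vec_lambda continuous_intros assms)

lemma column_mult: "column j (M ** N) = M *v column j N"
  by (simp add: matrix_matrix_mult_def matrix_vector_mult_def column_def vec_eq_iff)

lemma matrix_eq_columns: "M = N \<longleftrightarrow> (\<forall>j. column j M = column j N)"
  by (auto simp: column_def vec_eq_iff)

lemma continuous_on_locallyI:
  fixes S :: "'a::metric_space set"
  assumes "\<And>p. p \<in> S \<Longrightarrow> \<exists>e>0. continuous_on (S \<inter> ball p e) g"
  shows "continuous_on S g"
  unfolding continuous_on_eq_continuous_within
proof
  fix p assume p: "p \<in> S"
  then obtain e where e: "e > 0" "continuous_on (S \<inter> ball p e) g" using assms by blast
  have "at p within S = at p within (S \<inter> ball p e)"
    by (rule at_within_nhd[of _ "ball p e"]) (use e in auto)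
  moreover have "continuous (at p within (S \<inter> ball p e)) g"
    using e p by (simp add: continuous_on_eq_continuous_within)
  ultimately show "continuous (at p within S) g" by simp
qed

definition trans_mat :: "('x, 'n::finite) chart \<Rightarrow> ('x, 'n) chart \<Rightarrow> complex ^ 'n \<Rightarrow> complex ^ 'n ^ 'n" where
  "trans_mat c c' z = matrix (frechet_derivative (in_coords c c' (\<lambda>x. x)) (at z))"

lemma trans_mat_eq:
  assumes "(in_coords c c' (\<lambda>x. x) has_derivative (\<lambda>v. M *v v)) (at z)"
  shows "trans_mat c c' z = M"
  by (simp add: trans_mat_def flip: frechet_derivative_at[OF assms])

lemma cont_intoE:
  assumes "cont_into At D f" "p \<in> D"
  obtains c e where "c \<in> At" "e > 0" "f ` (D \<inter> ball p e) \<subseteq> fst c"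
    "continuous_on (D \<inter> ball p e) (snd c \<circ> f)" "f p \<in> fst c"
proof -
  obtain c e where c: "c \<in> At" "e > 0" "f ` (D \<inter> ball p e) \<subseteq> fst c"
    "continuous_on (D \<inter> ball p e) (snd c \<circ> f)"
    using assms unfolding cont_into_def by blast
  moreover have "p \<in> D \<inter> ball p e" using assms(2) c(2) by simp
  ultimately show ?thesis using that by blast
qed

text \<open>A complex manifold with a nowhere vanishing section of its canonical bundle, given by its
  coefficient \<open>vol\<close> in each chart.\<close>

locale cy_atlas =
  fixes At :: "('x, 'n::finite) chart set" and vol :: "('x, 'n) chart \<Rightarrow> complex ^ 'n \<Rightarrow> complex"
  assumes inj: "c \<in> At \<Longrightarrow> inj_on (snd c) (fst c)"
    and open_overlap: "c \<in> At \<Longrightarrow> c' \<in> At \<Longrightarrow> open (snd c ` (fst c \<inter> fst c'))"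
    and has_derivative_trans: "c \<in> At \<Longrightarrow> c' \<in> At \<Longrightarrow> x \<in> fst c \<Longrightarrow> x \<in> fst c' \<Longrightarrow>
      (in_coords c c' (\<lambda>x. x) has_derivative (\<lambda>v. trans_mat c c' (snd c x) *v v)) (at (snd c x))"
    and trans_mat_cont: "c \<in> At \<Longrightarrow> c' \<in> At \<Longrightarrow> continuous_on (snd c ` (fst c \<inter> fst c')) (trans_mat c c')"
    and vol_cont: "c \<in> At \<Longrightarrow> continuous_on (snd c ` fst c) (vol c)"
    and vol_nz: "c \<in> At \<Longrightarrow> x \<in> fst c \<Longrightarrow> vol c (snd c x) \<noteq> 0"
    and vol_trans: "c \<in> At \<Longrightarrow> c' \<in> At \<Longrightarrow> x \<in> fst c \<Longrightarrow> x \<in> fst c' \<Longrightarrow>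
      det (trans_mat c c' (snd c x)) * vol c' (snd c' x) = vol c (snd c x)"
begin

lemma coord_inv_snd [simp]: "c \<in> At \<Longrightarrow> x \<in> fst c \<Longrightarrow> coord_inv c (snd c x) = x"
  unfolding coord_inv_def by (rule inv_into_f_f[OF inj])

lemma in_coords_snd: "c \<in> At \<Longrightarrow> x \<in> fst c \<Longrightarrow> in_coords c c' (\<lambda>x. x) (snd c x) = snd c' x"
  by (simp add: in_coords_def)

lemma frechet_derivative_trans:
  assumes "c \<in> At" "c' \<in> At" "x \<in> fst c" "x \<in> fst c'"
  shows "frechet_derivative (in_coords c c' (\<lambda>x. x)) (at (snd c x)) v = trans_mat c c' (snd c x) *v v"
  using frechet_derivative_at[OF has_derivative_trans[OF assms]] by metis

lemma trans_mat_self: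
  assumes "c \<in> At" "x \<in> fst c" shows "trans_mat c c (snd c x) = mat 1"
proof (rule trans_mat_eq)
  have "((\<lambda>z. z) has_derivative (\<lambda>v. mat 1 *v v)) (at (snd c x))"
    using has_derivative_ident by simp
  thus "(in_coords c c (\<lambda>x. x) has_derivative (\<lambda>v. mat 1 *v v)) (at (snd c x))"
    by (rule has_derivative_transform_within_open[of _ _ _ _ "snd c ` fst c"])
      (use open_overlap[of c c] assms in \<open>auto simp: in_coords_snd\<close>)
qed

lemma trans_mat_comp:
  assumes "c \<in> At" "c' \<in> At" "c'' \<in> At" "x \<in> fst c" "x \<in> fst c'" "x \<in> fst c''"
  shows "trans_mat c' c'' (snd c' x) ** trans_mat c c' (snd c x) = trans_mat c c'' (snd c x)"
proof (rule trans_mat_eq[symmetric])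
  have "((\<lambda>z. in_coords c' c'' (\<lambda>x. x) (in_coords c c' (\<lambda>x. x) z)) has_derivative
     (\<lambda>v. trans_mat c' c'' (snd c' x) *v (trans_mat c c' (snd c x) *v v))) (at (snd c x))"
    by (rule has_derivative_compose[OF has_derivative_trans])
      (use assms has_derivative_trans[of c' c'' x] in \<open>auto simp: in_coords_snd\<close>)
  hence "((\<lambda>z. in_coords c' c'' (\<lambda>x. x) (in_coords c c' (\<lambda>x. x) z)) has_derivative
     (\<lambda>v. (trans_mat c' c'' (snd c' x) ** trans_mat c c' (snd c x)) *v v)) (at (snd c x))"
    by (simp add: matrix_vector_mul_assoc)
  thus "(in_coords c c'' (\<lambda>x. x) has_derivative
     (\<lambda>v. (trans_mat c' c'' (snd c' x) ** trans_mat c c' (snd c x)) *v v)) (at (snd c x))"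
    by (rule has_derivative_transform_within_open[of _ _ _ _ "snd c ` (fst c \<inter> fst c')"])
      (use open_overlap[of c c'] assms in \<open>auto simp: in_coords_snd\<close>)
qed

lemma trans_mat_inverse:
  assumes "c \<in> At" "c' \<in> At" "x \<in> fst c" "x \<in> fst c'"
  shows "trans_mat c' c (snd c' x) ** trans_mat c c' (snd c x) = mat 1"
  using trans_mat_comp[OF assms(1,2,1,3,4,3)] trans_mat_self assms by simp

lemma det_trans_mat:
  assumes "c \<in> At" "c' \<in> At" "x \<in> fst c" "x \<in> fst c'"
  shows "det (trans_mat c c' (snd c x)) \<noteq> 0"
  using trans_mat_inverse[OF assms] det_mul[of "trans_mat c' c (snd c' x)" "trans_mat c c' (snd c x)"]
  by auto

lemma tangent_frame_iff:
  "tangent_frame At D f E \<longleftrightarrow>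
     (\<forall>c\<in>At. continuous_on {p\<in>D. f p \<in> fst c} (E c) \<and>
        (\<forall>p\<in>D. f p \<in> fst c \<longrightarrow> det (E c p) \<noteq> 0)) \<and>
     (\<forall>c\<in>At. \<forall>c'\<in>At. \<forall>p\<in>D. f p \<in> fst c \<longrightarrow> f p \<in> fst c' \<longrightarrow>
        E c' p = trans_mat c c' (snd c (f p)) ** E c p)"
proof -
  have "(f p \<in> fst c \<inter> fst c' \<longrightarrow> (\<forall>j. column j (E c' p) =
           frechet_derivative (in_coords c c' (\<lambda>x. x)) (at (snd c (f p))) (column j (E c p)))) \<longleftrightarrow>
        (f p \<in> fst c \<longrightarrow> f p \<in> fst c' \<longrightarrow> E c' p = trans_mat c c' (snd c (f p)) ** E c p)"
    if "c \<in> At" "c' \<in> At" for c c' p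
    using that by (auto simp add: frechet_derivative_trans matrix_eq_columns column_mult)
  thus ?thesis unfolding tangent_frame_def by (simp cong: ball_cong)
qed

lemma frameD:
  assumes "tangent_frame At D f E" "c \<in> At"
  shows "continuous_on {p\<in>D. f p \<in> fst c} (E c)"
    and "p \<in> D \<Longrightarrow> f p \<in> fst c \<Longrightarrow> det (E c p) \<noteq> 0"
    and "c' \<in> At \<Longrightarrow> p \<in> D \<Longrightarrow> f p \<in> fst c \<Longrightarrow> f p \<in> fst c' \<Longrightarrow>
        E c' p = trans_mat c c' (snd c (f p)) ** E c p"
  using assms unfolding tangent_frame_iff by blast+

lemma frame_mono:
  assumes "tangent_frame At D f E" "D' \<subseteq> D" "\<And>p. p \<in> D' \<Longrightarrow> f p = g p"
  shows "tangent_frame At D' g E"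
proof -
  have eq: "{p\<in>D'. g p \<in> fst c} = {p\<in>D'. f p \<in> fst c}" for c :: "('x, 'n) chart"
    using assms(3) by auto
  show ?thesis unfolding tangent_frame_iff eq
  proof (intro conjI ballI impI)
    fix c assume "c \<in> At"
    thus "continuous_on {p\<in>D'. f p \<in> fst c} (E c)"
      by (rule continuous_on_subset[OF frameD(1)[OF assms(1)]]) (use assms(2) in auto)
  next
    fix c p assume "c \<in> At" "p \<in> D'" "g p \<in> fst c"
    thus "det (E c p) \<noteq> 0" using frameD(2)[OF assms(1)] assms(2,3) by (metis subsetD)
  next
    fix c c' p assume "c \<in> At" "c' \<in> At" "p \<in> D'" "g p \<in> fst c" "g p \<in> fst c'"
    thus "E c' p = trans_mat c c' (snd c (g p)) ** E c p"
      using frameD(3)[OF assms(1), of c c' p] assms(2) assms(3)[of p] by auto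
  qed
qed

text \<open>The frame is the coordinate frame of c: the transition matrix out of c is its expression
  in any other chart, and compatibility is the chain rule.\<close>

lemma local_frame:
  assumes c: "c \<in> At" and "f ` D \<subseteq> fst c" "continuous_on D (snd c \<circ> f)"
  shows "tangent_frame At D f (\<lambda>c' p. trans_mat c c' (snd c (f p)))"
  unfolding tangent_frame_iff
proof (intro conjI ballI impI)
  fix c' assume c': "c' \<in> At"
  have "continuous_on {p\<in>D. f p \<in> fst c'} (\<lambda>p. (snd c \<circ> f) p)"
    using assms(3) by (rule continuous_on_subset) auto
  thus "continuous_on {p\<in>D. f p \<in> fst c'} (\<lambda>p. trans_mat c c' (snd c (f p)))"
    using continuous_on_compose2[OF trans_mat_cont[OF c c'], of _ "\<lambda>p. (snd c \<circ> f) p"] assms(2)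
    by (auto simp: image_subset_iff)
next
  fix c' p assume "c' \<in> At" "p \<in> D" "f p \<in> fst c'"
  thus "det (trans_mat c c' (snd c (f p))) \<noteq> 0" using assms by (intro det_trans_mat) auto
next
  fix c' c'' p assume "c' \<in> At" "c'' \<in> At" "p \<in> D" "f p \<in> fst c'" "f p \<in> fst c''"
  thus "trans_mat c c'' (snd c (f p)) = trans_mat c' c'' (snd c' (f p)) ** trans_mat c c' (snd c (f p))"
    using assms by (intro trans_mat_comp[symmetric]) auto
qed

text \<open>On the overlap the frames differ by a continuous invertible matrix function g with
  \<open>E1 = E2 ** g\<close>. The nearest point retraction r onto the convex overlap extends g to
  \<open>g \<circ> r\<close> on all of \<open>D2\<close>, and \<open>E2\<close> multiplied by it
  continues \<open>E1\<close>.\<close>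

lemma glue_frames:
  fixes D1 D2 :: "complex set"
  assumes cl: "closed D1" "closed D2" and f: "cont_into At (D1 \<union> D2) f"
    and E1: "tangent_frame At D1 f E1" and E2: "tangent_frame At D2 f E2"
    and conv: "convex (D1 \<inter> D2)" "D1 \<inter> D2 \<noteq> {}"
  shows "\<exists>E. tangent_frame At (D1 \<union> D2) f E"
proof -
  define C where "C = D1 \<inter> D2"
  \<comment> \<open>The chart may be chosen arbitrarily: transition matrices multiply both frames
    from the left and cancel in the quotient, as the fact \<open>g\<close> below shows.\<close>
  define g where "g p = (let c = SOME c. c \<in> At \<and> f p \<in> fst c in matrix_ldiv (E2 c p) (E1 c p))" for p
  define r where "r = closest_point C"
  have clC: "closed C" "C \<noteq> {}" "convex C" using cl conv by (auto simp: C_def)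
  have r: "r p \<in> C" "p \<in> C \<Longrightarrow> r p = p" for p
    using closest_point_in_set[OF clC(1,2)] closest_point_self by (auto simp: r_def)
  have contr: "continuous_on S r" for S
    unfolding r_def using continuous_on_closest_point[OF clC(3,1,2)] .
  have ex: "\<exists>c\<in>At. f p \<in> fst c" if "p \<in> D1 \<union> D2" for p
    using cont_intoE[OF f that] by metis
  have g: "E1 c p = E2 c p ** g p" if p: "p \<in> C" and c: "c \<in> At" "f p \<in> fst c" for p c
  proof -
    define c0 where "c0 = (SOME c. c \<in> At \<and> f p \<in> fst c)"
    have c0: "c0 \<in> At" "f p \<in> fst c0"
      unfolding c0_def using someI_ex[of "\<lambda>c. c \<in> At \<and> f p \<in> fst c"] c by blast+
    have "det (E2 c0 p) \<noteq> 0" using frameD(2)[OF E2 c0(1)] c0 p by (auto simp: C_def)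
    hence "E2 c0 p ** g p = E1 c0 p"
      unfolding g_def c0_def[symmetric] Let_def by (simp add: matrix_ldiv_iff)
    hence "trans_mat c0 c (snd c0 (f p)) ** E2 c0 p ** g p = trans_mat c0 c (snd c0 (f p)) ** E1 c0 p"
      by (simp flip: matrix_mul_assoc)
    moreover have "E1 c p = trans_mat c0 c (snd c0 (f p)) ** E1 c0 p"
      "E2 c p = trans_mat c0 c (snd c0 (f p)) ** E2 c0 p"
      using frameD(3)[OF E1 c0(1) c(1)] frameD(3)[OF E2 c0(1) c(1)] p c c0 by (auto simp: C_def)
    ultimately show ?thesis by simp
  qed
  have detg: "det (g p) \<noteq> 0" if p: "p \<in> C" for p
  proof -
    obtain c where c: "c \<in> At" "f p \<in> fst c" using ex[of p] p unfolding C_def by blast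
    have "det (E1 c p) \<noteq> 0" using frameD(2)[OF E1 c(1)] c p by (auto simp: C_def)
    thus ?thesis using g[OF p c] by (simp add: det_mul)
  qed
  have contg: "continuous_on C g"
  proof (rule continuous_on_locallyI)
    fix p assume p: "p \<in> C"
    then obtain c e where c: "c \<in> At" "e > 0" "f ` ((D1 \<union> D2) \<inter> ball p e) \<subseteq> fst c"
      using f unfolding cont_into_def C_def by blast
    let ?S = "C \<inter> ball p e"
    have sub: "?S \<subseteq> {p\<in>D1. f p \<in> fst c}" "?S \<subseteq> {p\<in>D2. f p \<in> fst c}"
      using c(3) by (auto simp: C_def)
    have nz: "det (E2 c q) \<noteq> 0" if "q \<in> ?S" for q using frameD(2)[OF E2 c(1)] sub that by blast
    have "continuous_on ?S (\<lambda>q. matrix_ldiv (E2 c q) (E1 c q))"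
      by (intro continuous_on_matrix_ldiv continuous_on_subset[OF frameD(1)[OF E1 c(1)] sub(1)]
          continuous_on_subset[OF frameD(1)[OF E2 c(1)] sub(2)] nz)
    moreover have "matrix_ldiv (E2 c q) (E1 c q) = g q" if "q \<in> ?S" for q
    proof -
      have "E1 c q = E2 c q ** g q" using that sub by (intro g c) auto
      thus ?thesis using matrix_ldiv_iff[OF nz[OF that]] by metis
    qed
    ultimately have "continuous_on ?S g" by (rule continuous_on_eq)
    thus "\<exists>e>0. continuous_on (C \<inter> ball p e) g" using c(2) by blast
  qed
  define E where "E c p = (if p \<in> D1 then E1 c p else E2 c p ** g (r p))" for c p
  have E2: "E c p = E2 c p ** g (r p)" if "p \<in> D2" "c \<in> At" "f p \<in> fst c" for c p
    using that g[of p c] r(2)[of p] by (auto simp: E_def C_def)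
  note E2' = frameD[OF assms(5)]
  have "tangent_frame At (D1 \<union> D2) f E" unfolding tangent_frame_iff
  proof (intro conjI ballI impI)
    fix c assume c: "c \<in> At"
    let ?S1 = "{p\<in>D1. f p \<in> fst c}" and ?S2 = "{p\<in>D2. f p \<in> fst c}"
    have eq: "{p \<in> D1 \<union> D2. f p \<in> fst c} = ?S1 \<union> ?S2" by auto
    show "continuous_on {p \<in> D1 \<union> D2. f p \<in> fst c} (E c)" unfolding eq E_def
    proof (rule continuous_on_cases_local)
      show "closedin (top_of_set (?S1 \<union> ?S2)) ?S1"
        unfolding closedin_closed using cl by (intro exI[of _ D1]) auto
      show "closedin (top_of_set (?S1 \<union> ?S2)) ?S2"
        unfolding closedin_closed using cl by (intro exI[of _ D2]) auto
      show "continuous_on ?S1 (E1 c)" using frameD(1)[OF E1 c] .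
      show "continuous_on ?S2 (\<lambda>p. E2 c p ** g (r p))"
        by (intro continuous_intros E2'(1)[OF c] continuous_on_compose2[OF contg contr]) (use r in auto)
      show "E1 c p = E2 c p ** g (r p)" if "p \<in> ?S1 \<and> p \<notin> D1 \<or> p \<in> ?S2 \<and> p \<in> D1" for p
        using that E2[of p c] c by (auto simp: E_def)
    qed
  next
    fix c p assume "c \<in> At" "p \<in> D1 \<union> D2" "f p \<in> fst c"
    thus "det (E c p) \<noteq> 0"
      using frameD(2)[OF E1, of c p] E2'(2)[of c p] detg[OF r(1), of p] by (auto simp: E_def det_mul)
  next
    fix c c' p assume "c \<in> At" "c' \<in> At" "p \<in> D1 \<union> D2" "f p \<in> fst c" "f p \<in> fst c'"
    thus "E c' p = trans_mat c c' (snd c (f p)) ** E c p"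
      using frameD(3)[OF E1, of c c' p] E2'(3)[of c c' p] by (auto simp: E_def matrix_mul_assoc)
  qed
  thus ?thesis by blast
qed

section \<open>Frames over boxes and over the closed disk\<close>

definition "box_frame f x1 x2 y1 y2 \<longleftrightarrow> (\<exists>E. tangent_frame At (cbox (Complex x1 y1) (Complex x2 y2)) f E)"

lemma box_frame_mono:
  "box_frame f x1 x2 y1 y2 \<Longrightarrow> x1 \<le> x1' \<Longrightarrow> x2' \<le> x2 \<Longrightarrow> y1 \<le> y1' \<Longrightarrow> y2' \<le> y2 \<Longrightarrow>
   box_frame f x1' x2' y1' y2'"
proof -
  assume "box_frame f x1 x2 y1 y2" and le: "x1 \<le> x1'" "x2' \<le> x2" "y1 \<le> y1'" "y2' \<le> y2"
  then obtain E where E: "tangent_frame At (cbox (Complex x1 y1) (Complex x2 y2)) f E"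
    by (auto simp: box_frame_def)
  have "cbox (Complex x1' y1') (Complex x2' y2') \<subseteq> cbox (Complex x1 y1) (Complex x2 y2)"
    using le by (auto simp: in_cbox_complex_iff)
  from frame_mono[OF E this refl] show ?thesis by (auto simp: box_frame_def)
qed

text \<open>One statement serves for gluing side by side and on top of each other: the union takes
  its lower left corner from the first box and its upper right corner from the second.\<close>

lemma box_frame_glue:
  assumes f: "cont_into At UNIV f" 
    and bf: "box_frame f x1 x2 y1 y2" "box_frame f x1' x2' y1' y2'"
    and un: "cbox (Complex x1 y1) (Complex x2 y2) \<union> cbox (Complex x1' y1') (Complex x2' y2') =
      cbox (Complex x1 y1) (Complex x2' y2')"
    and ne: "cbox (Complex x1 y1) (Complex x2 y2) \<inter> cbox (Complex x1' y1') (Complex x2' y2') \<noteq> {}"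
  shows "box_frame f x1 x2' y1 y2'"
proof -
  from bf obtain E1 E2 where E: "tangent_frame At (cbox (Complex x1 y1) (Complex x2 y2)) f E1"
    "tangent_frame At (cbox (Complex x1' y1') (Complex x2' y2')) f E2"
    by (auto simp: box_frame_def)
  have "cont_into At D f" for D
    unfolding cont_into_def
  proof
    fix p
    obtain c e where c: "c \<in> At" "e > 0" "f ` (UNIV \<inter> ball p e) \<subseteq> fst c"
      "continuous_on (UNIV \<inter> ball p e) (snd c \<circ> f)" using f unfolding cont_into_def by blast
    show "\<exists>c\<in>At. \<exists>e>0. f ` (D \<inter> ball p e) \<subseteq> fst c \<and> continuous_on (D \<inter> ball p e) (snd c \<circ> f)"
    proof (intro bexI[OF _ c(1)] exI[of _ e] conjI c(2))
      show "f ` (D \<inter> ball p e) \<subseteq> fst c" using c by auto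
      show "continuous_on (D \<inter> ball p e) (snd c \<circ> f)"
        by (rule continuous_on_subset[OF c(4)]) auto
    qed
  qed
  from glue_frames[OF closed_cbox closed_cbox this E convex_Int[OF convex_box(1) convex_box(1)] ne]
  show ?thesis by (simp add: box_frame_def un)
qed

text \<open>Bisection in the vertical direction yields a frame over a whole thin column, whose width
  depends on its position; bisection in the horizontal direction then joins the columns.\<close>

lemma box_frame_exists:
  assumes f: "cont_into At UNIV f" and le: "x1 \<le> x2" "y1 \<le> y2"
  shows "box_frame f x1 x2 y1 y2"
proof -
  have loc: "\<exists>e>0. \<forall>a b c d. x - a \<le> e \<and> b - x \<le> e \<and> y - c \<le> e \<and> d - y \<le> e \<longrightarrow> box_frame f a b c d" for x y
  proof -
    obtain c e where c: "c \<in> At" "e > 0" "f ` (UNIV \<inter> ball (Complex x y) e) \<subseteq> fst c"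
      "continuous_on (UNIV \<inter> ball (Complex x y) e) (snd c \<circ> f)" using f unfolding cont_into_def by blast
    have fr: "tangent_frame At (ball (Complex x y) e) f (\<lambda>c' p. trans_mat c c' (snd c (f p)))"
      by (rule local_frame) (use c in auto)
    \<comment> \<open>With e/4 on both axes the distance from the centre is at most e/4 + e/4, which
      is below e.\<close>
    have "box_frame f a b c d" if "x - a \<le> e/4" "b - x \<le> e/4" "y - c \<le> e/4" "d - y \<le> e/4" for a b c d
    proof -
      have "cbox (Complex a c) (Complex b d) \<subseteq> ball (Complex x y) e"
      proof
        fix p assume "p \<in> cbox (Complex a c) (Complex b d)"
        hence "\<bar>Re (p - Complex x y)\<bar> \<le> e/4" "\<bar>Im (p - Complex x y)\<bar> \<le> e/4"
          using that unfolding in_cbox_complex_iff minus_complex.sel complex.sel abs_le_iff atLeastAtMost_iff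
          by (elim conjE, intro conjI; linarith)+
        hence "norm (p - Complex x y) < e" using cmod_le[of "p - Complex x y"] c(2) by linarith
        thus "p \<in> ball (Complex x y) e" by (simp add: dist_norm norm_minus_commute)
      qed
      from frame_mono[OF fr this refl] show ?thesis by (auto simp: box_frame_def)
    qed
    thus ?thesis using c(2) by (intro exI[of _ "e/4"]) auto
  qed
  have col: "\<exists>d>0. box_frame f (x - d) (x + d) y1 y2" for x
    using le(2)
  proof (induction rule: Bolzano)
    case (trans a b c)
    then obtain d1 d2 where d: "d1 > 0" "d2 > 0" "box_frame f (x - d1) (x + d1) a b"
      "box_frame f (x - d2) (x + d2) b c" by auto
    let ?d = "min d1 d2"
    have m: "box_frame f (x - ?d) (x + ?d) a b" "box_frame f (x - ?d) (x + ?d) b c"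
      using d by (auto intro: box_frame_mono)
    have "box_frame f (x - ?d) (x + ?d) a c"
      by (rule box_frame_glue[OF f m])
        (use trans d in \<open>auto simp: set_eq_iff in_cbox_complex_iff intro!: exI[of _ "Complex x b"]\<close>)
    thus ?case using d by (intro exI[of _ ?d]) auto
  next
    case (local y)
    obtain e where e: "e > 0" 
      "\<And>a b c d. x - a \<le> e \<Longrightarrow> b - x \<le> e \<Longrightarrow> y - c \<le> e \<Longrightarrow> d - y \<le> e \<Longrightarrow> box_frame f a b c d"
      using loc[of x y] by blast
    show ?case
    proof (rule exI[of _ e], intro conjI e(1) allI impI)
      fix a b assume ab: "a \<le> y \<and> y \<le> b \<and> b - a < e"
      have "box_frame f (x - e) (x + e) a b"
        by (rule e(2)) (use ab in auto)
      thus "\<exists>d>0. box_frame f (x - d) (x + d) a b" using e(1) by blast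
    qed
  qed
  show ?thesis using le(1)
  proof (induction rule: Bolzano)
    case (trans a b c)
    show ?case
      by (rule box_frame_glue[OF f trans(1,2)])
        (use trans le in \<open>auto simp: set_eq_iff in_cbox_complex_iff intro!: exI[of _ "Complex b y1"]\<close>)
  next
    case (local x)
    obtain d where d: "d > 0" "box_frame f (x - d) (x + d) y1 y2" using col by blast
    show ?case
      by (intro exI[of _ d] conjI d(1) allI impI box_frame_mono[OF d(2)]) auto
  qed
qed

text \<open>The nearest point retraction extends f continuously to the plane, where boxes are
  available; the frame over a surrounding square is then restricted to the disk.\<close>

theorem disk_frame_exists:
  assumes "cont_into At (cball 0 1) f"
  obtains E where "tangent_frame At (cball 0 1) f E"
proof -
  let ?r = "closest_point (cball (0::complex) 1)"
  have r: "?r p \<in> cball 0 1" "p \<in> cball 0 1 \<Longrightarrow> ?r p = p" for p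
    using closest_point_in_set[of "cball (0::complex) 1"] by (auto intro: closest_point_self)
  have cr: "continuous_on UNIV ?r" by (rule continuous_on_closest_point) auto
  have "cont_into At UNIV (f \<circ> ?r)" unfolding cont_into_def
  proof
    fix p
    obtain c e where c: "c \<in> At" "e > 0" "f ` (cball 0 1 \<inter> ball (?r p) e) \<subseteq> fst c"
      "continuous_on (cball 0 1 \<inter> ball (?r p) e) (snd c \<circ> f)"
      using assms r(1) unfolding cont_into_def by blast
    have "isCont ?r p" using cr by (simp add: continuous_on_eq_continuous_at)
    then obtain d where d: "d > 0" "\<And>q. dist q p < d \<Longrightarrow> dist (?r q) (?r p) < e"
      using c(2) unfolding continuous_at_eps_delta by (metis dist_commute)
    have sub: "?r ` (UNIV \<inter> ball p d) \<subseteq> cball 0 1 \<inter> ball (?r p) e"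
      using d(2) r(1) by (auto simp: dist_commute)
    have "continuous_on (UNIV \<inter> ball p d) ((snd c \<circ> f) \<circ> ?r)"
      by (rule continuous_on_compose[OF continuous_on_subset[OF cr] continuous_on_subset[OF c(4) sub]]) auto
    thus "\<exists>c\<in>At. \<exists>e>0. (f \<circ> ?r) ` (UNIV \<inter> ball p e) \<subseteq> fst c \<and> continuous_on (UNIV \<inter> ball p e) (snd c \<circ> (f \<circ> ?r))"
      using c d(1) sub by (intro bexI[OF _ c(1)] exI[of _ d]) (auto simp: o_assoc image_subset_iff)
  qed
  from box_frame_exists[OF this, of "-1" 1 "-1" 1]
  obtain E where E: "tangent_frame At (cbox (Complex (-1) (-1)) (Complex 1 1)) (f \<circ> ?r) E"
    by (auto simp: box_frame_def)
  have "cball (0::complex) 1 \<subseteq> cbox (Complex (-1) (-1)) (Complex 1 1)"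
  proof
    fix p :: complex assume "p \<in> cball 0 1"
    thus "p \<in> cbox (Complex (-1) (-1)) (Complex 1 1)"
      using abs_Re_le_cmod[of p] abs_Im_le_cmod[of p] by (auto simp: in_cbox_complex_iff)
  qed
  from frame_mono[OF E this, of f] r(2) have "tangent_frame At (cball 0 1) f E" by auto
  thus ?thesis by (rule that)
qed

text \<open>The volume form evaluated on the frame. By \<open>vol_trans\<close> the value is the
  same in every chart, so the choice is harmless, and the determinant of the frame becomes a global
  function on the disk.\<close>

definition frame_vol :: "(complex \<Rightarrow> 'x) \<Rightarrow> (('x, 'n) chart \<Rightarrow> complex \<Rightarrow> complex ^ 'n ^ 'n) \<Rightarrow> complex \<Rightarrow> complex" where
  "frame_vol f E p = (let c = SOME c. c \<in> At \<and> f p \<in> fst c in vol c (snd c (f p)) * det (E c p))"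

lemma frame_vol_eq:
  assumes "tangent_frame At D f E" "p \<in> D" "c \<in> At" "f p \<in> fst c"
  shows "frame_vol f E p = vol c (snd c (f p)) * det (E c p)"
proof -
  define c0 where "c0 = (SOME c. c \<in> At \<and> f p \<in> fst c)"
  have c0: "c0 \<in> At" "f p \<in> fst c0"
    unfolding c0_def using someI_ex[of "\<lambda>c. c \<in> At \<and> f p \<in> fst c"] assms by blast+
  have "det (E c p) = det (trans_mat c0 c (snd c0 (f p))) * det (E c0 p)"
    using frameD(3)[OF assms(1) c0(1) assms(3) assms(2)] c0 assms by (simp add: det_mul)
  thus ?thesis unfolding frame_vol_def c0_def[symmetric] Let_def
    by (simp add: mult_ac flip: vol_trans[OF c0(1) assms(3) c0(2) assms(4)])
qed

lemma frame_vol_nz: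
  assumes "tangent_frame At D f E" "p \<in> D" "c \<in> At" "f p \<in> fst c"
  shows "frame_vol f E p \<noteq> 0"
  using frame_vol_eq[OF assms] frameD(2)[OF assms(1,3,2,4)] vol_nz[OF assms(3,4)] by simp

lemma frame_vol_cont:
  assumes E: "tangent_frame At D f E" and f: "cont_into At D f"
  shows "continuous_on D (frame_vol f E)"
proof (rule continuous_on_locallyI)
  fix p assume p: "p \<in> D"
  then obtain c e where c: "c \<in> At" "e > 0" "f ` (D \<inter> ball p e) \<subseteq> fst c"
    "continuous_on (D \<inter> ball p e) (snd c \<circ> f)" using f unfolding cont_into_def by blast
  have 1: "continuous_on (D \<inter> ball p e) (E c)"
    by (rule continuous_on_subset[OF frameD(1)[OF E c(1)]]) (use c in auto)
  have 2: "continuous_on (D \<inter> ball p e) (\<lambda>q. vol c ((snd c \<circ> f) q))"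
    by (rule continuous_on_compose2[OF vol_cont[OF c(1)] c(4)]) (use c in auto)
  have "continuous_on (D \<inter> ball p e) (\<lambda>q. vol c ((snd c \<circ> f) q) * det (E c q))"
    by (intro continuous_intros 1 2)
  moreover have "vol c ((snd c \<circ> f) q) * det (E c q) = frame_vol f E q" if q: "q \<in> D \<inter> ball p e" for q
  proof -
    have "f q \<in> fst c" using c(3) q by blast
    thus ?thesis using frame_vol_eq[OF E, of q c] c(1) q by simp
  qed
  ultimately have "continuous_on (D \<inter> ball p e) (frame_vol f E)" by (rule continuous_on_eq)
  thus "\<exists>e>0. continuous_on (D \<inter> ball p e) (frame_vol f E)" using c(2) by blast
qed

end

section \<open>Winding numbers and the Maslov index\<close>

lemma unit_circle_eq: "unit_circle = circlepath 0 1"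
  by (simp add: fun_eq_iff unit_circle_def circlepath mult_ac)

lemma norm_unit_circle [simp]: "norm (unit_circle t) = 1"
  by (simp add: unit_circle_def)

lemma unit_circle_ends: "unit_circle 0 = 1" "unit_circle 1 = 1"
  using exp_two_pi_i by (simp_all add: unit_circle_def)

lemma continuous_on_unit_circle: "continuous_on S unit_circle"
  unfolding unit_circle_def by (intro continuous_intros)

lemma winding_number_exp_path:
  assumes "continuous_on {0..1} q" "\<And>t. t \<in> {0..1} \<Longrightarrow> \<gamma> t = exp (q t)"
  shows "winding_number \<gamma> 0 = (q 1 - q 0) / (2 * of_real pi * \<i>)"
proof -
  have "winding_number \<gamma> 0 = winding_number (exp \<circ> q) 0"
    by (rule winding_number_cong) (use assms in auto)
  also have "\<dots> = (q 1 - q 0) / (2 * of_real pi * \<i>)"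
    using winding_number_compose_exp[of q] assms(1) by (simp add: path_def pathfinish_def pathstart_def)
  finally show ?thesis .
qed

text \<open>A continuous logarithm exists on the whole disk, so its values at the two ends of the
  loop agree.\<close>

lemma winding_number_loop_on_disk:
  assumes "continuous_on (cball 0 1) V" "\<And>p. p \<in> cball 0 1 \<Longrightarrow> V p \<noteq> 0"
  shows "winding_number (\<lambda>t. V (unit_circle t)) 0 = 0"
proof -
  obtain g where g: "continuous_on (cball 0 1) g" "\<And>z. z \<in> cball 0 1 \<Longrightarrow> V z = exp (g z)"
    using continuous_logarithm_on_cball[OF assms] by metis
  have "continuous_on {0..1} (\<lambda>t. g (unit_circle t))"
    by (rule continuous_on_compose2[OF g(1) continuous_on_unit_circle]) auto
  from winding_number_exp_path[OF this, of "\<lambda>t. V (unit_circle t)"] g(2) show ?thesis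
    by (simp add: unit_circle_ends)
qed

definition sq_phase :: "complex \<Rightarrow> complex" where
  "sq_phase s = s\<^sup>2 / complex_of_real ((norm s)\<^sup>2)"

lemma sq_phase_mult: "sq_phase (a * b) = sq_phase a * sq_phase b"
  by (simp add: sq_phase_def norm_mult power_mult_distrib)

lemma sq_phase_real: "r \<noteq> 0 \<Longrightarrow> sq_phase (of_real r) = 1"
  by (simp add: sq_phase_def flip: of_real_power)

lemma sq_phase_exp: "sq_phase (exp q) = exp (2 * of_real (Im q) * \<i>)"
proof -
  have "exp q = of_real (exp (Re q)) * exp (\<i> * of_real (Im q))"
    by (metis complex_eq exp_add exp_of_real)
  hence "sq_phase (exp q) = sq_phase (exp (\<i> * of_real (Im q)))"
    by (simp add: sq_phase_mult sq_phase_real del: of_real_exp)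
  also have "\<dots> = exp (2 * of_real (Im q) * \<i>)"
    by (simp add: sq_phase_def power2_eq_square flip: exp_add) (simp add: algebra_simps)
  finally show ?thesis .
qed

lemma sq_phase_nz: "s \<noteq> 0 \<Longrightarrow> sq_phase s \<noteq> 0" by (simp add: sq_phase_def)

text \<open>Along the circle the ends of a logarithm q of W differ by 2 pi \<i> times the winding
  number, while a logarithm g of V lives on the whole disk and closes up. The squared phase doubles
  the imaginary part of q - g and forgets the real part.\<close>

lemma winding_number_sq_phase:
  assumes W: "continuous_on (sphere 0 1) W" "\<And>p. p \<in> sphere 0 1 \<Longrightarrow> W p \<noteq> 0"
    and V: "continuous_on (cball 0 1) V" "\<And>p. p \<in> cball 0 1 \<Longrightarrow> V p \<noteq> 0" and u: "u \<noteq> 0"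
  shows "winding_number (\<lambda>t. sq_phase (u * W (unit_circle t) / V (unit_circle t))) 0 =
    2 * winding_number (\<lambda>t. W (unit_circle t)) 0"
proof -
  let ?p = "\<lambda>t. W (unit_circle t)"
  have p: "path ?p" unfolding path_def
    by (rule continuous_on_compose2[OF W(1) continuous_on_unit_circle]) auto
  have 0: "0 \<notin> path_image ?p" using W(2) by (auto simp: path_image_def)
  have loop: "pathfinish ?p = pathstart ?p" by (simp add: pathfinish_def pathstart_def unit_circle_ends)
  \<comment> \<open>Integrality makes the winding number real, so it can be recovered from the
    imaginary part of q alone.\<close>
  have int: "winding_number ?p 0 \<in> \<int>" by (rule integer_winding_number[OF p loop 0])
  obtain q where q: "path q" "pathfinish q - pathstart q = 2 * of_real pi * \<i> * winding_number ?p 0"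
      "\<And>t. t \<in> {0..1} \<Longrightarrow> ?p t = 0 + exp (q t)"
    using winding_number_as_continuous_log[OF p 0] by blast
  obtain g where g: "continuous_on (cball 0 1) g" "\<And>z. z \<in> cball 0 1 \<Longrightarrow> V z = exp (g z)"
    using continuous_logarithm_on_cball[OF V] by metis
  define h where "h t = Ln (sq_phase u) + 2 * of_real (Im (q t - g (unit_circle t))) * \<i>" for t
  have gc: "continuous_on {0..1} (\<lambda>t. g (unit_circle t))"
    by (rule continuous_on_compose2[OF g(1) continuous_on_unit_circle]) auto
  have "continuous_on {0..1} h" unfolding h_def
    using q(1) by (intro continuous_intros gc) (simp add: path_def)
  moreover have "sq_phase (u * W (unit_circle t) / V (unit_circle t)) = exp (h t)" if "t \<in> {0..1}" for t
  proof -
    have "u * W (unit_circle t) / V (unit_circle t) = u * exp (q t - g (unit_circle t))"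
      using q(3)[OF that] g(2)[of "unit_circle t"] by (simp add: exp_diff)
    thus ?thesis using sq_phase_nz[OF u] by (simp add: sq_phase_mult sq_phase_exp h_def exp_add)
  qed
  ultimately have "winding_number (\<lambda>t. sq_phase (u * W (unit_circle t) / V (unit_circle t))) 0
      = (h 1 - h 0) / (2 * of_real pi * \<i>)"
    by (rule winding_number_exp_path)
  moreover have "h 1 - h 0 = 2 * of_real (Im (q 1 - q 0)) * \<i>"
    by (simp add: h_def unit_circle_ends algebra_simps)
  moreover obtain k where k: "winding_number ?p 0 = of_int k" using int by (auto elim: Ints_cases)
  moreover have "Im (q 1 - q 0) = 2 * pi * of_int k"
    using q(2) k by (simp add: pathfinish_def pathstart_def)
  ultimately show "winding_number (\<lambda>t. sq_phase (u * W (unit_circle t) / V (unit_circle t))) 0 =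
    2 * winding_number ?p 0"
    by (simp add: field_simps)
qed

text \<open>F is only continuous at the boundary, while the argument principle needs a circle inside
  the open disk. The zeros form a compact subset of the open disk, so the loop can be moved inward
  through an annulus without zeros; the count is then a sum of positive orders.\<close>

lemma winding_number_counts_zeros:
  assumes cont: "continuous_on (cball 0 1) F" and hol: "F holomorphic_on ball 0 1"
    and nz: "\<And>p. p \<in> sphere 0 1 \<Longrightarrow> F p \<noteq> 0"
  obtains k :: nat where "winding_number (\<lambda>t. F (unit_circle t)) 0 = of_nat k"
    "\<And>p. k = 0 \<Longrightarrow> p \<in> ball 0 1 \<Longrightarrow> F p \<noteq> 0"
proof (cases "\<forall>p\<in>ball 0 1. F p \<noteq> 0")
  case True
  have "F p \<noteq> 0" if "p \<in> cball 0 1" for p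
    using True nz[of p] that by (cases "norm p = 1") auto
  from winding_number_loop_on_disk[OF cont this] show ?thesis using that[of 0] True by simp
next
  case False
  let ?Z = "{p\<in>cball 0 1. F p = 0}"
  have "closed ?Z"
    using continuous_closed_preimage_constant[OF cont closed_cball, of 0] by (simp add: conj_commute)
  moreover have "bounded ?Z" by (rule bounded_subset[OF bounded_cball[of 0 1]]) auto
  ultimately have "compact ?Z" by (simp add: compact_eq_bounded_closed)
  moreover have "?Z \<noteq> {}"
  proof -
    obtain p where "p \<in> ball 0 1" "F p = 0" using False by blast
    hence "p \<in> ?Z" by auto
    thus ?thesis by blast
  qed
  ultimately obtain z0 where z0: "z0 \<in> ?Z" "\<And>p. p \<in> ?Z \<Longrightarrow> norm p \<le> norm z0"
    using continuous_attains_sup[of ?Z norm] continuous_on_norm_id by blast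
  have "norm z0 < 1" using z0(1) nz[of z0] by (cases "norm z0 = 1") auto
  \<comment> \<open>Halfway between the largest modulus of a zero and the boundary.\<close>
  define r where "r = (norm z0 + 1) / 2"
  have r: "0 < r" "r < 1" "norm z0 < r" using \<open>norm z0 < 1\<close> by (auto simp: r_def add_nonneg_pos)
  have Zr: "norm p < r" if "norm p \<le> 1" "F p = 0" for p
    using z0(2)[of p] r that by simp
  let ?A = "{p. r \<le> norm p \<and> norm p \<le> 1}"
  have A: "F p \<noteq> 0" if "p \<in> ?A" for p using that Zr[of p] by auto
  \<comment> \<open>F has a zero but does not vanish at r, so it is not constant, and its zeros in
    the compact disk of radius r are finite in number.\<close>
  have fin: "finite {w \<in> ball 0 1. F w = 0}"
  proof -
    have "F r \<noteq> 0" using A[of "of_real r"] r by auto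
    have nc: "\<not> F constant_on ball 0 1"
    proof
      assume "F constant_on ball 0 1"
      then obtain c where c: "\<And>p. p \<in> ball 0 1 \<Longrightarrow> F p = c" unfolding constant_on_def by blast
      have "c = 0" using c False by auto
      moreover have "complex_of_real r \<in> ball 0 1" using r by simp
      ultimately show False using c \<open>F r \<noteq> 0\<close> by blast
    qed
    have "finite {w\<in>cball 0 r. F w = 0}"
      by (rule holomorphic_compact_finite_zeros[OF hol _ _ _ _ nc]) (use r in auto)
    thus ?thesis
      by (rule rev_finite_subset) (use Zr in \<open>auto intro: less_imp_le\<close>)
  qed
  have "homotopic_loops ?A (circlepath 0 r) (circlepath 0 1)"
  proof (rule homotopic_loops_linear)
    fix t :: real
    show "closed_segment (circlepath 0 r t) (circlepath 0 1 t) \<subseteq> ?A"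
    proof
      fix p assume "p \<in> closed_segment (circlepath 0 r t) (circlepath 0 1 t)"
      then obtain s where s: "0 \<le> s" "s \<le> 1" 
        "p = (1 - s) *\<^sub>R circlepath 0 r t + s *\<^sub>R circlepath 0 1 t" by (auto simp: in_segment)
      define e where "e = exp (2 * of_real pi * \<i> * of_real t)"
      have ne: "norm e = 1" by (simp add: e_def norm_exp_eq_Re)
      have "p = of_real ((1 - s) * r + s) * e"
        by (simp add: s(3) circlepath e_def scaleR_conv_of_real algebra_simps)
      hence "norm p = (1 - s) * r + s" using ne s r by (simp add: norm_mult del: of_real_add of_real_mult)
      moreover have "(1 - s) * r + s = r + s * (1 - r)" "(1 - s) * r + s = 1 - (1 - s) * (1 - r)" 
        by (auto simp: algebra_simps)
      moreover have "s * (1 - r) \<ge> 0" "(1 - s) * (1 - r) \<ge> 0" using s r by auto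
      ultimately show "p \<in> ?A" by auto
    qed
  qed auto
  hence "homotopic_loops (- {0}) (F \<circ> circlepath 0 r) (F \<circ> circlepath 0 1)"
    by (rule homotopic_loops_continuous_image) (use A in \<open>auto intro: continuous_on_subset[OF cont]\<close>)
  from winding_number_homotopic_loops[OF this]
  have "winding_number (\<lambda>t. F (unit_circle t)) 0 = winding_number (F \<circ> circlepath 0 r) 0"
    by (simp add: unit_circle_eq o_def)
  also have "\<dots> = 1 / (2*pi*\<i>) * contour_integral (F \<circ> circlepath 0 r) (\<lambda>w. 1 / (w - 0))"
  proof (rule winding_number_valid_path)
    show "valid_path (F \<circ> circlepath 0 r)"
      by (rule valid_path_compose_holomorphic[OF _ hol]) (use r in auto)
    show "0 \<notin> path_image (F \<circ> circlepath 0 r)"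
      using A r by (fastforce simp: path_image_compose)
  qed
  also have "contour_integral (F \<circ> circlepath 0 r) (\<lambda>w. 1 / (w - 0)) =
      contour_integral (circlepath 0 r) (\<lambda>w. deriv F w * (1 / (F w - 0)))"
    by (rule contour_integral_comp_analyticW[of F "ball 0 1"])
      (use hol r in \<open>auto simp: analytic_on_open\<close>)
  also have "\<dots> = contour_integral (circlepath 0 r) (\<lambda>w. deriv F w * 1 / F w)" by simp
  also have "\<dots> = 2 * pi * \<i> * (\<Sum>p\<in>{w\<in>ball 0 1. F w = 0 \<or> w \<in> {}}. winding_number (circlepath 0 r) p * 1 * zorder F p)"
  proof (rule argument_principle)
    show "finite {w \<in> ball 0 1. F w = 0 \<or> w \<in> {}}" using fin by simp
    show "path_image (circlepath 0 r) \<subseteq> ball 0 1 - {w \<in> ball 0 1. F w = 0 \<or> w \<in> {}}"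
      using r A by auto
    show "\<forall>z. z \<notin> ball 0 1 \<longrightarrow> winding_number (circlepath 0 r) z = 0"
      using r by (intro allI impI winding_number_zero_outside[of _ "cball 0 r"]) auto
  qed (use hol in auto)
  also have "(\<Sum>p\<in>{w\<in>ball 0 1. F w = 0 \<or> w \<in> {}}. winding_number (circlepath 0 r) p * 1 * zorder F p)
     = of_int (\<Sum>p\<in>{w\<in>ball 0 1. F w = 0}. zorder F p)"
    unfolding of_int_sum
  proof (rule sum.cong)
    fix p assume "p \<in> {w\<in>ball 0 1. F w = 0}"
    hence "norm (p - 0) < r" using Zr[of p] by simp
    thus "winding_number (circlepath 0 r) p * 1 * zorder F p = of_int (zorder F p)"
      by (simp only: winding_number_circlepath) simp
  qed auto
  finally have eq: "winding_number (\<lambda>t. F (unit_circle t)) 0 = of_int (\<Sum>p\<in>{w\<in>ball 0 1. F w = 0}. zorder F p)"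
    by simp
  have pos: "zorder F p > 0" if "p \<in> {w\<in>ball 0 1. F w = 0}" for p
  proof -
    have "F r \<noteq> 0" "complex_of_real r \<in> ball 0 1" using A[of "of_real r"] r by auto
    from non_zero_neighbour_alt[OF hol _ _ _ this(2,1), of p] that
    have "\<forall>\<^sub>F w in at p. F w \<noteq> 0" by (auto elim: eventually_mono)
    hence "\<exists>\<^sub>F w in at p. F w \<noteq> 0" by (intro eventually_frequently) auto
    thus ?thesis using zorder_pos_iff[OF hol] that by auto
  qed
  define S where "S = (\<Sum>p\<in>{w\<in>ball 0 1. F w = 0}. zorder F p)"
  show ?thesis
  proof (rule that[of "nat S"])
    have "S > 0" unfolding S_def by (intro sum_pos fin pos) (use False in auto)
    thus "winding_number (\<lambda>t. F (unit_circle t)) 0 = of_nat (nat S)"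
      and "nat S = 0 \<Longrightarrow> p \<in> ball 0 1 \<Longrightarrow> F p \<noteq> 0" for p
      using eq by (simp_all add: S_def)
  qed
qed

text \<open>Both bases span the same real space, so they differ by an invertible real matrix. This
  is why the description in \<open>det_sq_phase\<close> determines a value.\<close>

lemma real_basis_unique:
  assumes "real_basis F V" "real_basis F' V"
  obtains r :: real where "r \<noteq> 0" "det F' = of_real r * det F"
proof -
  let ?c = "\<lambda>a::real ^ 'a. \<chi> j. complex_of_real (a $ j)"
  have "\<exists>a. column j F' = F *v ?c a" for j
  proof -
    have "column j F' = F' *v ?c (axis j 1)"
      by (auto simp: vec_eq_iff column_def matrix_vector_mult_def axis_def if_distrib cong: if_cong)
    hence "column j F' \<in> V" using assms(2) unfolding real_basis_def by blast
    thus ?thesis using assms(1) unfolding real_basis_def by auto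
  qed
  then obtain a where a: "\<And>j. column j F' = F *v ?c (a j)" by metis
  define R :: "real ^ 'a ^ 'a" where "R = (\<chi> i j. a j $ i)"
  define CR :: "complex ^ 'a ^ 'a" where "CR = (\<chi> i j. of_real (R $ i $ j))"
  have col: "column j CR = ?c (a j)" for j by (simp add: column_def CR_def R_def vec_eq_iff)
  have "F' = F ** CR"
    unfolding matrix_eq_columns column_mult col using a by simp
  moreover have "det CR = of_real (det R)" by (simp add: det_def CR_def)
  ultimately have "det F' = of_real (det R) * det F" by (simp add: det_mul)
  moreover from this have "det R \<noteq> 0" using assms(2) by (auto simp: real_basis_def)
  ultimately show ?thesis using that by blast
qed

lemma det_sq_phase_eq:
  assumes "real_basis F V" shows "det_sq_phase V = sq_phase (det F)"
  unfolding det_sq_phase_def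
proof (rule the_equality)
  show "\<exists>F'. real_basis F' V \<and> sq_phase (det F) = (det F')\<^sup>2 / complex_of_real ((norm (det F'))\<^sup>2)"
    using assms by (auto simp: sq_phase_def)
next
  fix s assume "\<exists>F. real_basis F V \<and> s = (det F)\<^sup>2 / complex_of_real ((norm (det F))\<^sup>2)"
  then obtain F' where F': "real_basis F' V" "s = sq_phase (det F')" by (auto simp: sq_phase_def)
  obtain r :: real where "r \<noteq> 0" "det F' = of_real r * det F" using real_basis_unique[OF assms F'(1)] .
  thus "s = sq_phase (det F)" using F' by (simp add: sq_phase_mult sq_phase_real)
qed

lemma tangent_set_image:
  assumes v: "v \<in> tangent_set S z" and U: "open U" "z \<in> U"
    and f: "(f has_derivative D) (at z)" and sub: "f ` (S \<inter> U) \<subseteq> S'"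
  shows "D v \<in> tangent_set S' (f z)"
proof -
  obtain \<gamma> :: "real \<Rightarrow> 'a" where \<gamma>: "range \<gamma> \<subseteq> S" "\<gamma> 0 = z" "(\<gamma> has_vector_derivative v) (at 0)"
    using v by (auto simp: tangent_set_def)
  \<comment> \<open>\<open>tangent_set\<close> wants the whole curve inside the set. Where \<gamma>
    leaves \<open>U\<close> the curve is set to the base point, which does not affect the derivative
    at 0.\<close>
  define \<delta> where "\<delta> t = (if \<gamma> t \<in> U then f (\<gamma> t) else f z)" for t
  have "((\<lambda>t. f (\<gamma> t)) has_vector_derivative D v) (at 0)"
  proof -
    have "(f \<circ> \<gamma> has_derivative D \<circ> (\<lambda>t. t *\<^sub>R v)) (at 0)"
      by (rule diff_chain_at) (use \<gamma> f in \<open>auto simp: has_vector_derivative_def\<close>)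
    moreover have "D (t *\<^sub>R v) = t *\<^sub>R D v" for t
      using has_derivative_linear[OF f] by (simp add: linear_cmul)
    ultimately show ?thesis by (simp add: has_vector_derivative_def o_def)
  qed
  moreover have "isCont \<gamma> 0" using \<gamma>(3) by (rule has_vector_derivative_continuous)
  hence "\<forall>\<^sub>F t in nhds 0. \<gamma> t \<in> U"
    using U \<gamma>(2) unfolding isCont_def tendsto_def eventually_at_filter
    by (auto elim!: allE[of _ U] eventually_mono)
  hence "\<forall>\<^sub>F t in nhds 0. f (\<gamma> t) = \<delta> t" by (rule eventually_mono) (simp add: \<delta>_def)
  ultimately have "(\<delta> has_vector_derivative D v) (at 0)"
    using has_vector_derivative_cong_ev[of UNIV "\<lambda>t. f (\<gamma> t)" \<delta> 0 "D v"]
    by (auto simp: \<delta>_def \<gamma>(2) eventually_mono)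
  moreover have "range \<delta> \<subseteq> S'"
  proof -
    have "z \<in> S" using \<gamma>(1,2) by auto
    thus ?thesis using \<gamma>(1) sub U(2) by (auto simp: \<delta>_def)
  qed
  moreover have "\<delta> 0 = f z" by (simp add: \<delta>_def \<gamma>(2))
  ultimately show ?thesis by (auto simp: tangent_set_def)
qed

lemma real_basis_frame:
  assumes E: "det E \<noteq> 0" and G: "real_basis G T"
  shows "real_basis (matrix_ldiv E G) {a. E *v a \<in> T}" and "det (matrix_ldiv E G) = det G / det E"
proof -
  let ?M = "matrix_ldiv E G"
  have eq: "E ** ?M = G" using matrix_ldiv_iff[OF E] by blast
  hence "det E * det ?M = det G" by (metis det_mul)
  thus 1: "det ?M = det G / det E" using E by (simp add: field_simps)
  have inj: "E *v a = E *v b \<longleftrightarrow> a = b" for a b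
    using E by (metis invertible_det_nz inj_matrix_vector_mult injD)
  have "E *v a \<in> T \<longleftrightarrow> a \<in> range (\<lambda>b. ?M *v (\<chi> j. complex_of_real (b $ j)))" for a
  proof -
    have "E *v a \<in> T \<longleftrightarrow> (\<exists>b::real^'a. E *v a = E *v (?M *v (\<chi> j. complex_of_real (b $ j))))"
      using G unfolding real_basis_def by (auto simp: matrix_vector_mul_assoc eq)
    thus ?thesis unfolding inj by auto
  qed
  thus "real_basis ?M {a. E *v a \<in> T}"
    using G E 1 unfolding real_basis_def by auto
qed

section \<open>Maslov index and Chern number through the volume form\<close>

context cy_atlas
begin

abbreviation "tangent_at L c x \<equiv> tangent_set (snd c ` (L \<inter> fst c)) (snd c x)"

lemma tangent_trans:
  assumes "c \<in> At" "c' \<in> At" "x \<in> fst c" "x \<in> fst c'" "v \<in> tangent_at L c x"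
  shows "trans_mat c c' (snd c x) *v v \<in> tangent_at L c' x"
proof -
  have "trans_mat c c' (snd c x) *v v \<in> tangent_set (snd c' ` (L \<inter> fst c')) (in_coords c c' (\<lambda>x. x) (snd c x))"
  proof (rule tangent_set_image[OF assms(5) open_overlap[OF assms(1,2)] _ has_derivative_trans[OF assms(1-4)]])
    show "in_coords c c' (\<lambda>x. x) ` (snd c ` (L \<inter> fst c) \<inter> snd c ` (fst c \<inter> fst c')) \<subseteq> snd c' ` (L \<inter> fst c')"
    proof safe
      fix y y' assume *: "y \<in> L" "y \<in> fst c" "y' \<in> fst c" "y' \<in> fst c'" "snd c y = snd c y'"
      hence "y = y'" using inj[OF assms(1)] by (auto dest: inj_onD)
      thus "in_coords c c' (\<lambda>x. x) (snd c y) \<in> snd c' ` (L \<inter> fst c')"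
        using * assms in_coords_snd by auto
    qed
  qed (use assms in auto)
  thus ?thesis using in_coords_snd assms by simp
qed

text \<open>The definition of \<open>framed_tangent\<close> asks for some chart; by
  \<open>tangent_trans\<close> every chart gives the same condition.\<close>

lemma framed_tangent_eq:
  assumes E: "tangent_frame At D f E" and "p \<in> D" "c \<in> At" "f p \<in> fst c"
  shows "framed_tangent At L f E p = {a. E c p *v a \<in> tangent_at L c (f p)}"
proof -
  have "E c' p *v a \<in> tangent_at L c' (f p)" if "E c p *v a \<in> tangent_at L c (f p)"
    "c \<in> At" "c' \<in> At" "f p \<in> fst c" "f p \<in> fst c'" for c c' a
    using tangent_trans[OF that(2-5,1)] frameD(3)[OF E that(2,3) assms(2) that(4,5)]
    by (simp add: matrix_vector_mul_assoc)
  thus ?thesis unfolding framed_tangent_def using assms by blast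
qed

text \<open>The hypothesis on \<open>G\<close> says that \<open>L\<close> is special Lagrangian with respect to \<open>vol / W\<close>.\<close>

lemma disk_maslov_eq:
  assumes f: "cont_into At (cball 0 1) f" and u: "u \<noteq> 0"
    and W: "continuous_on (sphere 0 1) W" "\<And>p. p \<in> sphere 0 1 \<Longrightarrow> W p \<noteq> 0"
    and G: "\<And>p c. p \<in> sphere 0 1 \<Longrightarrow> c \<in> At \<Longrightarrow> f p \<in> fst c \<Longrightarrow>
        \<exists>G r. real_basis G (tangent_at L c (f p)) \<and> r \<noteq> 0 \<and>
          vol c (snd c (f p)) * det G = u * complex_of_real r * W p"
    and k: "winding_number (\<lambda>t. W (unit_circle t)) 0 = of_int k"
  shows "disk_maslov At L f = 2 * k"
  unfolding disk_maslov_def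
proof (rule the_equality)
  have key: "winding_number (\<lambda>t. det_sq_phase (framed_tangent At L f E (unit_circle t))) 0 = of_int (2 * k)"
    if E: "tangent_frame At (cball 0 1) f E" for E
  proof -
    have V: "continuous_on (cball 0 1) (frame_vol f E)" "\<And>p. p \<in> cball 0 1 \<Longrightarrow> frame_vol f E p \<noteq> 0"
      using frame_vol_cont[OF E f] frame_vol_nz[OF E] cont_intoE[OF f] by metis+
    have "det_sq_phase (framed_tangent At L f E p) = sq_phase (u * W p / frame_vol f E p)" if p: "p \<in> sphere 0 1" for p
    proof -
      have pc: "p \<in> cball 0 1" using p by auto
      obtain c where c: "c \<in> At" "f p \<in> fst c" using cont_intoE[OF f pc] by metis
      obtain G r where G: "real_basis G (tangent_at L c (f p))" "r \<noteq> 0"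
          "vol c (snd c (f p)) * det G = u * complex_of_real r * W p" using G[OF p c] by blast
      have dE: "det (E c p) \<noteq> 0" using frameD(2)[OF E c(1) pc c(2)] .
      have "det_sq_phase (framed_tangent At L f E p) = sq_phase (det G / det (E c p))"
        unfolding framed_tangent_eq[OF E pc c] 
        using det_sq_phase_eq real_basis_frame[OF dE G(1)] by metis
      \<comment> \<open>The hypothesis on G trades \<open>det G\<close> for W up to the volume
        coefficient, which joins \<open>det (E c p)\<close> to form \<open>frame_vol\<close>. The
        real factor r has trivial squared phase.\<close>
      also have "det G / det (E c p) = of_real r * (u * W p / frame_vol f E p)"
        using G(3) vol_nz[OF c] dE by (simp add: frame_vol_eq[OF E pc c] field_simps)
      finally show ?thesis using sq_phase_real[OF G(2)] by (simp only: sq_phase_mult mult_1)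
    qed
    hence "winding_number (\<lambda>t. det_sq_phase (framed_tangent At L f E (unit_circle t))) 0 =
        winding_number (\<lambda>t. sq_phase (u * W (unit_circle t) / frame_vol f E (unit_circle t))) 0"
      by simp
    also have "\<dots> = 2 * of_int k" using winding_number_sq_phase[OF W V u] k by simp
    finally show ?thesis by simp
  qed
  obtain E where E: "tangent_frame At (cball 0 1) f E" using disk_frame_exists[OF f] .
  show "\<exists>E. tangent_frame At (cball 0 1) f E \<and>
      winding_number (\<lambda>t. det_sq_phase (framed_tangent At L f E (unit_circle t))) 0 = of_int (2 * k)"
    using E key by blast
  fix k' assume "\<exists>E. tangent_frame At (cball 0 1) f E \<and>
      winding_number (\<lambda>t. det_sq_phase (framed_tangent At L f E (unit_circle t))) 0 = of_int k'"
  hence "complex_of_int k' = of_int (2 * k)" using key by metis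
  thus "k' = 2 * k" by (simp only: of_int_eq_iff)
qed

text \<open>Evaluating the volume form on the two frames gives a nowhere zero function on each
  closed hemisphere, and the determinant of the clutching function is their quotient. Both functions
  have logarithms on their hemispheres, so the quotient does not wind along the equator.\<close>

lemma sphere_chern_eq_0:
  assumes "cont_into At (cball 0 1) (g \<circ> Some)" "cont_into At (cball 0 1) (g \<circ> at_infinity_coord)"
  shows "sphere_chern At g = 0"
  unfolding sphere_chern_def
proof (rule the_equality)
  have key: "winding_number (\<lambda>t. let p = unit_circle t; c = (SOME c. c \<in> At \<and> g (Some p) \<in> fst c)
           in det (F c (inverse p)) / det (E c p)) 0 = of_int 0"
    if E: "tangent_frame At (cball 0 1) (g \<circ> Some) E" and F: "tangent_frame At (cball 0 1) (g \<circ> at_infinity_coord) F" for E F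
  proof -
    let ?VE = "frame_vol (g \<circ> Some) E" and ?VF = "frame_vol (g \<circ> at_infinity_coord) F"
    have VE: "continuous_on (cball 0 1) ?VE" "\<And>p. p \<in> cball 0 1 \<Longrightarrow> ?VE p \<noteq> 0"
      using frame_vol_cont[OF E assms(1)] frame_vol_nz[OF E] cont_intoE[OF assms(1)] by metis+
    have VF: "continuous_on (cball 0 1) ?VF" "\<And>p. p \<in> cball 0 1 \<Longrightarrow> ?VF p \<noteq> 0"
      using frame_vol_cont[OF F assms(2)] frame_vol_nz[OF F] cont_intoE[OF assms(2)] by metis+
    obtain gE where gE: "continuous_on (cball 0 1) gE" "\<And>z. z \<in> cball 0 1 \<Longrightarrow> ?VE z = exp (gE z)"
      using continuous_logarithm_on_cball[OF VE] by metis
    obtain gF where gF: "continuous_on (cball 0 1) gF" "\<And>z. z \<in> cball 0 1 \<Longrightarrow> ?VF z = exp (gF z)"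
      using continuous_logarithm_on_cball[OF VF] by metis
    define q where "q t = gF (inverse (unit_circle t)) - gE (unit_circle t)" for t
    have "continuous_on {0..1} q" unfolding q_def
    proof (intro continuous_on_diff)
      show "continuous_on {0..1} (\<lambda>t. gE (unit_circle t))"
        by (rule continuous_on_compose2[OF gE(1) continuous_on_unit_circle]) auto
      have "continuous_on {0..1} (\<lambda>t. inverse (unit_circle t))"
        by (intro continuous_on_inverse continuous_on_unit_circle) (auto simp: unit_circle_def)
      thus "continuous_on {0..1} (\<lambda>t. gF (inverse (unit_circle t)))"
        by (rule continuous_on_compose2[OF gF(1)]) (auto simp: norm_inverse)
    qed
    moreover have "(let p = unit_circle t; c = (SOME c. c \<in> At \<and> g (Some p) \<in> fst c)
           in det (F c (inverse p)) / det (E c p)) = exp (q t)" for t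
    proof -
      define p where "p = unit_circle t"
      define c where "c = (SOME c. c \<in> At \<and> g (Some p) \<in> fst c)"
      have p: "p \<in> cball 0 1" "inverse p \<in> cball 0 1" "p \<noteq> 0" by (auto simp: p_def norm_inverse unit_circle_def)
      have "\<exists>c. c \<in> At \<and> g (Some p) \<in> fst c" using cont_intoE[OF assms(1) p(1)] by (metis comp_apply)
      hence c: "c \<in> At" "g (Some p) \<in> fst c" unfolding c_def by (metis (mono_tags, lifting) someI_ex)+
      have inf: "at_infinity_coord (inverse p) = Some p" using p by (simp add: at_infinity_coord_def)
      have "?VE p = vol c (snd c (g (Some p))) * det (E c p)"
        using frame_vol_eq[OF E p(1) c(1)] c by simp
      moreover have "?VF (inverse p) = vol c (snd c (g (Some p))) * det (F c (inverse p))"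
        using frame_vol_eq[OF F p(2) c(1)] c inf by simp
      ultimately have "det (F c (inverse p)) / det (E c p) = ?VF (inverse p) / ?VE p"
        using vol_nz[OF c] by simp
      also have "\<dots> = exp (q t)" using gE(2)[OF p(1)] gF(2)[OF p(2)] by (simp add: q_def exp_diff p_def)
      finally show ?thesis by (simp add: Let_def p_def c_def)
    qed
    ultimately show ?thesis using winding_number_exp_path[of q] by (simp add: q_def unit_circle_ends)
  qed
  obtain E where E: "tangent_frame At (cball 0 1) (g \<circ> Some) E" using disk_frame_exists[OF assms(1)] .
  obtain F where F: "tangent_frame At (cball 0 1) (g \<circ> at_infinity_coord) F" using disk_frame_exists[OF assms(2)] .
  show "\<exists>E F. tangent_frame At (cball 0 1) (g \<circ> Some) E \<and>
        tangent_frame At (cball 0 1) (g \<circ> at_infinity_coord) F \<and>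
        winding_number (\<lambda>t. let p = unit_circle t; c = (SOME c. c \<in> At \<and> g (Some p) \<in> fst c)
           in det (F c (inverse p)) / det (E c p)) 0 = of_int 0"
    by (rule exI[of _ E], rule exI[of _ F]) (intro conjI E F key[OF E F])
  fix k assume "\<exists>E F. tangent_frame At (cball 0 1) (g \<circ> Some) E \<and>
        tangent_frame At (cball 0 1) (g \<circ> at_infinity_coord) F \<and>
        winding_number (\<lambda>t. let p = unit_circle t; c = (SOME c. c \<in> At \<and> g (Some p) \<in> fst c)
           in det (F c (inverse p)) / det (E c p)) 0 = of_int k"
  then obtain E F where "tangent_frame At (cball 0 1) (g \<circ> Some) E"
        "tangent_frame At (cball 0 1) (g \<circ> at_infinity_coord) F"
    and k: "winding_number (\<lambda>t. let p = unit_circle t; c = (SOME c. c \<in> At \<and> g (Some p) \<in> fst c)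
           in det (F c (inverse p)) / det (E c p)) 0 = of_int k"
    by (elim exE conjE)
  from key[OF this(1,2)] have "complex_of_int k = of_int 0" unfolding k .
  thus "k = 0" by simp
qed

end

section \<open>The canonical section of a toric Calabi--Yau manifold\<close>

text \<open>A chart is only a set with a map and does not carry its bases. Any choice of them will
  do, because \<open>det_jac\<close> compares arbitrary ones.\<close>

definition atlas_vol :: "(real ^ 'n::finite) set set \<Rightarrow> int ^ 'n \<Rightarrow> ('n tpoint, 'n) chart \<Rightarrow> complex ^ 'n \<Rightarrow> complex" where
  "atlas_vol \<Sigma> \<nu> c = (SOME h. \<exists>\<sigma> A B J. toric_chart \<Sigma> \<sigma> A B J \<and> c = toric_chart.chart \<Sigma> \<sigma> A \<and> h = vol A B \<nu>)"

locale cy_fan =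
  fixes \<Sigma> :: "(real ^ 'n::finite) set set" and \<nu> :: "int ^ 'n"
  assumes smooth: "smooth_fan \<Sigma>"
    and cy: "\<And>v. v \<in> ray_generators \<Sigma> \<Longrightarrow> rvec \<nu> \<bullet> rvec v = 1"
begin

lemma cy_chartI: "toric_chart \<Sigma> \<sigma> A B J \<Longrightarrow> cy_chart \<Sigma> \<sigma> A B J \<nu>"
  by (simp add: cy_chart_def cy_chart_axioms_def cy)

lemma atlas_chartE:
  assumes "c \<in> toric_atlas \<Sigma>"
  obtains \<sigma> A B J where "cy_chart \<Sigma> \<sigma> A B J \<nu>" "c = toric_chart.chart \<Sigma> \<sigma> A" "atlas_vol \<Sigma> \<nu> c = vol A B \<nu>"
proof -
  have "\<exists>h \<sigma> A B J. toric_chart \<Sigma> \<sigma> A B J \<and> c = toric_chart.chart \<Sigma> \<sigma> A \<and> h = vol A B \<nu>"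
    using atlasE[OF assms smooth] by metis
  from someI_ex[OF this] obtain \<sigma> A B J where "toric_chart \<Sigma> \<sigma> A B J"
    "c = toric_chart.chart \<Sigma> \<sigma> A" "atlas_vol \<Sigma> \<nu> c = vol A B \<nu>"
    unfolding atlas_vol_def by blast
  thus ?thesis using that cy_chartI by blast
qed

lemma chart_change:
  assumes "c \<in> toric_atlas \<Sigma>" "c' \<in> toric_atlas \<Sigma>"
  obtains \<sigma> A B J \<sigma>' A' B' J' where "chart_change \<Sigma> \<sigma> A B J \<nu> \<sigma>' A' B' J'"
    "c = toric_chart.chart \<Sigma> \<sigma> A" "atlas_vol \<Sigma> \<nu> c = vol A B \<nu>"
    "c' = toric_chart.chart \<Sigma> \<sigma>' A'" "atlas_vol \<Sigma> \<nu> c' = vol A' B' \<nu>"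
  using atlas_chartE[OF assms(1)] atlas_chartE[OF assms(2)] chart_change.intro by metis

sublocale cy_atlas "toric_atlas \<Sigma>" "atlas_vol \<Sigma> \<nu>"
proof
  fix c assume c: "c \<in> toric_atlas \<Sigma>"
  then obtain \<sigma> A B J where *: "cy_chart \<Sigma> \<sigma> A B J \<nu>" "c = toric_chart.chart \<Sigma> \<sigma> A"
    "atlas_vol \<Sigma> \<nu> c = vol A B \<nu>" using atlas_chartE by metis
  then interpret cy_chart \<Sigma> \<sigma> A B J \<nu> by simp
  show "inj_on (snd c) (fst c)" using inj_chart * by simp
  show "continuous_on (snd c ` fst c) (atlas_vol \<Sigma> \<nu> c)"
    unfolding *(3) unfolding *(2) image_chart by (rule vol_cont)
  show "atlas_vol \<Sigma> \<nu> c (snd c x) \<noteq> 0" if "x \<in> fst c" for x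
    using that unfolding *(3) unfolding *(2) by (intro vol_nz chart_mem)
next
  fix c c' assume "c \<in> toric_atlas \<Sigma>" "c' \<in> toric_atlas \<Sigma>"
  then obtain \<sigma> A B J \<sigma>' A' B' J' where *: "chart_change \<Sigma> \<sigma> A B J \<nu> \<sigma>' A' B' J'"
    "c = toric_chart.chart \<Sigma> \<sigma> A" "c' = toric_chart.chart \<Sigma> \<sigma>' A'"
    "atlas_vol \<Sigma> \<nu> c = vol A B \<nu>" "atlas_vol \<Sigma> \<nu> c' = vol A' B' \<nu>" using chart_change by metis
  then interpret chart_change \<Sigma> \<sigma> A B J \<nu> \<sigma>' A' B' J' by simp
  have mat: "trans_mat c c' z = jac z" if "z \<in> overlap" for z
    unfolding *(2,3) by (rule trans_mat_eq[OF has_derivative_in_coords[OF that]])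
  show "open (snd c ` (fst c \<inter> fst c'))" using open_overlap by (simp add: overlap_def *)
  have "continuous_on overlap (trans_mat c c')"
    by (rule continuous_on_eq[OF continuous_on_jac]) (simp add: mat)
  thus "continuous_on (snd c ` (fst c \<inter> fst c')) (trans_mat c c')" by (simp add: overlap_def *)
  fix x assume x: "x \<in> fst c" "x \<in> fst c'"
  hence z: "snd c x \<in> overlap" by (auto simp: overlap_def *)
  show "(in_coords c c' (\<lambda>x. x) has_derivative (*v) (trans_mat c c' (snd c x))) (at (snd c x))"
    using has_derivative_in_coords[OF z] mat[OF z] by (simp add: *)
  show "det (trans_mat c c' (snd c x)) * atlas_vol \<Sigma> \<nu> c' (snd c' x) = atlas_vol \<Sigma> \<nu> c (snd c x)"
    using det_jac[OF z] mat[OF z] trans_map_coord[of x] x unfolding *(4,5) by (simp add: *)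
qed

end

text \<open>\<Phi> is known to be differentiable only at z, so the implicit function theorem does
  not apply. With a linear right inverse g of D, a curve z + t v + g (y t) is sought in the level
  set with y t = o(t). Such points exist by Brouwer's theorem, and near-minimal ones fit together to
  a curve with velocity v.\<close>

lemma tangent_set_level_set:
  fixes \<Phi> :: "'a::euclidean_space \<Rightarrow> 'b::euclidean_space"
  assumes U: "open U" "z \<in> U" and cont: "continuous_on U \<Phi>"
    and D: "(\<Phi> has_derivative D) (at z)" "surj D"
  shows "tangent_set {y\<in>U. \<Phi> y = \<Phi> z} z = {v. D v = 0}"
proof (intro equalityI subsetI)
  fix v assume "v \<in> tangent_set {y\<in>U. \<Phi> y = \<Phi> z} z"
  then obtain \<gamma> :: "real \<Rightarrow> 'a" where \<gamma>: "range \<gamma> \<subseteq> {y\<in>U. \<Phi> y = \<Phi> z}" "\<gamma> 0 = z" "(\<gamma> has_vector_derivative v) (at 0)"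
    by (auto simp: tangent_set_def)
  have "(\<Phi> \<circ> \<gamma> has_derivative D \<circ> (\<lambda>t. t *\<^sub>R v)) (at 0)"
    by (rule diff_chain_at) (use \<gamma> D in \<open>auto simp: has_vector_derivative_def\<close>)
  moreover have "\<Phi> \<circ> \<gamma> = (\<lambda>t. \<Phi> z)" using \<gamma>(1) by (auto simp: fun_eq_iff)
  moreover have "((\<lambda>t::real. \<Phi> z) has_derivative (\<lambda>t. 0)) (at 0)" by simp
  ultimately have "D \<circ> (\<lambda>t. t *\<^sub>R v) = (\<lambda>t. 0)" using has_derivative_unique by metis
  from fun_cong[OF this, of 1] show "v \<in> {v. D v = 0}" by simp
next
  fix v assume "v \<in> {v. D v = 0}"
  hence v: "D v = 0" by simp
  have lin: "linear D" using D(1) has_derivative_linear by blast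
  obtain g where g: "linear g" "D \<circ> g = id"
    using linear_surjective_right_inverse[OF lin D(2)] by blast
  obtain B where B: "B > 0" "\<And>y. norm (g y) \<le> B * norm y"
    using linear_bounded_pos[OF g(1)] by blast
  have contg: "continuous_on S g" for S using g(1) linear_continuous_on linear_conv_bounded_linear by blast
  define Y where "Y t = {y. z + t *\<^sub>R v + g y \<in> U \<and> \<Phi> (z + t *\<^sub>R v + g y) = \<Phi> z}" for t :: real
  have solve: "\<exists>\<delta>>0. \<forall>t. \<bar>t\<bar> < \<delta> \<longrightarrow> (\<exists>y\<in>Y t. norm y \<le> e * \<bar>t\<bar>)" if e: "0 < e" "e \<le> 1" for e
  proof -
    \<comment> \<open>For \<open>e \<le> 1\<close> and y in the ball of radius e |t|, the
      displacement t v + g y has norm at most C |t|.\<close>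
    define C where "C = norm v + B + 1"
    have C: "C > 0" using B(1) by (simp add: C_def add_nonneg_pos)
    obtain d1 where d1: "d1 > 0" "ball z d1 \<subseteq> U" using U openE by blast
    obtain d2 where d2: "d2 > 0" "\<And>y. norm (y - z) < d2 \<Longrightarrow> norm (\<Phi> y - \<Phi> z - D (y - z)) \<le> e / C * norm (y - z)"
      using D(1) e C unfolding has_derivative_at_alt by (metis divide_pos_pos)
    define \<delta> where "\<delta> = min d1 d2 / C"
    have "\<exists>y\<in>Y t. norm y \<le> e * \<bar>t\<bar>" if t: "\<bar>t\<bar> < \<delta>" for t
    proof -
      let ?p = "\<lambda>y. z + t *\<^sub>R v + g y"
      let ?S = "cball (0::'b) (e * \<bar>t\<bar>)"
      have nb: "norm (?p y - z) \<le> \<bar>t\<bar> * C" if "y \<in> ?S" for y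
      proof -
        have "norm (?p y - z) \<le> norm (t *\<^sub>R v) + norm (g y)" using norm_triangle_ineq[of "t *\<^sub>R v" "g y"] by simp
        also have "\<dots> \<le> \<bar>t\<bar> * norm v + B * (e * \<bar>t\<bar>)"
          using B(2)[of y] that B(1) by (smt (verit) mem_cball_0 mult_left_mono norm_scaleR)
        also have "\<dots> \<le> \<bar>t\<bar> * norm v + B * (1 * \<bar>t\<bar>)"
          using e B(1) by (intro add_left_mono mult_left_mono mult_right_mono) auto
        also have "\<dots> \<le> \<bar>t\<bar> * C" by (simp add: C_def algebra_simps)
        finally show ?thesis .
      qed
      have "\<bar>t\<bar> * C < min d1 d2" using t C by (simp add: \<delta>_def pos_less_divide_eq)
      hence nb': "norm (?p y - z) < d1" "norm (?p y - z) < d2" if "y \<in> ?S" for y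
        using nb[OF that] by linarith+
      have inU: "?p y \<in> U" if "y \<in> ?S" for y
      proof -
        have "dist (?p y) z < d1" using nb'(1)[OF that] by (simp only: dist_norm)
        hence "?p y \<in> ball z d1" by (simp only: mem_ball dist_commute)
        thus ?thesis using d1(2) by blast
      qed
      \<comment> \<open>A fixed point of h solves the equation. As D kills v and inverts g,
        \<open>h y\<close> is minus the error of the linear approximation, which the choice of
        \<open>d2\<close> keeps within the radius e |t|.\<close>
      define h where "h y = y - (\<Phi> (?p y) - \<Phi> z)" for y
      have "h ` ?S \<subseteq> ?S"
      proof safe
        fix y assume y: "y \<in> ?S"
        have "D (?p y - z) = y"
        proof -
          have "D (?p y - z) = D (t *\<^sub>R v + g y)" by simp
          also have "\<dots> = y" using fun_cong[OF g(2), of y] by (simp add: linear_add[OF lin] linear_cmul[OF lin] v)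
          finally show ?thesis .
        qed
        hence "norm (h y) = norm (\<Phi> (?p y) - \<Phi> z - D (?p y - z))" by (simp add: h_def norm_minus_commute)
        also have "\<dots> \<le> e / C * norm (?p y - z)" using d2(2)[OF nb'(2)[OF y]] .
        also have "\<dots> \<le> e / C * (\<bar>t\<bar> * C)" using nb[OF y] e C by (intro mult_left_mono) auto
        also have "\<dots> = e * \<bar>t\<bar>" using C by simp
        finally show "h y \<in> ?S" by simp
      qed
      moreover have "continuous_on ?S h" unfolding h_def
      proof (intro continuous_intros)
        show "continuous_on ?S (\<lambda>y. \<Phi> (?p y))"
          by (rule continuous_on_compose2[OF cont]) (use inU in \<open>auto intro!: continuous_intros contg\<close>)
      qed
      moreover have "?S \<noteq> {}" using e by (simp add: not_less)
      ultimately obtain y where y: "y \<in> ?S" "h y = y"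
        using brouwer[OF compact_cball convex_cball] by (metis image_subset_iff_funcset)
      hence "y \<in> Y t" using inU[OF y(1)] by (simp add: Y_def h_def)
      thus ?thesis using y(1) by auto
    qed
    thus ?thesis using d1 d2 C by (intro exI[of _ \<delta>]) (auto simp: \<delta>_def)
  qed
  \<comment> \<open>The solutions found for different e need not coincide. A choice within t^2 of
    the smallest norm competes with all of them at once, and t^2 is itself o(t).\<close>
  have "\<exists>y. y \<in> Y t \<and> (\<forall>y'\<in>Y t. norm y \<le> norm y' + t\<^sup>2)" if "Y t \<noteq> {}" "t \<noteq> 0" for t
  proof -
    have bdd: "bdd_below (norm ` Y t)" by (rule bdd_belowI[of _ 0]) auto
    have "Inf (norm ` Y t) < Inf (norm ` Y t) + t\<^sup>2" using that by simp
    moreover have "norm ` Y t \<noteq> {}" using that by simp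
    ultimately have "\<exists>r\<in>norm ` Y t. r < Inf (norm ` Y t) + t\<^sup>2" by (rule cInf_lessD[rotated])
    then obtain y where "y \<in> Y t" "norm y < Inf (norm ` Y t) + t\<^sup>2" by blast
    moreover have "Inf (norm ` Y t) \<le> norm y'" if "y' \<in> Y t" for y'
      using cInf_lower[OF _ bdd] that by blast
    ultimately show ?thesis by (meson add_right_mono less_le_not_le order_trans less_imp_le)
  qed
  then obtain y where y: "\<And>t. Y t \<noteq> {} \<Longrightarrow> t \<noteq> 0 \<Longrightarrow> y t \<in> Y t \<and> (\<forall>y'\<in>Y t. norm (y t) \<le> norm y' + t\<^sup>2)"
    by metis
  define \<gamma> where "\<gamma> t = (if t = 0 \<or> Y t = {} then z else z + t *\<^sub>R v + g (y t))" for t :: real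
  have "range \<gamma> \<subseteq> {y\<in>U. \<Phi> y = \<Phi> z}"
    using y U(2) by (auto simp: \<gamma>_def Y_def)
  moreover have "\<gamma> 0 = z" by (simp add: \<gamma>_def)
  moreover have "(\<gamma> has_vector_derivative v) (at 0)"
    unfolding has_vector_derivative_def has_derivative_at_alt
  proof (intro conjI allI impI)
    fix e :: real assume e: "e > 0"
    \<comment> \<open>Half of the error is left for the t^2 term, and B accounts for the norm of
      g.\<close>
    define e' where "e' = min 1 (e / (2 * B))"
    have e': "0 < e'" "e' \<le> 1" "B * e' \<le> e / 2" using e B(1) by (auto simp: e'_def min_def field_simps)
    obtain \<delta> where \<delta>: "\<delta> > 0" "\<And>t. \<bar>t\<bar> < \<delta> \<Longrightarrow> \<exists>y\<in>Y t. norm y \<le> e' * \<bar>t\<bar>" using solve[OF e'(1,2)] by blast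
    define \<delta>' where "\<delta>' = min \<delta> (e / (2 * B))"
    show "\<exists>d>0. \<forall>t. norm (t - 0) < d \<longrightarrow> norm (\<gamma> t - \<gamma> 0 - (t - 0) *\<^sub>R v) \<le> e * norm (t - 0)"
    proof (rule exI[of _ \<delta>'], intro conjI allI impI)
      show "\<delta>' > 0" using \<delta> e B(1) by (simp add: \<delta>'_def)
      fix t :: real assume t: "norm (t - 0) < \<delta>'"
      show "norm (\<gamma> t - \<gamma> 0 - (t - 0) *\<^sub>R v) \<le> e * norm (t - 0)"
      proof (cases "t = 0")
        case False
        obtain y' where y': "y' \<in> Y t" "norm y' \<le> e' * \<bar>t\<bar>" using \<delta>(2)[of t] t by (auto simp: \<delta>'_def)
        have "norm (y t) \<le> e' * \<bar>t\<bar> + t\<^sup>2" using y[of t] y' False by fastforce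
        hence "B * norm (y t) \<le> B * (e' * \<bar>t\<bar> + t\<^sup>2)" using B(1) by simp
        also have "\<dots> = (B * e' + B * \<bar>t\<bar>) * \<bar>t\<bar>" by (simp add: algebra_simps power2_eq_square)
        also have "\<dots> \<le> (e / 2 + e / 2) * \<bar>t\<bar>"
        proof (rule mult_right_mono)
          have "\<bar>t\<bar> \<le> e / (2 * B)" using t by (simp add: \<delta>'_def)
          hence "B * \<bar>t\<bar> \<le> B * (e / (2 * B))" using B(1) by (intro mult_left_mono) auto
          also have "\<dots> = e / 2" using B(1) by simp
          finally show "B * e' + B * \<bar>t\<bar> \<le> e / 2 + e / 2" using e'(3) by linarith
        qed simp
        finally have "norm (g (y t)) \<le> e * \<bar>t\<bar>" using B(2)[of "y t"] by simp
        thus ?thesis using False y'(1) by (auto simp: \<gamma>_def)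
      qed (simp add: \<gamma>_def)
    qed
  qed (rule bounded_linear_scaleR_left)
  ultimately show "v \<in> tangent_set {y\<in>U. \<Phi> y = \<Phi> z} z" by (auto simp: tangent_set_def)
qed

section \<open>Torus orbits and the moment map\<close>

lemma cis_sum: "finite I \<Longrightarrow> cis (\<Sum>i\<in>I. f i) = (\<Prod>i\<in>I. cis (f i))"
  by (induction I rule: finite_induct) (simp_all flip: cis_mult)

lemma has_vector_derivative_vecI:
  fixes \<gamma> :: "real \<Rightarrow> complex ^ 'n::finite"
  assumes "\<And>j. ((\<lambda>t. \<gamma> t $ j) has_vector_derivative v $ j) (at t)"
  shows "(\<gamma> has_vector_derivative v) (at t)"
  using assms unfolding has_vector_derivative_def
  by (intro has_derivative_vecI) simp

locale gross_chart = cy_chart +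
  fixes \<omega> \<mu>\<^sub>0
  assumes kaehler: "toric_kaehler_form \<Sigma> \<omega>" and moment: "moment_map \<Sigma> \<omega> \<mu>\<^sub>0"
begin

definition rot :: "real ^ 'a \<Rightarrow> complex ^ 'a \<Rightarrow> complex ^ 'a" where
  "rot \<theta> z = (\<chi> j. cis (rvec (A $ j) \<bullet> \<theta>) * z $ j)"

text \<open>The noncompact part of the complex torus; together with \<open>rot\<close> it sweeps out
  the open orbit.\<close>

definition stretch :: "real ^ 'a \<Rightarrow> complex ^ 'a \<Rightarrow> complex ^ 'a" where
  "stretch \<xi> z = (\<chi> j. of_real (exp (rvec (A $ j) \<bullet> \<xi>)) * z $ j)"

definition fund_vec :: "real ^ 'a \<Rightarrow> complex ^ 'a \<Rightarrow> complex ^ 'a" where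
  "fund_vec \<xi> z = (\<chi> j. \<i> * of_real (rvec (A $ j) \<bullet> \<xi>) * z $ j)"

definition "mu z = \<mu>\<^sub>0 (pt B z)"

definition "dmu z = frechet_derivative (\<mu>\<^sub>0 \<circ> coord_inv chart) (at z)"

lemma mon_rot: "mon B m (rot \<theta> z) = cis (rvec m \<bullet> \<theta>) * mon B m z"
proof -
  have "mon B m (rot \<theta> z) = (\<Prod>j\<in>UNIV. cis (of_int (ipair m (B $ j)) * (rvec (A $ j) \<bullet> \<theta>))) * mon B m z"
    by (simp add: mon_def rot_def power_int_mult_distrib prod.distrib cis_power_int)
  also have "(\<Prod>j\<in>UNIV. cis (of_int (ipair m (B $ j)) * (rvec (A $ j) \<bullet> \<theta>))) = cis (rvec m \<bullet> \<theta>)"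
    by (subst inner_expand[OF dual, of m]) (simp add: cis_sum)
  finally show ?thesis .
qed

lemma torus_act_pt: "torus_act \<theta> (pt B z) = pt B (rot \<theta> z)"
proof -
  have "regular_at B m (rot \<theta> z) \<longleftrightarrow> regular_at B m z" for m by (simp add: regular_at_def rot_def)
  thus ?thesis by (simp add: fun_eq_iff torus_act_def pt_def mon_rot)
qed

lemma rot_range: "rot \<theta> z \<in> coord_range \<longleftrightarrow> z \<in> coord_range"
  by (simp add: coord_range_def rot_def)

lemma stretch_range: "stretch \<theta> z \<in> coord_range \<longleftrightarrow> z \<in> coord_range"
  by (simp add: coord_range_def stretch_def)

lemma linear_rot: "linear (rot \<theta>)"
  by (simp add: linear_iff rot_def vec_eq_iff algebra_simps)

lemma fund_vec_rot: "fund_vec \<xi> (rot \<theta> z) = rot \<theta> (fund_vec \<xi> z)"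
  by (simp add: rot_def fund_vec_def vec_eq_iff)

lemma fund_vec_add: "fund_vec (\<xi> + \<eta>) z = fund_vec \<xi> z + fund_vec \<eta> z"
  by (simp add: fund_vec_def vec_eq_iff inner_add_right algebra_simps)

lemma fund_vec_scaleR: "fund_vec (r *\<^sub>R \<xi>) z = r *\<^sub>R fund_vec \<xi> z"
  by (simp add: fund_vec_def vec_eq_iff inner_scaleR_right) (simp add: scaleR_conv_of_real)

lemma fund_vec_zero [simp]: "fund_vec 0 z = 0"
  by (simp add: fund_vec_def vec_eq_iff)

lemma fund_vec_sum: "fund_vec (\<Sum>i\<in>I. f i) z = (\<Sum>i\<in>I. fund_vec (f i) z)"
  by (induction I rule: infinite_finite_induct) (simp_all add: fund_vec_add)

lemma kaehler_form_chart:
  assumes z: "z \<in> coord_range"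
  shows bil: "bilinear (\<omega> chart z)" and alt: "\<omega> chart z u u = 0"
    and Jinv: "\<omega> chart z (\<i> *s u) (\<i> *s v) = \<omega> chart z u v"
    and pos: "u \<noteq> 0 \<Longrightarrow> \<omega> chart z u (\<i> *s u) > 0"
proof -
  have k: "kaehler_form (toric_atlas \<Sigma>) \<omega>" using kaehler by (simp add: toric_kaehler_form_def)
  hence s: "smooth_two_form (toric_atlas \<Sigma>) \<omega>" by (simp add: kaehler_form_def)
  have zc: "z \<in> snd chart ` fst chart" using z image_chart by simp
  show "bilinear (\<omega> chart z)" "\<omega> chart z u u = 0"
    using s zc chart_in_atlas unfolding smooth_two_form_def by blast+
  show "\<omega> chart z (\<i> *s u) (\<i> *s v) = \<omega> chart z u v" "u \<noteq> 0 \<Longrightarrow> \<omega> chart z u (\<i> *s u) > 0"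
    using k zc chart_in_atlas unfolding kaehler_form_def by blast+
qed

lemma skew:
  assumes z: "z \<in> coord_range" shows "\<omega> chart z u v = - \<omega> chart z v u"
  using alt[OF z, of "u + v"] alt[OF z, of u] alt[OF z, of v]
  by (simp add: bilinear_ladd[OF bil[OF z]] bilinear_radd[OF bil[OF z]])

lemma form_rot:
  assumes z: "z \<in> coord_range"
  shows "\<omega> chart (rot \<theta> z) (rot \<theta> u) (rot \<theta> v) = \<omega> chart z u v"
proof -
  have "preserves_form (toric_atlas \<Sigma>) \<omega> (torus_act \<theta>)"
    using kaehler by (simp add: toric_kaehler_form_def)
  moreover have "pt B z \<in> fst chart" "torus_act \<theta> (pt B z) \<in> fst chart"
    using pt_mem z rot_range by (auto simp: torus_act_pt)
  ultimately have *: "\<omega> chart (snd chart (pt B z)) u v = \<omega> chart (snd chart (torus_act \<theta> (pt B z)))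
     (frechet_derivative (in_coords chart chart (torus_act \<theta>)) (at (snd chart (pt B z))) u)
     (frechet_derivative (in_coords chart chart (torus_act \<theta>)) (at (snd chart (pt B z))) v)"
    using chart_in_atlas unfolding preserves_form_def Let_def by blast
  have "(rot \<theta> has_derivative rot \<theta>) (at z)"
    using linear_rot linear_conv_bounded_linear bounded_linear_imp_has_derivative by blast
  hence "(in_coords chart chart (torus_act \<theta>) has_derivative rot \<theta>) (at z)"
    by (rule has_derivative_transform_within_open[OF _ open_coord_range z])
      (simp add: in_coords_def torus_act_pt)
  hence "frechet_derivative (in_coords chart chart (torus_act \<theta>)) (at z) = rot \<theta>"
    by (rule frechet_derivative_at[symmetric])
  thus ?thesis using * by (simp add: torus_act_pt)
qed

lemma rot_deriv: "((\<lambda>t. rot (t *\<^sub>R \<eta>) z) has_vector_derivative fund_vec \<eta> (rot (t *\<^sub>R \<eta>) z)) (at t)"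
proof (rule has_vector_derivative_vecI)
  fix j
  let ?a = "rvec (A $ j) \<bullet> \<eta>"
  have "((\<lambda>s. exp (\<i> * (s * of_real ?a)) * z $ j) has_field_derivative
      \<i> * of_real ?a * (exp (\<i> * (of_real t * of_real ?a)) * z $ j)) (at (of_real t))"
    by (auto intro!: derivative_eq_intros)
  from has_vector_derivative_real_field[OF this]
  show "((\<lambda>t. rot (t *\<^sub>R \<eta>) z $ j) has_vector_derivative fund_vec \<eta> (rot (t *\<^sub>R \<eta>) z) $ j) (at t)"
    by (simp add: rot_def fund_vec_def cis_conv_exp inner_scaleR_right)
qed

lemma stretch_deriv: "((\<lambda>t. stretch (t *\<^sub>R \<eta>) z) has_vector_derivative - (\<i> *s fund_vec \<eta> (stretch (t *\<^sub>R \<eta>) z))) (at t)"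
proof (rule has_vector_derivative_vecI)
  fix j
  let ?a = "rvec (A $ j) \<bullet> \<eta>"
  have "((\<lambda>s. exp (s * of_real ?a) * z $ j) has_field_derivative
      of_real ?a * (exp (of_real t * of_real ?a) * z $ j)) (at (of_real t))"
    by (auto intro!: derivative_eq_intros)
  from has_vector_derivative_real_field[OF this]
  show "((\<lambda>t. stretch (t *\<^sub>R \<eta>) z $ j) has_vector_derivative (- (\<i> *s fund_vec \<eta> (stretch (t *\<^sub>R \<eta>) z))) $ j) (at t)"
    by (simp add: stretch_def fund_vec_def inner_scaleR_right mult.assoc[symmetric] flip: exp_of_real)
qed

lemma fundamental_vector_pt:
  assumes z: "z \<in> coord_range"
  shows "fundamental_vector chart \<xi> (pt B z) = fund_vec \<xi> z"
  using rot_deriv[of \<xi> z 0] unfolding fundamental_vector_def torus_act_pt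
  by (simp add: vector_derivative_at) (simp add: rot_def)

lemma mu_has_derivative:
  assumes z: "z \<in> coord_range"
  shows "(mu has_derivative dmu z) (at z)" and "dmu z v \<bullet> \<xi> = \<omega> chart z v (fund_vec \<xi> z)"
    and "((\<mu>\<^sub>0 \<circ> coord_inv chart) has_derivative dmu z) (at z)"
proof -
  have "smooth_on (snd chart ` fst chart) (\<mu>\<^sub>0 \<circ> coord_inv chart)"
    using moment chart_in_atlas unfolding moment_map_def smooth_fun_def by blast
  hence "Ck_on 1 coord_range (\<mu>\<^sub>0 \<circ> coord_inv chart)" by (simp add: smooth_on_def image_chart)
  hence "(\<mu>\<^sub>0 \<circ> coord_inv chart) differentiable (at z)" using z by simp
  thus d: "((\<mu>\<^sub>0 \<circ> coord_inv chart) has_derivative dmu z) (at z)"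
    unfolding dmu_def by (simp add: frechet_derivative_works)
  thus "(mu has_derivative dmu z) (at z)"
    by (rule has_derivative_transform_within_open[OF _ open_coord_range z]) (simp add: mu_def)
  have "((\<lambda>z. \<mu>\<^sub>0 (coord_inv chart z) \<bullet> \<xi>) has_derivative (\<lambda>v. dmu z v \<bullet> \<xi>)) (at z)"
    using has_derivative_inner_left[OF d, of \<xi>] by simp
  hence "frechet_derivative (\<lambda>z. \<mu>\<^sub>0 (coord_inv chart z) \<bullet> \<xi>) (at z) = (\<lambda>v. dmu z v \<bullet> \<xi>)"
    by (rule frechet_derivative_at[symmetric])
  moreover have "frechet_derivative (\<lambda>z. \<mu>\<^sub>0 (coord_inv chart z) \<bullet> \<xi>) (at (snd chart (pt B z))) v =
        \<omega> chart (snd chart (pt B z)) v (fundamental_vector chart \<xi> (pt B z))"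
    using moment chart_in_atlas pt_mem[OF z] unfolding moment_map_def by blast
  ultimately show "dmu z v \<bullet> \<xi> = \<omega> chart z v (fund_vec \<xi> z)"
    by (simp add: fundamental_vector_pt[OF z])
qed

lemma mu_chain:
  assumes "(\<gamma> has_vector_derivative v) (at t)" "\<gamma> t \<in> coord_range"
  shows "((\<lambda>t. mu (\<gamma> t) \<bullet> \<xi>) has_real_derivative \<omega> chart (\<gamma> t) v (fund_vec \<xi> (\<gamma> t))) (at t)"
proof -
  have "(mu \<circ> \<gamma> has_derivative dmu (\<gamma> t) \<circ> (\<lambda>s. s *\<^sub>R v)) (at t)"
    by (rule diff_chain_at) (use assms mu_has_derivative(1) in \<open>auto simp: has_vector_derivative_def\<close>)
  from has_derivative_inner_left[OF this, of \<xi>]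
  have "((\<lambda>t. mu (\<gamma> t) \<bullet> \<xi>) has_derivative (\<lambda>s. dmu (\<gamma> t) (s *\<^sub>R v) \<bullet> \<xi>)) (at t)" by simp
  moreover have "dmu (\<gamma> t) (s *\<^sub>R v) \<bullet> \<xi> = \<omega> chart (\<gamma> t) v (fund_vec \<xi> (\<gamma> t)) * s" for s
    by (simp add: mu_has_derivative(2)[OF assms(2)] bilinear_lmul[OF bil[OF assms(2)]])
  ultimately show ?thesis by (simp add: has_field_derivative_def)
qed

text \<open>By invariance of the form, the moment component along \<xi> changes at a constant rate
  \<kappa> on the orbit of the one-parameter group of \<open>B $ k\<close>. A lattice vector
  generates a circle, so this orbit closes up and \<kappa> must be 0. Other one-parameter groups
  need not close up; they follow by linearity.\<close>

lemma isotropic_basis: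
  assumes z: "z \<in> coord_range"
  shows "\<omega> chart z (fund_vec (rvec (B $ k)) z) (fund_vec \<xi> z) = 0"
proof -
  let ?\<eta> = "rvec (B $ k)"
  define \<kappa> where "\<kappa> = \<omega> chart z (fund_vec ?\<eta> z) (fund_vec \<xi> z)"
  have "((\<lambda>t. mu (rot (t *\<^sub>R ?\<eta>) z) \<bullet> \<xi> - \<kappa> * t) has_real_derivative 0) (at t)" for t
  proof -
    have "((\<lambda>t. mu (rot (t *\<^sub>R ?\<eta>) z) \<bullet> \<xi>) has_real_derivative \<kappa>) (at t)"
      using mu_chain[OF rot_deriv[of ?\<eta> z t], of \<xi>] z by (simp add: rot_range fund_vec_rot form_rot \<kappa>_def)
    thus ?thesis by (auto intro!: derivative_eq_intros)
  qed
  hence "mu (rot (t *\<^sub>R ?\<eta>) z) \<bullet> \<xi> - \<kappa> * t = mu (rot (0 *\<^sub>R ?\<eta>) z) \<bullet> \<xi> - \<kappa> * 0" for t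
    by (intro DERIV_isconst_all) auto
  from this[of "2 * pi"] have "mu (rot ((2 * pi) *\<^sub>R ?\<eta>) z) \<bullet> \<xi> - \<kappa> * (2 * pi) = mu (rot 0 z) \<bullet> \<xi>" by simp
  moreover have "rot ((2 * pi) *\<^sub>R ?\<eta>) z = z" "rot 0 z = z"
    by (simp_all add: rot_def vec_eq_iff dual_bases_inner[OF dual] cis_2pi)
  ultimately show ?thesis by (simp add: \<kappa>_def)
qed

lemma isotropic:
  assumes z: "z \<in> coord_range"
  shows "\<omega> chart z (fund_vec \<eta> z) (fund_vec \<xi> z) = 0"
proof -
  have lin: "linear (\<lambda>u. \<omega> chart z u (fund_vec \<xi> z))" using bil[OF z] by (simp add: bilinear_def)
  have "fund_vec \<eta> z = (\<Sum>k\<in>UNIV. (rvec (A $ k) \<bullet> \<eta>) *\<^sub>R fund_vec (rvec (B $ k)) z)"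
    by (subst dual_bases_expand[OF dual, of \<eta>]) (simp add: fund_vec_sum fund_vec_scaleR)
  hence "\<omega> chart z (fund_vec \<eta> z) (fund_vec \<xi> z) =
      (\<Sum>k\<in>UNIV. \<omega> chart z ((rvec (A $ k) \<bullet> \<eta>) *\<^sub>R fund_vec (rvec (B $ k)) z) (fund_vec \<xi> z))"
    using linear_sum[OF lin] by metis
  also have "\<dots> = 0"
    by (intro sum.neutral ballI) (simp only: bilinear_lmul[OF bil[OF z]] isotropic_basis[OF z] scaleR_zero_right)
  finally show ?thesis .
qed

lemma mu_rot:
  assumes z: "z \<in> coord_range" shows "mu (rot \<theta> z) = mu z"
proof -
  have "mu (rot \<theta> z) \<bullet> \<xi> = mu z \<bullet> \<xi>" for \<xi>
  proof -
    have "((\<lambda>t. mu (rot (t *\<^sub>R \<theta>) z) \<bullet> \<xi>) has_real_derivative 0) (at t)" for t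
      using mu_chain[OF rot_deriv[of \<theta> z t], of \<xi>] z by (simp add: rot_range fund_vec_rot form_rot isotropic)
    hence "mu (rot (t *\<^sub>R \<theta>) z) \<bullet> \<xi> = mu (rot (0 *\<^sub>R \<theta>) z) \<bullet> \<xi>" for t
      by (intro DERIV_isconst_all) auto
    from this[of 1] show ?thesis by (simp add: rot_def)
  qed
  thus ?thesis by (metis inner_commute vector_eq_rdot)
qed

text \<open>The velocity of the stretching is -\<i> X with X the fundamental vector, so the
  derivative of the component along \<xi> is \<omega>(-\<i> X, X) = \<omega>(X, \<i> X), which is
  positive.\<close>

lemma mu_stretch:
  assumes z: "z \<in> coord_range" and nz: "fund_vec \<xi> z \<noteq> 0" and st: "s < t"
  shows "mu (stretch (s *\<^sub>R \<xi>) z) \<bullet> \<xi> < mu (stretch (t *\<^sub>R \<xi>) z) \<bullet> \<xi>"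
proof -
  have "\<exists>y. ((\<lambda>t. mu (stretch (t *\<^sub>R \<xi>) z) \<bullet> \<xi>) has_real_derivative y) (at t) \<and> 0 < y" for t
  proof -
    let ?z = "stretch (t *\<^sub>R \<xi>) z"
    have r: "?z \<in> coord_range" using z stretch_range by simp
    obtain j where "fund_vec \<xi> z $ j \<noteq> 0" using nz by (auto simp: vec_eq_iff)
    hence "fund_vec \<xi> ?z $ j \<noteq> 0" by (simp add: fund_vec_def stretch_def)
    hence "fund_vec \<xi> ?z \<noteq> 0" by (metis zero_index)
    from pos[OF r this] have "\<omega> chart ?z (- (\<i> *s fund_vec \<xi> ?z)) (fund_vec \<xi> ?z) > 0"
      using skew[OF r, of "\<i> *s fund_vec \<xi> ?z" "fund_vec \<xi> ?z"] unfolding bilinear_lneg[OF bil[OF r]] by linarith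
    thus ?thesis using mu_chain[OF stretch_deriv r, of \<xi>] by blast
  qed
  thus ?thesis using DERIV_pos_imp_increasing[OF st] by blast
qed

end

section \<open>The Lagrangian tangent spaces\<close>

lemma det_of_real: "det (\<chi> i j. complex_of_real (R $ i $ j)) = of_real (det (R :: real ^ 'n ^ 'n::finite))"
  by (simp add: det_def)

text \<open>A line is the orthogonal complement of its own orthogonal complement. Conditions in the
  quotient can thus be tested on directions orthogonal to \<nu>.\<close>

lemma quot_class_eq_iff:
  "quot_class \<nu> a = quot_class \<nu> b \<longleftrightarrow> (\<forall>\<xi>. rvec \<nu> \<bullet> \<xi> = 0 \<longrightarrow> a \<bullet> \<xi> = b \<bullet> \<xi>)"
proof -
  have "quot_class \<nu> a = quot_class \<nu> b \<longleftrightarrow> a - b \<in> span {rvec \<nu>}"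
  proof
    assume "quot_class \<nu> a = quot_class \<nu> b"
    moreover have "a \<in> quot_class \<nu> a" by (auto simp: quot_class_def span_zero intro!: image_eqI[of _ _ 0])
    ultimately show "a - b \<in> span {rvec \<nu>}" by (auto simp: quot_class_def)
  next
    have *: "quot_class \<nu> a \<subseteq> quot_class \<nu> b" if "a - b \<in> span {rvec \<nu>}" for a b
    proof
      fix x assume "x \<in> quot_class \<nu> a"
      then obtain s where s: "s \<in> span {rvec \<nu>}" "x = a + s" by (auto simp: quot_class_def)
      hence "(a - b) + s \<in> span {rvec \<nu>}" using that by (intro span_add)
      moreover have "x = b + ((a - b) + s)" by (simp add: s)
      ultimately show "x \<in> quot_class \<nu> b" unfolding quot_class_def by blast
    qed
    assume ab: "a - b \<in> span {rvec \<nu>}"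
    hence "b - a \<in> span {rvec \<nu>}" using span_neg[OF ab] by simp
    with ab show "quot_class \<nu> a = quot_class \<nu> b" using * by blast
  qed
  also have "\<dots> \<longleftrightarrow> (\<forall>\<xi>. rvec \<nu> \<bullet> \<xi> = 0 \<longrightarrow> a \<bullet> \<xi> = b \<bullet> \<xi>)"
  proof
    assume "a - b \<in> span {rvec \<nu>}"
    then obtain k where "a - b = k *\<^sub>R rvec \<nu>" by (auto simp: span_singleton)
    hence "a = b + k *\<^sub>R rvec \<nu>" by (simp add: algebra_simps)
    thus "\<forall>\<xi>. rvec \<nu> \<bullet> \<xi> = 0 \<longrightarrow> a \<bullet> \<xi> = b \<bullet> \<xi>" by (simp add: inner_add_left)
  next
    assume *: "\<forall>\<xi>. rvec \<nu> \<bullet> \<xi> = 0 \<longrightarrow> a \<bullet> \<xi> = b \<bullet> \<xi>"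
    let ?r = "rvec \<nu> :: real ^ 'a"
    define c where "c = ((a - b) \<bullet> ?r) / (?r \<bullet> ?r)"
    define d where "d = (a - b) - c *\<^sub>R ?r"
    have "?r \<bullet> d = 0" by (cases "?r = 0") (auto simp: d_def c_def inner_diff_right inner_commute)
    hence "(a - b) \<bullet> d = 0" "?r \<bullet> d = 0" using * by (auto simp: inner_diff_left)
    hence "d \<bullet> d = 0" by (simp add: d_def inner_diff_left)
    hence "a - b = c *\<^sub>R ?r" by (simp add: d_def)
    thus "a - b \<in> span {?r}" unfolding span_singleton by blast
  qed
  finally show ?thesis .
qed

locale gross_frame = gross_chart +
  fixes k0
  assumes k0: "\<nu> $ k0 \<noteq> 0"
begin

definition dw :: "complex ^ 'a \<Rightarrow> complex ^ 'a \<Rightarrow> complex" where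
  "dw z v = (\<Sum>l\<in>UNIV. dmon B \<nu> z l * v $ l)"

text \<open>The projection onto the orthogonal complement of \<open>\<nu>\<close> along the \<open>k0\<close>-th coordinate axis.\<close>

definition proj :: "real ^ 'a \<Rightarrow> real ^ 'a" where
  "proj s = s - ((rvec \<nu> \<bullet> s) / of_int (\<nu> $ k0)) *\<^sub>R axis k0 1"

lemma \<nu>_axis: "rvec \<nu> \<bullet> axis k0 1 = of_int (\<nu> $ k0)"
  by (simp add: inner_axis rvec_def)

lemma proj_orth: "rvec \<nu> \<bullet> proj s = 0"
  using k0 by (simp add: proj_def inner_diff_right \<nu>_axis)

lemma proj_id: "rvec \<nu> \<bullet> s = 0 \<Longrightarrow> proj s = s" by (simp add: proj_def)

lemma proj_axis: "proj (axis k0 1) = 0" using k0 by (simp add: proj_def \<nu>_axis)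

lemma linear_proj: "linear proj"
  by (simp add: linear_iff proj_def inner_add_right add_divide_distrib algebra_simps)

lemma proj_nth: "j \<noteq> k0 \<Longrightarrow> proj s $ j = s $ j"
  by (simp add: proj_def axis_def)

lemma proj_sum: "proj s = (\<Sum>l\<in>UNIV. s $ l *\<^sub>R proj (axis l 1))"
proof -
  have "proj s = proj (\<Sum>l\<in>UNIV. s $ l *\<^sub>R axis l 1)"
    by (rule arg_cong[of _ _ proj]) (simp add: vec_eq_iff axis_def if_distrib cong: if_cong)
  thus ?thesis by (simp add: linear_sum[OF linear_proj] linear_cmul[OF linear_proj])
qed

lemma proj_eq_0: "proj s = 0 \<Longrightarrow> j \<noteq> k0 \<Longrightarrow> s $ j = 0"
  using proj_nth[of j s] by simp

text \<open>A basis made of the hyperplane orthogonal to \<nu> and one vector outside it: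
  \<open>axis k0 1\<close> takes the place of \<open>proj (axis k0 1)\<close>, which is 0.\<close>

definition nbasis :: "real ^ 'a ^ 'a" where
  "nbasis = (\<chi> i l. (if l = k0 then axis k0 1 else proj (axis l 1)) $ i)"

lemma det_nbasis: "det nbasis \<noteq> 0"
proof -
  have "x = 0" if "nbasis *v x = 0" for x
  proof -
    have eq: "nbasis *v x = proj x + x $ k0 *\<^sub>R axis k0 1"
    proof -
      have "nbasis *v x = (\<Sum>l\<in>UNIV. x $ l *\<^sub>R (if l = k0 then axis k0 1 else proj (axis l 1)))"
        by (simp add: nbasis_def matrix_vector_mult_def vec_eq_iff mult.commute)
      also have "\<dots> = (\<Sum>l\<in>UNIV. x $ l *\<^sub>R proj (axis l 1) + (if l = k0 then x $ l *\<^sub>R axis k0 1 else 0))"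
        by (intro sum.cong) (auto simp: proj_axis)
      finally show ?thesis by (simp add: sum.distrib proj_sum[of x, symmetric])
    qed
    have 0: "(proj x + x $ k0 *\<^sub>R axis k0 1) $ j = 0" for j
      using that unfolding eq by simp
    have x: "x $ j = 0" if "j \<noteq> k0" for j
      using 0[of j] that by (simp add: proj_nth axis_def)
    hence "x = x $ k0 *\<^sub>R axis k0 1" by (auto simp: vec_eq_iff axis_def)
    hence "proj x = 0" using linear_cmul[OF linear_proj] proj_axis by (metis scaleR_zero_right)
    hence "x $ k0 = 0" using 0[of k0] by (simp add: axis_def)
    thus "x = 0" using x by (metis vec_eq_iff zero_index)
  qed
  hence "\<exists>C. C ** nbasis = mat 1" by (simp add: matrix_left_invertible_ker)
  thus ?thesis using invertible_det_nz invertible_left_inverse by blast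
qed

text \<open>The prospective real basis of the tangent space of a fiber: n - 1 directions along the
  torus orbit, and v across it.\<close>

definition lag_basis :: "complex ^ 'a \<Rightarrow> complex ^ 'a \<Rightarrow> complex ^ 'a ^ 'a" where
  "lag_basis v z = (\<chi> r l. if l = k0 then v $ r else fund_vec (proj (axis l 1)) z $ r)"

text \<open>Euler's relation for a monomial: \<open>z $ l\<close> times the l-th partial derivative
  is the exponent times the monomial.\<close>

lemma dw_fund_vec: 
  assumes "z \<in> coord_range"
  shows "dw z (fund_vec \<xi> z) = \<i> * of_real (rvec \<nu> \<bullet> \<xi>) * mon B \<nu> z"
proof -
  have d: "dmon B \<nu> z l * z $ l = of_int (ipair \<nu> (B $ l)) * mon B \<nu> z" for l
  proof -
    have m: "mon B \<nu> z = z $ l powi ipair \<nu> (B $ l) * (\<Prod>j\<in>UNIV - {l}. z $ j powi ipair \<nu> (B $ j))"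
      unfolding mon_def by (rule prod.remove) auto
    have *: "of_int (ipair \<nu> (B $ l)) * (z $ l powi (ipair \<nu> (B $ l) - 1) * z $ l) =
        of_int (ipair \<nu> (B $ l)) * z $ l powi ipair \<nu> (B $ l)"
      by (cases "ipair \<nu> (B $ l) = 0") (simp_all add: power_int_minus_mult)
    have "dmon B \<nu> z l * z $ l = of_int (ipair \<nu> (B $ l)) * (z $ l powi (ipair \<nu> (B $ l) - 1) * z $ l) *
        (\<Prod>j\<in>UNIV - {l}. z $ j powi ipair \<nu> (B $ j))"
      by (simp only: dmon_def mult_ac)
    thus ?thesis unfolding * by (simp only: m mult_ac)
  qed
  have "dw z (fund_vec \<xi> z) = (\<Sum>l\<in>UNIV. \<i> * of_real (rvec (A $ l) \<bullet> \<xi>) * (dmon B \<nu> z l * z $ l))"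
    by (simp add: dw_def fund_vec_def mult_ac)
  also have "\<dots> = \<i> * of_real (\<Sum>l\<in>UNIV. of_int (ipair \<nu> (B $ l)) * (rvec (A $ l) \<bullet> \<xi>)) * mon B \<nu> z"
    unfolding d by (simp add: sum_distrib_left sum_distrib_right mult_ac)
  finally show ?thesis by (simp add: inner_expand[OF dual, of \<nu> \<xi>])
qed

lemma dw_linear: "dw z (u + v) = dw z u + dw z v" "dw z (c *s v) = c * dw z v" "dw z (r *\<^sub>R v) = of_real r * dw z v"
  by (simp_all add: dw_def algebra_simps sum.distrib sum_distrib_left) (simp add: scaleR_conv_of_real mult_ac)

text \<open>Both sides are complex linear in v and vanish on the n - 1 torus directions orthogonal
  to \<nu>, so on the open torus only the coefficient of v along the last basis direction counts.
  The factor \<open>\<i> ^ CARD('a) / \<i>\<close> collects one \<i> from each of the n - 1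
  fundamental vectors.\<close>

lemma vol_det_lag_basis:
  assumes z: "z \<in> coord_range"
  shows "vol A B \<nu> z * det (lag_basis v z) =
    (\<i> ^ CARD('a) / \<i>) * of_real (det nbasis / of_int (\<nu> $ k0)) * dw z v"
proof (rule eq_from_torus[OF open_coord_range z])
  have "continuous_on coord_range (\<lambda>z. if l = k0 then v $ r else fund_vec (proj (axis l 1)) z $ r)" for l r
    by (cases "l = k0") (auto simp: fund_vec_def intro!: continuous_intros)
  thus "continuous_on coord_range (\<lambda>z. vol A B \<nu> z * det (lag_basis v z))"
    unfolding lag_basis_def by (intro continuous_intros vol_cont continuous_on_vec_lambda)
  show "continuous_on coord_range (\<lambda>z. (\<i> ^ CARD('a) / \<i>) * of_real (det nbasis / of_int (\<nu> $ k0)) * dw z v)"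
    unfolding dw_def by (intro continuous_intros continuous_on_dmon regular_\<nu>)
next
  fix z assume z: "z \<in> coord_range" and nz: "\<And>j. z $ j \<noteq> 0"
  define N where "N l = (if l = k0 then axis k0 1 else proj (axis l 1))" for l
  define Q where "Q = (\<chi> r l. fund_vec (N l) z $ r)"
  have Q: "Q = (\<chi> r l. z $ r * (\<chi> r l. complex_of_real ((rmat A ** nbasis) $ r $ l)) $ r $ l * \<i>)"
    by (simp add: Q_def fund_vec_def N_def vec_eq_iff matrix_matrix_mult_def nbasis_def inner_vec_def rmat_def rvec_def)
  have detQ: "det Q = (\<Prod>r\<in>UNIV. z $ r) * of_real (of_int (det A) * det nbasis) * \<i> ^ CARD('a)"
    unfolding Q det_scale_rows_columns det_of_real by (simp add: det_mul det_rmat)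
  have pz: "(\<Prod>r\<in>UNIV. z $ r) \<noteq> 0" using nz by simp
  have A2: "complex_of_int (det A) * of_int (det A) = 1"
    using dual_bases_det(2)[OF dual] by (metis of_int_1 of_int_mult)
  hence "det Q \<noteq> 0" using pz det_nbasis by (auto simp: detQ)
  then obtain x where x: "v = Q *v x"
    by (metis invertible_det_nz invertible_def matrix_vector_mul_assoc matrix_vector_mul_lid)
  \<comment> \<open>Replacing the \<open>k0\<close>-th column of Q by \<open>Q *v x\<close> is the
    situation of Cramer's rule: the determinant picks out the \<open>k0\<close>-th coefficient of
    v.\<close>
  have "lag_basis v z = (\<chi> i j. if j = k0 then (Q *v x) $ i else Q $ i $ j)"
    by (simp add: lag_basis_def x[symmetric] vec_eq_iff) (simp add: Q_def N_def)
  hence "det (lag_basis v z) = x $ k0 * det Q" by (simp add: cramer_lemma)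
  moreover have "dw z v = \<i> * mon B \<nu> z * x $ k0 * of_int (\<nu> $ k0)"
  proof -
    have "v = (\<Sum>l\<in>UNIV. x $ l *s fund_vec (N l) z)"
      by (simp add: x Q_def matrix_vector_mult_def vec_eq_iff mult.commute)
    moreover have "dw z (\<Sum>l\<in>F. x $ l *s fund_vec (N l) z) = (\<Sum>l\<in>F. x $ l * dw z (fund_vec (N l) z))" if "finite F" for F
      using that by (induction F) (simp_all add: dw_linear, simp add: dw_def)
    ultimately have "dw z v = (\<Sum>l\<in>UNIV. x $ l * dw z (fund_vec (N l) z))" by simp
    also have "\<dots> = (\<Sum>l\<in>UNIV. if l = k0 then \<i> * mon B \<nu> z * x $ k0 * of_int (\<nu> $ k0) else 0)"
      by (intro sum.cong) (auto simp: dw_fund_vec[OF z] N_def \<nu>_axis proj_orth)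
    finally show ?thesis by simp
  qed
  ultimately show "vol A B \<nu> z * det (lag_basis v z) =
    (\<i> ^ CARD('a) / \<i>) * of_real (det nbasis / of_int (\<nu> $ k0)) * dw z v"
    using k0 pz A2 by (simp add: vol_nonzero[OF nz] detQ field_simps)
qed

end

section \<open>The differential of the fibration and the tangent spaces of its fibers\<close>

context gross_frame
begin

definition dh :: "real \<Rightarrow> complex ^ 'a \<Rightarrow> complex ^ 'a \<Rightarrow> real" where
  "dh K z v = 2 * ((mon B \<nu> z - of_real K) \<bullet> dw z v)"

lemma gross_height_pt: "z \<in> coord_range \<Longrightarrow> gross_height \<nu> K (pt B z) = (norm (mon B \<nu> z - of_real K))\<^sup>2 - K\<^sup>2"
  by (simp add: gross_height_def character_pt regular_\<nu>)

lemma height_has_derivative: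
  assumes z: "z \<in> coord_range"
  shows "((\<lambda>z. (norm (mon B \<nu> z - of_real K))\<^sup>2 - K\<^sup>2) has_derivative dh K z) (at z)"
    and "((gross_height \<nu> K \<circ> coord_inv chart) has_derivative dh K z) (at z)"
proof -
  have "((\<lambda>z. mon B \<nu> z - of_real K) has_derivative dw z) (at z)"
    using has_derivative_mon[OF regular_\<nu>[OF z]] unfolding dw_def[abs_def]
    by (auto intro!: derivative_eq_intros)
  hence "((\<lambda>z. (mon B \<nu> z - of_real K) \<bullet> (mon B \<nu> z - of_real K) - K\<^sup>2) has_derivative
      (\<lambda>v. ((mon B \<nu> z - of_real K) \<bullet> dw z v + dw z v \<bullet> (mon B \<nu> z - of_real K)) - 0)) (at z)"
    by (intro has_derivative_diff has_derivative_inner has_derivative_const)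
  moreover have "(mon B \<nu> z - of_real K) \<bullet> dw z v + dw z v \<bullet> (mon B \<nu> z - of_real K) - 0 = dh K z v" for v
    unfolding dh_def inner_commute[of "dw z v"] by simp
  ultimately show *: "((\<lambda>z. (norm (mon B \<nu> z - of_real K))\<^sup>2 - K\<^sup>2) has_derivative dh K z) (at z)"
    by (simp only: power2_norm_eq_inner)
  show "((gross_height \<nu> K \<circ> coord_inv chart) has_derivative dh K z) (at z)"
    by (rule has_derivative_transform_within_open[OF * open_coord_range z]) (simp add: gross_height_pt)
qed

text \<open>Surjectivity of the differential of the fibration, tested on directions orthogonal to
  \<nu>, with the derivative of the moment map already expressed through \<omega>.\<close>

definition noncritical :: "real \<Rightarrow> complex ^ 'a \<Rightarrow> bool" where
  "noncritical K z \<longleftrightarrow> (\<forall>m s. \<exists>v. (\<forall>\<xi>. rvec \<nu> \<bullet> \<xi> = 0 \<longrightarrow> \<omega> chart z v (fund_vec \<xi> z) = m \<bullet> \<xi>) \<and> dh K z v = s)"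

lemma noncriticalI:
  assumes z: "z \<in> coord_range" and nc: "pt B z \<notin> gross_critical_points \<Sigma> \<nu> K \<mu>\<^sub>0"
  shows "noncritical K z"
proof -
  have "\<exists>v. quot_class \<nu> (frechet_derivative (\<mu>\<^sub>0 \<circ> coord_inv chart) (at (snd chart (pt B z))) v) = quot_class \<nu> m \<and>
           frechet_derivative (gross_height \<nu> K \<circ> coord_inv chart) (at (snd chart (pt B z))) v = s" for m s
    using nc chart_in_atlas pt_mem[OF z] unfolding gross_critical_points_def by blast
  hence "\<exists>v. quot_class \<nu> (dmu z v) = quot_class \<nu> m \<and> dh K z v = s" for m s
    using frechet_derivative_at[OF height_has_derivative(2)[OF z, of K]] by (simp add: dmu_def)
  thus ?thesis unfolding noncritical_def quot_class_eq_iff mu_has_derivative(2)[OF z] by (intro allI)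
qed

text \<open>If the fundamental vector of \<xi> is zero, the moment component along \<xi> is
  stationary, and the differential cannot reach the class of \<xi>, which pairs with \<xi> to its
  squared norm.\<close>

lemma fund_vec_inj:
  assumes nc: "noncritical K z" and z: "z \<in> coord_range" and \<xi>: "rvec \<nu> \<bullet> \<xi> = 0" "fund_vec \<xi> z = 0"
  shows "\<xi> = 0"
proof -
  obtain v where "\<omega> chart z v (fund_vec \<xi> z) = \<xi> \<bullet> \<xi>" using nc \<xi>(1) unfolding noncritical_def by blast
  thus ?thesis using bilinear_rzero[OF bil[OF z]] \<xi>(2) by simp
qed

definition lag_space :: "real \<Rightarrow> complex ^ 'a \<Rightarrow> (complex ^ 'a) set" where
  "lag_space K z = {v. (\<forall>\<xi>. rvec \<nu> \<bullet> \<xi> = 0 \<longrightarrow> \<omega> chart z v (fund_vec \<xi> z) = 0) \<and> dh K z v = 0}"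

lemma fiber_image:
  "snd chart ` (gross_fiber \<Sigma> \<nu> K \<mu>\<^sub>0 r \<inter> fst chart) = {y\<in>coord_range. gross_fibration \<nu> K \<mu>\<^sub>0 (pt B y) = r}"
proof safe
  fix x assume "x \<in> gross_fiber \<Sigma> \<nu> K \<mu>\<^sub>0 r" "x \<in> fst chart"
  thus "snd chart x \<in> coord_range" "gross_fibration \<nu> K \<mu>\<^sub>0 (pt B (snd chart x)) = r"
    using chart_mem by (auto simp: gross_fiber_def)
next
  fix y assume y: "y \<in> coord_range"
  have "pt B y \<in> fst chart" "pt B y \<in> toric_variety \<Sigma>" using pt_mem[OF y] chart_toric by auto
  thus "y \<in> snd chart ` (gross_fiber \<Sigma> \<nu> K \<mu>\<^sub>0 (gross_fibration \<nu> K \<mu>\<^sub>0 (pt B y)) \<inter> fst chart)"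
    by (intro image_eqI[of _ _ "pt B y"]) (auto simp: gross_fiber_def)
qed

text \<open>The fibration in n real coordinates. The slot \<open>k0\<close> carries no information
  on the quotient, since \<open>proj (axis k0 1)\<close> is 0, and is used for the height.\<close>

definition fib_map :: "real \<Rightarrow> complex ^ 'a \<Rightarrow> real ^ 'a" where
  "fib_map K y = (\<chi> j. if j = k0 then (norm (mon B \<nu> y - of_real K))\<^sup>2 - K\<^sup>2 else mu y \<bullet> proj (axis j 1))"

lemma inner_orth:
  assumes "rvec \<nu> \<bullet> \<xi> = 0" "\<And>j. j \<noteq> k0 \<Longrightarrow> a \<bullet> proj (axis j 1) = b \<bullet> proj (axis j 1)"
  shows "a \<bullet> \<xi> = b \<bullet> \<xi>"
proof -
  have "a \<bullet> proj (axis l 1) = b \<bullet> proj (axis l 1)" for l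
    using assms(2)[of l] by (cases "l = k0") (auto simp: proj_axis)
  hence "a \<bullet> (\<Sum>l\<in>UNIV. \<xi> $ l *\<^sub>R proj (axis l 1)) = b \<bullet> (\<Sum>l\<in>UNIV. \<xi> $ l *\<^sub>R proj (axis l 1))"
    by (simp add: inner_sum_right)
  thus ?thesis using proj_sum[of \<xi>] proj_id[OF assms(1)] by simp
qed

lemma fib_map_eq_iff:
  assumes "y \<in> coord_range" "z \<in> coord_range"
  shows "fib_map K y = fib_map K z \<longleftrightarrow> gross_fibration \<nu> K \<mu>\<^sub>0 (pt B y) = gross_fibration \<nu> K \<mu>\<^sub>0 (pt B z)"
proof -
  have "(\<forall>\<xi>. rvec \<nu> \<bullet> \<xi> = 0 \<longrightarrow> mu y \<bullet> \<xi> = mu z \<bullet> \<xi>) \<longleftrightarrow>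
      (\<forall>j. j \<noteq> k0 \<longrightarrow> mu y \<bullet> proj (axis j 1) = mu z \<bullet> proj (axis j 1))"
    using inner_orth proj_orth by blast
  thus ?thesis using assms
    by (auto simp: fib_map_def vec_eq_iff gross_fibration_def quot_class_eq_iff gross_height_pt mu_def[symmetric])
qed

lemma tangent_fiber:
  assumes z: "z \<in> coord_range" and nc: "noncritical K z" and r: "gross_fibration \<nu> K \<mu>\<^sub>0 (pt B z) = r"
  shows "tangent_set (snd chart ` (gross_fiber \<Sigma> \<nu> K \<mu>\<^sub>0 r \<inter> fst chart)) z = lag_space K z"
proof -
  define D where "D v = (\<chi> j. if j = k0 then dh K z v else \<omega> chart z v (fund_vec (proj (axis j 1)) z))" for v
  have "(fib_map K has_derivative D) (at z)"
  proof (rule has_derivative_vecI)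
    fix i show "((\<lambda>y. fib_map K y $ i) has_derivative (\<lambda>v. D v $ i)) (at z)"
    proof (cases "i = k0")
      case True thus ?thesis using height_has_derivative(1)[OF z] by (simp add: fib_map_def D_def)
    next
      case False
      have "((\<lambda>y. mu y \<bullet> proj (axis i 1)) has_derivative (\<lambda>v. dmu z v \<bullet> proj (axis i 1))) (at z)"
        by (rule has_derivative_inner_left[OF mu_has_derivative(1)[OF z]])
      thus ?thesis using False by (simp add: fib_map_def D_def mu_has_derivative(2)[OF z])
    qed
  qed
  moreover have "surj D"
  proof -
    have "\<exists>v. y = D v" for y
    proof -
      \<comment> \<open>\<open>proj (axis j 1)\<close> differs from \<open>axis j 1\<close> only in
        the \<open>k0\<close>-th entry; with that entry of \<open>?m\<close> equal to 0 the pairing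
        is \<open>y $ j\<close>.\<close>
      let ?m = "\<chi> j. if j = k0 then 0 else y $ j"
      obtain v where v: "\<And>\<xi>. rvec \<nu> \<bullet> \<xi> = 0 \<Longrightarrow> \<omega> chart z v (fund_vec \<xi> z) = ?m \<bullet> \<xi>" "dh K z v = y $ k0"
        using nc unfolding noncritical_def by blast
      have "?m \<bullet> proj (axis j 1) = y $ j" if "j \<noteq> k0" for j
        using that by (simp add: proj_def inner_diff_right inner_axis)
      hence "D v = y" using v by (simp add: D_def vec_eq_iff proj_orth)
      thus ?thesis by blast
    qed
    thus ?thesis by (simp add: surj_def)
  qed
  moreover have "continuous_on coord_range (fib_map K)" unfolding fib_map_def
  proof (rule continuous_on_vec_lambda)
    fix i
    have "continuous_on coord_range mu"
      using mu_has_derivative(1) has_derivative_continuous by (blast intro: continuous_at_imp_continuous_on)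
    thus "continuous_on coord_range (\<lambda>y. if i = k0 then (norm (mon B \<nu> y - of_real K))\<^sup>2 - K\<^sup>2 else mu y \<bullet> proj (axis i 1))"
      using continuous_on_mon[of coord_range B \<nu>] regular_\<nu> by (cases "i = k0") (auto intro!: continuous_intros)
  qed
  ultimately have "tangent_set {y\<in>coord_range. fib_map K y = fib_map K z} z = {v. D v = 0}"
    by (intro tangent_set_level_set open_coord_range z)
  moreover have "{y\<in>coord_range. fib_map K y = fib_map K z} = snd chart ` (gross_fiber \<Sigma> \<nu> K \<mu>\<^sub>0 r \<inter> fst chart)"
    unfolding fiber_image using fib_map_eq_iff[OF _ z] r by auto
  moreover have "D v = 0 \<longleftrightarrow> v \<in> lag_space K z" for v
  proof -
    have *: "\<omega> chart z v (fund_vec \<xi> z) = dmu z v \<bullet> \<xi>" for \<xi> using mu_has_derivative(2)[OF z] by simp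
    have "(\<forall>\<xi>. rvec \<nu> \<bullet> \<xi> = 0 \<longrightarrow> dmu z v \<bullet> \<xi> = 0) \<longleftrightarrow> (\<forall>j. j \<noteq> k0 \<longrightarrow> dmu z v \<bullet> proj (axis j 1) = 0)"
      using inner_orth[of _ "dmu z v" 0] proj_orth by auto
    thus ?thesis by (auto simp: D_def lag_space_def vec_eq_iff *)
  qed
  ultimately show ?thesis by auto
qed

lemma lag_basis_mult: "lag_basis v z *v (\<chi> j. complex_of_real (p $ j)) = fund_vec (proj p) z + p $ k0 *\<^sub>R v"
proof -
  have "lag_basis v z *v (\<chi> j. complex_of_real (p $ j)) =
      (\<Sum>l\<in>UNIV. p $ l *\<^sub>R (if l = k0 then v else fund_vec (proj (axis l 1)) z))"
    unfolding vec_eq_iff matrix_vector_mult_def vec_lambda_beta sum_component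
  proof (intro allI sum.cong refl)
    fix i l
    show "lag_basis v z $ i $ l * complex_of_real (p $ l) =
        (p $ l *\<^sub>R (if l = k0 then v else fund_vec (proj (axis l 1)) z)) $ i"
      unfolding vector_scaleR_component lag_basis_def by (cases "l = k0") (simp_all add: scaleR_conv_of_real mult.commute)
  qed
  also have "\<dots> = (\<Sum>l\<in>UNIV. p $ l *\<^sub>R fund_vec (proj (axis l 1)) z + (if l = k0 then p $ l *\<^sub>R v else 0))"
    by (intro sum.cong) (auto simp: proj_axis)
  also have "\<dots> = fund_vec (proj p) z + p $ k0 *\<^sub>R v"
    by (simp add: sum.distrib proj_sum[of p] fund_vec_sum fund_vec_scaleR)
  finally show ?thesis .
qed

lemma smult_i: "\<i> *s (u + v) = \<i> *s u + \<i> *s (v :: complex ^ 'a)" "\<i> *s (r *\<^sub>R v) = r *\<^sub>R (\<i> *s v)"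
  by (simp_all add: vec_eq_iff algebra_simps scaleR_conv_of_real)

text \<open>The height changes along v1, so dw is nonzero on it. The vector \<i> v1 turns dw by \<i>
  but may change the moment components; adding some \<i> X, with X a torus direction orthogonal to
  \<nu>, repairs this and leaves dw alone. Real combinations of v1 and the repaired vector t then
  realise every complex value of dw.\<close>

lemma lag_space_transversal:
  assumes z: "z \<in> coord_range" and nc: "noncritical K z"
  obtains v where "v \<in> lag_space K z" "dw z v = \<i> * (mon B \<nu> z - of_real K)" "mon B \<nu> z \<noteq> of_real K"
proof -
  note bl = bil[OF z]
  let ?w = "mon B \<nu> z - of_real K"
  obtain v1 where v1: "\<And>\<xi>. rvec \<nu> \<bullet> \<xi> = 0 \<Longrightarrow> \<omega> chart z v1 (fund_vec \<xi> z) = 0" "dh K z v1 = 1"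
    using nc unfolding noncritical_def by (metis inner_zero_left)
  have w: "?w \<noteq> 0" and d1: "dw z v1 \<noteq> 0" using v1(2) by (auto simp: dh_def)
  \<comment> \<open>Finding X is a square linear system. The slot \<open>k0\<close> stores
    \<open>s $ k0\<close>, which \<open>proj\<close> ignores, so \<Lambda> is injective by
    positivity of the form, and hence surjective.\<close>
  define \<Lambda> where "\<Lambda> s = (\<chi> j. if j = k0 then s $ k0 else \<omega> chart z (\<i> *s fund_vec (proj s) z) (fund_vec (proj (axis j 1)) z))" for s
  have lin: "linear \<Lambda>"
  proof -
    have l: "linear (\<lambda>s. \<omega> chart z (\<i> *s fund_vec (proj s) z) u)" for u
      by (auto simp: linear_iff linear_add[OF linear_proj] linear_cmul[OF linear_proj] fund_vec_add fund_vec_scaleR smult_i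
        bilinear_ladd[OF bl] bilinear_lmul[OF bl])
    show ?thesis using l by (auto simp: linear_iff \<Lambda>_def vec_eq_iff)
  qed
  have "inj \<Lambda>" unfolding linear_injective_0[OF lin]
  proof (intro allI impI)
    fix s assume s: "\<Lambda> s = 0"
    have s0: "s $ k0 = 0" and sj: "\<And>j. j \<noteq> k0 \<Longrightarrow> \<omega> chart z (\<i> *s fund_vec (proj s) z) (fund_vec (proj (axis j 1)) z) = 0"
      using s by (auto simp: \<Lambda>_def vec_eq_iff split: if_splits dest: spec[of _ k0])
    have "dmu z (\<i> *s fund_vec (proj s) z) \<bullet> proj s = 0 \<bullet> proj s"
      by (rule inner_orth[OF proj_orth]) (simp add: mu_has_derivative(2)[OF z] sj)
    hence "\<omega> chart z (\<i> *s fund_vec (proj s) z) (fund_vec (proj s) z) = 0" by (simp add: mu_has_derivative(2)[OF z])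
    hence "\<omega> chart z (fund_vec (proj s) z) (\<i> *s fund_vec (proj s) z) = 0"
      using skew[OF z, of "fund_vec (proj s) z" "\<i> *s fund_vec (proj s) z"] by linarith
    hence "fund_vec (proj s) z = 0" using pos[OF z, of "fund_vec (proj s) z"] by fastforce
    hence "proj s = 0" by (rule fund_vec_inj[OF nc z proj_orth])
    thus "s = 0" using proj_eq_0[of s] s0 by (metis vec_eq_iff zero_index)
  qed
  hence "surj \<Lambda>" using linear_injective_imp_surjective[OF lin] by simp
  from surjD[OF this] obtain s
    where s: "(\<chi> j. if j = k0 then 0 else - \<omega> chart z (\<i> *s v1) (fund_vec (proj (axis j 1)) z)) = \<Lambda> s"
    by blast
  define t where "t = \<i> *s v1 + \<i> *s fund_vec (proj s) z"
  have t: "\<omega> chart z t (fund_vec \<xi> z) = 0" if "rvec \<nu> \<bullet> \<xi> = 0" for \<xi>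
  proof -
    have "\<omega> chart z t (fund_vec (proj (axis j 1)) z) = 0" if "j \<noteq> k0" for j
      using arg_cong[OF s, of "\<lambda>u. u $ j"] that by (simp add: \<Lambda>_def t_def bilinear_ladd[OF bl])
    hence "dmu z t \<bullet> \<xi> = 0 \<bullet> \<xi>"
      by (intro inner_orth[OF that]) (simp add: mu_has_derivative(2)[OF z])
    thus ?thesis by (simp add: mu_has_derivative(2)[OF z])
  qed
  have dt: "dw z t = \<i> * dw z v1" by (simp add: t_def dw_linear dw_fund_vec[OF z] proj_orth)
  define q where "q = \<i> * ?w / dw z v1"
  define v where "v = Re q *\<^sub>R v1 + Im q *\<^sub>R t"
  have "dw z v = (of_real (Re q) + \<i> * of_real (Im q)) * dw z v1"
    by (simp add: v_def dw_linear dt algebra_simps)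
  also have "\<dots> = \<i> * ?w" using d1 complex_eq[of q] by (simp add: q_def)
  finally have dv: "dw z v = \<i> * ?w" .
  \<comment> \<open>In the real plane \<i> (w - K) is orthogonal to w - K.\<close>
  have "dh K z v = 0" unfolding dh_def dv by (simp add: inner_complex_def algebra_simps)
  moreover have "\<omega> chart z v (fund_vec \<xi> z) = 0" if "rvec \<nu> \<bullet> \<xi> = 0" for \<xi>
    using t[OF that] v1(1)[OF that] by (simp add: v_def bilinear_ladd[OF bl] bilinear_lmul[OF bl])
  ultimately show ?thesis using that dv w by (auto simp: lag_space_def)
qed

text \<open>Complex independence comes from the volume form. For a tangent vector with complex
  coefficients p + \<i> q, the height forces \<open>q $ k0 = 0\<close>, and positivity of the form
  then kills the fundamental vector of \<open>proj q\<close>.\<close>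

lemma lag_real_basis:
  assumes z: "z \<in> coord_range" and nc: "noncritical K z"
    and v: "v \<in> lag_space K z" "dw z v = \<i> * (mon B \<nu> z - of_real K)" "mon B \<nu> z \<noteq> of_real K"
  shows "real_basis (lag_basis v z) (lag_space K z)"
  unfolding real_basis_def
proof
  note bl = bil[OF z]
  have "vol A B \<nu> z * det (lag_basis v z) \<noteq> 0"
    unfolding vol_det_lag_basis[OF z] using det_nbasis k0 v(2,3) by simp
  thus det: "det (lag_basis v z) \<noteq> 0" by auto
  show "lag_space K z = range (\<lambda>a. lag_basis v z *v (\<chi> j. complex_of_real (a $ j)))"
  proof (intro equalityI subsetI)
    fix t assume "t \<in> range (\<lambda>a. lag_basis v z *v (\<chi> j. complex_of_real (a $ j)))"
    then obtain p :: "real ^ 'a" where t: "t = fund_vec (proj p) z + p $ k0 *\<^sub>R v" using lag_basis_mult by auto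
    have "\<omega> chart z t (fund_vec \<xi> z) = 0" if "rvec \<nu> \<bullet> \<xi> = 0" for \<xi>
      using v(1) that by (simp add: t bilinear_ladd[OF bl] bilinear_lmul[OF bl] isotropic[OF z] lag_space_def)
    moreover have "dh K z t = 0"
      using v(1) by (simp add: t dh_def dw_linear dw_fund_vec[OF z] proj_orth lag_space_def flip: scaleR_conv_of_real)
    ultimately show "t \<in> lag_space K z" by (simp add: lag_space_def)
  next
    fix t assume t: "t \<in> lag_space K z"
    obtain s where s: "t = lag_basis v z *v s"
      using det by (metis invertible_det_nz invertible_def matrix_vector_mul_assoc matrix_vector_mul_lid)
    define p q :: "real ^ 'a" where "p = (\<chi> j. Re (s $ j))" and "q = (\<chi> j. Im (s $ j))"
    let ?c = "\<lambda>a::real ^ 'a. \<chi> j. complex_of_real (a $ j)"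
    have "s = ?c p + \<i> *s ?c q" by (simp add: p_def q_def vec_eq_iff complex_eq)
    hence "t = lag_basis v z *v ?c p + \<i> *s (lag_basis v z *v ?c q)"
      by (simp add: s matrix_vector_right_distrib vector_scalar_commute)
    hence teq: "t = (fund_vec (proj p) z + p $ k0 *\<^sub>R v) + \<i> *s (fund_vec (proj q) z + q $ k0 *\<^sub>R v)"
      unfolding lag_basis_mult .
    have "dw z t = (of_real (p $ k0) + \<i> * of_real (q $ k0)) * (\<i> * (mon B \<nu> z - of_real K))"
      unfolding teq by (simp add: dw_linear dw_fund_vec[OF z] proj_orth v(2) algebra_simps)
    moreover have "W \<bullet> ((of_real a + \<i> * of_real b) * (\<i> * W)) = - b * (norm W)\<^sup>2" for W :: complex and a b
      unfolding cmod_power2 by (simp add: inner_complex_def algebra_simps power2_eq_square)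
    ultimately have "dh K z t = - 2 * q $ k0 * (norm (mon B \<nu> z - of_real K))\<^sup>2"
      unfolding dh_def by simp
    hence q0: "q $ k0 = 0" using t v(3) by (simp add: lag_space_def)
    have "\<omega> chart z t (fund_vec (proj q) z) = 0" using t proj_orth by (simp add: lag_space_def)
    moreover have "\<omega> chart z v (fund_vec (proj q) z) = 0" using v(1) proj_orth by (simp add: lag_space_def)
    ultimately have "\<omega> chart z (\<i> *s fund_vec (proj q) z) (fund_vec (proj q) z) = 0"
      unfolding teq q0 by (simp add: bilinear_ladd[OF bl] bilinear_lmul[OF bl] isotropic[OF z])
    hence "\<omega> chart z (fund_vec (proj q) z) (\<i> *s fund_vec (proj q) z) = 0"
      using skew[OF z, of "fund_vec (proj q) z" "\<i> *s fund_vec (proj q) z"] by linarith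
    hence "fund_vec (proj q) z = 0" using pos[OF z, of "fund_vec (proj q) z"] by fastforce
    hence "t = lag_basis v z *v ?c p" unfolding teq q0 lag_basis_mult by (simp add: vec_eq_iff)
    thus "t \<in> range (\<lambda>a. lag_basis v z *v ?c a)" by blast
  qed
qed

text \<open>On the transversal vector dw equals \<i> (w - K), which cancels the division by \<i> in
  \<open>vol_det_lag_basis\<close>. What remains is a constant phase times a real number times w -
  K.\<close>

theorem special_lagrangian:
  assumes z: "z \<in> coord_range" and nc: "pt B z \<notin> gross_critical_points \<Sigma> \<nu> K \<mu>\<^sub>0"
    and r: "gross_fibration \<nu> K \<mu>\<^sub>0 (pt B z) = r"
  shows "mon B \<nu> z \<noteq> of_real K"
    and "\<exists>G \<rho>. real_basis G (tangent_set (snd chart ` (gross_fiber \<Sigma> \<nu> K \<mu>\<^sub>0 r \<inter> fst chart)) z) \<and> \<rho> \<noteq> 0 \<and>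
          vol A B \<nu> z * det G = \<i> ^ CARD('a) * complex_of_real \<rho> * (mon B \<nu> z - of_real K)"
proof -
  have nc': "noncritical K z" by (rule noncriticalI[OF z nc])
  obtain v where v: "v \<in> lag_space K z" "dw z v = \<i> * (mon B \<nu> z - of_real K)" "mon B \<nu> z \<noteq> of_real K"
    using lag_space_transversal[OF z nc'] .
  show "mon B \<nu> z \<noteq> of_real K" by fact
  have "vol A B \<nu> z * det (lag_basis v z) = \<i> ^ CARD('a) * of_real (det nbasis / of_int (\<nu> $ k0)) * (mon B \<nu> z - of_real K)"
  proof -
    have "(c / \<i>) * d * (\<i> * X) = c * d * X" for c d X :: complex
    proof -
      have "(c / \<i>) * d * (\<i> * X) = (c / \<i> * \<i>) * d * X" by (simp only: mult_ac)
      also have "c / \<i> * \<i> = c" by (rule nonzero_eq_divide_eq[THEN iffD1]) simp_all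
      finally show ?thesis .
    qed
    thus ?thesis unfolding vol_det_lag_basis[OF z] v(2) .
  qed
  moreover have "det nbasis / of_int (\<nu> $ k0) \<noteq> 0" using det_nbasis k0 by simp
  moreover have "real_basis (lag_basis v z) (tangent_set (snd chart ` (gross_fiber \<Sigma> \<nu> K \<mu>\<^sub>0 r \<inter> fst chart)) z)"
    unfolding tangent_fiber[OF z nc' r] by (rule lag_real_basis[OF z nc' v])
  ultimately show "\<exists>G \<rho>. real_basis G (tangent_set (snd chart ` (gross_fiber \<Sigma> \<nu> K \<mu>\<^sub>0 r \<inter> fst chart)) z) \<and> \<rho> \<noteq> 0 \<and>
          vol A B \<nu> z * det G = \<i> ^ CARD('a) * complex_of_real \<rho> * (mon B \<nu> z - of_real K)"
    by blast
qed

end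

section \<open>Rigidity of disks of index zero\<close>

lemma holomorphic_on_powi:
  assumes "f holomorphic_on S" "\<And>z. z \<in> S \<Longrightarrow> f z = 0 \<Longrightarrow> k \<ge> 0"
  shows "(\<lambda>z. f z powi k) holomorphic_on S"
proof (cases "k \<ge> 0")
  case True
  thus ?thesis using assms(1) by (auto simp: power_int_nonneg_exp intro!: holomorphic_intros)
next
  case False
  hence "\<forall>z\<in>S. f z \<noteq> 0" using assms by auto
  thus ?thesis using assms(1) by (auto intro!: holomorphic_intros)
qed

text \<open>The maximum principle for F and for 1/F makes the modulus constant inside, and then F
  attains its maximal modulus in the interior.\<close>

lemma constant_modulus_imp_constant:
  assumes cont: "continuous_on (cball 0 1) F" and hol: "F holomorphic_on ball 0 1"
    and bd: "\<And>p. p \<in> sphere 0 1 \<Longrightarrow> norm (F p) = \<rho>" and nz: "\<And>p. p \<in> cball 0 1 \<Longrightarrow> F p \<noteq> 0"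
  obtains c where "\<And>p. p \<in> cball 0 1 \<Longrightarrow> F p = c"
proof -
  have \<rho>: "\<rho> > 0" using bd[of 1] nz[of 1] by (metis mem_sphere_0 mem_cball_0 norm_one order_refl zero_less_norm_iff)
  have le: "norm (F p) \<le> \<rho>" if "p \<in> cball 0 1" for p
    by (rule maximum_modulus_frontier[of F "cball 0 1"]) (use that cont hol bd in \<open>auto simp: frontier_cball\<close>)
  have "norm (inverse (F p)) \<le> inverse \<rho>" if "p \<in> cball 0 1" for p
  proof (rule maximum_modulus_frontier[of "\<lambda>p. inverse (F p)" "cball 0 1"])
    show "(\<lambda>p. inverse (F p)) holomorphic_on interior (cball 0 1)"
      using hol nz by (auto intro!: holomorphic_on_inverse)
    show "continuous_on (closure (cball 0 1)) (\<lambda>p. inverse (F p))"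
      using cont nz by (auto intro!: continuous_on_inverse)
    show "norm (inverse (F p)) \<le> inverse \<rho>" if "p \<in> frontier (cball 0 1)" for p
      using bd[of p] that by (simp add: frontier_cball norm_inverse)
  qed (use that in auto)
  hence ge: "norm (F p) \<ge> \<rho>" if "p \<in> cball 0 1" for p
    using \<rho> nz[OF that] that by (simp add: norm_inverse) (metis inverse_le_imp_le norm_inverse zero_less_norm_iff that)
  have eq: "norm (F p) = \<rho>" if "p \<in> ball 0 1" for p using le[of p] ge[of p] that by auto
  have "F constant_on ball 0 1"
    by (rule maximum_modulus_principle[OF hol, of "ball 0 1" 0]) (use eq in auto)
  then obtain c where c: "\<And>p. p \<in> ball 0 1 \<Longrightarrow> F p = c" unfolding constant_on_def by blast
  have "F p = c" if "p \<in> cball 0 1" for p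
    using continuous_constant_on_closure[of "ball 0 1" F c] cont c that by (simp add: closure_ball)
  thus ?thesis using that by blast
qed

text \<open>Two compact hemispheres cover the sphere, so each coordinate expression is a bounded
  entire function.\<close>

lemma sphere_function_constant:
  assumes hol: "(\<lambda>z. h (Some z)) holomorphic_on UNIV" "(\<lambda>z. h (at_infinity_coord z)) holomorphic_on UNIV"
  obtains c where "\<And>p. h p = c"
proof -
  let ?F = "\<lambda>z. h (Some z)" and ?G = "\<lambda>z. h (at_infinity_coord z)"
  have FG: "?F z = ?G (inverse z)" if "z \<noteq> 0" for z using that by (simp add: at_infinity_coord_def)
  have const: "f constant_on UNIV" if f: "f holomorphic_on UNIV" and g: "g holomorphic_on UNIV"
    and fg: "\<And>z. z \<noteq> 0 \<Longrightarrow> f z = g (inverse z)" for f g :: "complex \<Rightarrow> complex"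
  proof (rule Liouville_theorem[OF f])
    have "continuous_on (cball 0 1) f" "continuous_on (cball 0 1) g"
      using f g holomorphic_on_imp_continuous_on continuous_on_subset by blast+
    hence "compact (f ` cball 0 1)" "compact (g ` cball 0 1)"
      by (simp_all add: compact_continuous_image)
    hence "bounded (f ` cball 0 1 \<union> g ` cball 0 1)" by (simp add: compact_imp_bounded)
    moreover have "range f \<subseteq> f ` cball 0 1 \<union> g ` cball 0 1"
    proof safe
      fix z assume *: "f z \<notin> g ` cball 0 1"
      show "f z \<in> f ` cball 0 1"
      proof (cases "norm z \<le> 1")
        case False
        hence "z \<noteq> 0" "inverse z \<in> cball 0 1" by (auto simp: norm_inverse inverse_le_1_iff)
        thus ?thesis using * fg by blast
      qed auto
    qed
    ultimately show "bounded (range f)" by (rule bounded_subset)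
  qed
  obtain c where c: "\<And>z. ?F z = c"
    using const[OF hol] FG unfolding constant_on_def by blast
  have "?G z = ?F (inverse z)" if "z \<noteq> 0" for z using that FG[of "inverse z"] by simp
  then obtain c' where c': "\<And>z. ?G z = c'"
    using const[OF hol(2,1)] unfolding constant_on_def by blast
  have "c = c'" using c[of 1] c'[of 1] FG[of 1] by simp
  have "h p = c" for p
  proof (cases p)
    case None thus ?thesis using c'[of 0] \<open>c = c'\<close> by (simp add: at_infinity_coord_def)
  qed (use c in auto)
  thus ?thesis by (rule that)
qed

text \<open>The values agree at the nodes, and the components are connected through these. The map h
  is first the character \<nu> and later the identity.\<close>

lemma semistable_constant:
  assumes S: "semistable_disk S" and nodes: "\<forall>e \<in> nodes S. \<forall>(i, p) \<in> e. \<forall>(j, q) \<in> e. u i p = u j q"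
    and const: "\<And>i. i \<in> comps_of S \<Longrightarrow> \<exists>y. \<forall>p \<in> carrier_of S i. h (u i p) = y"
  obtains y where "\<And>i p. i \<in> comps_of S \<Longrightarrow> p \<in> carrier_of S i \<Longrightarrow> h (u i p) = y"
proof -
  obtain y where y: "\<And>i p. i \<in> comps_of S \<Longrightarrow> p \<in> carrier_of S i \<Longrightarrow> h (u i p) = y i"
    using const by metis
  have pts: "i \<in> comps_of S \<and> p \<in> carrier_of S i" if "e \<in> nodes S" "(i, p) \<in> e" for e i p
  proof -
    have "e \<subseteq> boundary_points S \<or> e \<subseteq> interior_points S" "disks S \<inter> spheres S = {}"
      using S that unfolding semistable_disk_def by blast+
    hence "(i, p) \<in> boundary_points S \<or> (i, p) \<in> interior_points S" "i \<in> spheres S \<Longrightarrow> i \<notin> disks S"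
      using that(2) by blast+
    thus ?thesis
      unfolding boundary_points_def interior_points_def comps_of_def carrier_of_def by auto
  qed
  have step: "y i = y j" if ij: "(i, j) \<in> adjacent (nodes S)" for i j
  proof -
    obtain p q where e: "{(i, p), (j, q)} \<in> nodes S" using ij unfolding adjacent_def by blast
    have "case (i, p) of (i', p') \<Rightarrow> \<forall>(j', q') \<in> {(i, p), (j, q)}. u i' p' = u j' q'"
      by (rule bspec[OF bspec[OF nodes e]]) simp
    hence "\<forall>(j', q') \<in> {(i, p), (j, q)}. u i p = u j' q'" by (simp only: prod.case)
    hence "case (j, q) of (j', q') \<Rightarrow> u i p = u j' q'" by (rule bspec) simp
    hence "u i p = u j q" by (simp only: prod.case)
    thus ?thesis using y pts[OF e, of i p] pts[OF e, of j q] by (metis insertCI)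
  qed
  have "y i = y j" if "(i, j) \<in> (adjacent (nodes S))\<^sup>*" for i j
    using that by (induction rule: rtrancl_induct) (auto simp: step)
  moreover have conn: "\<forall>i \<in> comps_of S. \<forall>j \<in> comps_of S. (i, j) \<in> (adjacent (nodes S))\<^sup>*"
    using S unfolding semistable_disk_def by (elim conjE)
  moreover have ne: "disks S \<noteq> {}"
    using S unfolding semistable_disk_def by (elim conjE)
  moreover obtain i0 where i0: "i0 \<in> comps_of S" using ne unfolding comps_of_def by blast
  ultimately have "y i = y i0" if "i \<in> comps_of S" for i
    using \<open>i \<in> comps_of S\<close> by blast
  thus ?thesis using that y by metis
qed

text \<open>The two points differ by a rotation and a stretching along some \<xi>. Equal moduli of w
  make \<xi> orthogonal to \<nu>, so the moment components along \<xi> agree, which strict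
  monotonicity permits only if \<xi> acts trivially.\<close>

lemma (in gross_chart) same_moduli:
  assumes z: "z \<in> coord_range" "\<And>j. z $ j \<noteq> 0" and z': "\<And>j. z' $ j \<noteq> 0"
    and w: "norm (mon B \<nu> z) = norm (mon B \<nu> z')" and q: "quot_class \<nu> (mu z) = quot_class \<nu> (mu z')"
  shows "norm (z $ j) = norm (z' $ j)"
proof -
  define \<xi> where "\<xi> = (\<Sum>j\<in>UNIV. ln (norm (z' $ j / z $ j)) *\<^sub>R rvec (B $ j))"
  define \<theta> where "\<theta> = (\<Sum>j\<in>UNIV. Arg (z' $ j / z $ j) *\<^sub>R rvec (B $ j))"
  have A\<xi>: "rvec (A $ j) \<bullet> \<xi> = ln (norm (z' $ j / z $ j))" and A\<theta>: "rvec (A $ j) \<bullet> \<theta> = Arg (z' $ j / z $ j)" for j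
    by (simp_all add: \<xi>_def \<theta>_def inner_sum_right dual_bases_inner[OF dual] if_distrib cong: if_cong)
  have eq: "z' = rot \<theta> (stretch \<xi> z)"
  proof (subst vec_eq_iff, intro allI)
    fix j
    have "z' $ j / z $ j = of_real (norm (z' $ j / z $ j)) * cis (Arg (z' $ j / z $ j))"
      using rcis_cmod_Arg[of "z' $ j / z $ j"] by (simp add: rcis_def)
    moreover have "norm (z' $ j / z $ j) > 0" using z(2) z' by simp
    ultimately have "z' $ j / z $ j = of_real (exp (rvec (A $ j) \<bullet> \<xi>)) * cis (rvec (A $ j) \<bullet> \<theta>)"
      unfolding A\<xi> A\<theta> by (simp only: exp_ln)
    hence "z' $ j = of_real (exp (rvec (A $ j) \<bullet> \<xi>)) * cis (rvec (A $ j) \<bullet> \<theta>) * z $ j"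
      using z(2)[of j] by (simp add: divide_eq_eq)
    thus "z' $ j = rot \<theta> (stretch \<xi> z) $ j" by (simp add: rot_def stretch_def mult_ac)
  qed
  have sr: "stretch \<xi> z \<in> coord_range" using z(1) stretch_range by simp
  have "norm (mon B \<nu> z') = (\<Prod>j\<in>UNIV. exp (of_int (ipair \<nu> (B $ j)) * (rvec (A $ j) \<bullet> \<xi>))) * norm (mon B \<nu> z)"
  proof -
    have "norm (mon B \<nu> z') = norm (mon B \<nu> (stretch \<xi> z))" unfolding eq mon_rot by (simp add: norm_mult)
    also have "\<dots> = (\<Prod>j\<in>UNIV. exp (rvec (A $ j) \<bullet> \<xi>) powi ipair \<nu> (B $ j)) * norm (mon B \<nu> z)"
      by (simp add: mon_def stretch_def prod_norm[symmetric] norm_power_int norm_mult power_int_mult_distrib prod.distrib)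
    finally show ?thesis by (simp add: exp_power_int mult.commute)
  qed
  also have "(\<Prod>j\<in>UNIV. exp (of_int (ipair \<nu> (B $ j)) * (rvec (A $ j) \<bullet> \<xi>))) = exp (rvec \<nu> \<bullet> \<xi>)"
    by (simp add: exp_sum inner_expand[OF dual, of \<nu> \<xi>])
  finally have "exp (rvec \<nu> \<bullet> \<xi>) = 1" using w z(2) z' by (simp add: mon_eq_0)
  hence "rvec \<nu> \<bullet> \<xi> = 0" by simp
  hence "mu z \<bullet> \<xi> = mu (stretch \<xi> z) \<bullet> \<xi>"
    using q unfolding quot_class_eq_iff eq mu_rot[OF sr] by blast
  hence "fund_vec \<xi> z = 0" using mu_stretch[OF z(1), of \<xi> 0 1] by (auto simp: stretch_def)
  hence "rvec (A $ j) \<bullet> \<xi> = 0" using z(2)[of j] by (auto simp: fund_vec_def vec_eq_iff)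
  hence "norm (z' $ j / z $ j) = 1" using A\<xi>[of j] z(2)[of j] z'[of j] by simp
  thus ?thesis using z(2)[of j] by (simp add: norm_divide)
qed

section \<open>Indices of disks and spheres bounded by a Gross fiber\<close>

locale gross_fan = cy_fan \<Sigma> \<nu> for \<Sigma> :: "(real ^ 'n::finite) set set" and \<nu> +
  fixes \<omega> \<mu>\<^sub>0 and K :: real
  assumes kaehler: "toric_kaehler_form \<Sigma> \<omega>" and moment: "moment_map \<Sigma> \<omega> \<mu>\<^sub>0"
    and two_rays: "card (ray_generators \<Sigma>) \<ge> 2" and K_pos: "K > 0"
begin

abbreviation "fiber r \<equiv> gross_fiber \<Sigma> \<nu> K \<mu>\<^sub>0 r"
abbreviation "disc \<equiv> discriminant \<Sigma> \<nu> K \<mu>\<^sub>0"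

lemma ex_ray: "\<exists>v. v \<in> ray_generators \<Sigma>"
  using two_rays by (metis card.empty ex_in_conv not_numeral_le_zero)

definition "k0 = (SOME k. \<nu> $ k \<noteq> 0)"

lemma k0: "\<nu> $ k0 \<noteq> 0"
proof -
  obtain v where "v \<in> ray_generators \<Sigma>" using ex_ray by blast
  hence "\<nu> \<noteq> 0" using cy[of v] by auto
  hence "\<exists>k. \<nu> $ k \<noteq> 0" by (simp add: vec_eq_iff)
  thus ?thesis unfolding k0_def by (rule someI_ex)
qed

lemma gross_frameI:
  assumes "toric_chart \<Sigma> \<sigma> A B J" shows "gross_frame \<Sigma> \<sigma> A B J \<nu> \<omega> \<mu>\<^sub>0 k0"
  using cy_chartI[OF assms] kaehler moment k0
  by (simp add: gross_frame_def gross_chart_def gross_chart_axioms_def gross_frame_axioms_def)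

lemma gross_frameE:
  assumes "c \<in> toric_atlas \<Sigma>"
  obtains \<sigma> A B J where "gross_frame \<Sigma> \<sigma> A B J \<nu> \<omega> \<mu>\<^sub>0 k0" "c = toric_chart.chart \<Sigma> \<sigma> A"
    "atlas_vol \<Sigma> \<nu> c = vol A B \<nu>"
  using atlas_chartE[OF assms] gross_frameI cy_chart.axioms(1) by metis

lemma character_chart:
  assumes "toric_chart \<Sigma> \<sigma> A B J" "x \<in> fst (toric_chart.chart \<Sigma> \<sigma> A)" "m \<in> dom x"
  shows "regular_at B m (snd (toric_chart.chart \<Sigma> \<sigma> A) x)"
    and "character m x = mon B m (snd (toric_chart.chart \<Sigma> \<sigma> A) x)"
proof -
  interpret toric_chart \<Sigma> \<sigma> A B J by fact
  have x: "x = pt B (snd chart x)" using assms(2) by simp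
  thus r: "regular_at B m (snd chart x)" using assms(3) dom_pt[of B "snd chart x"] by auto
  show "character m x = mon B m (snd chart x)" using character_pt[OF r] x by simp
qed

lemma \<nu>_dom: "c \<in> toric_atlas \<Sigma> \<Longrightarrow> x \<in> fst c \<Longrightarrow> \<nu> \<in> dom x"
proof -
  assume c: "c \<in> toric_atlas \<Sigma>" "x \<in> fst c"
  obtain \<sigma> A B J where g: "gross_frame \<Sigma> \<sigma> A B J \<nu> \<omega> \<mu>\<^sub>0 k0" "c = toric_chart.chart \<Sigma> \<sigma> A"
    using gross_frameE[OF c(1)] by metis
  interpret C: gross_frame \<Sigma> \<sigma> A B J \<nu> \<omega> \<mu>\<^sub>0 k0 by fact
  have "x = pt B (snd C.chart x)" using c g by simp
  moreover have "regular_at B \<nu> (snd C.chart x)" using C.regular_\<nu>[OF C.chart_mem] c g by simp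
  ultimately show "\<nu> \<in> dom x" using dom_pt[of B "snd C.chart x"] by auto
qed

lemma open_orbit:
  assumes "x \<in> toric_variety \<Sigma>" "character \<nu> x \<noteq> 0"
  shows "dom x = UNIV"
proof -
  obtain \<sigma> A B J where g: "toric_chart \<Sigma> \<sigma> A B J" "x \<in> fst (toric_chart.chart \<Sigma> \<sigma> A)"
    using toric_variety_chart[OF smooth assms(1)] by metis
  interpret C: gross_frame \<Sigma> \<sigma> A B J \<nu> \<omega> \<mu>\<^sub>0 k0 using gross_frameI g by blast
  have x: "x = pt B (snd C.chart x)" using g by simp
  have "snd C.chart x $ j \<noteq> 0" for j
    using assms(2) C.regular_\<nu>_pt[OF g(2)] C.mon_\<nu>_zero[OF C.chart_mem[OF g(2)]] by auto
  thus ?thesis using dom_pt[of B "snd C.chart x"] x by (auto simp: regular_at_def)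
qed

lemma cont_into_toric: "cont_into (toric_atlas \<Sigma>) D f \<Longrightarrow> p \<in> D \<Longrightarrow> f p \<in> toric_variety \<Sigma>"
  by (metis gross_frameE cont_intoE cy_chart.axioms(1) gross_chart.axioms(1) gross_frame.axioms(1) toric_chart.chart_toric)

lemma cont_into_\<nu>_dom: "cont_into (toric_atlas \<Sigma>) D f \<Longrightarrow> p \<in> D \<Longrightarrow> \<nu> \<in> dom (f p)"
  using cont_intoE \<nu>_dom by metis

lemma character_cont:
  assumes f: "cont_into (toric_atlas \<Sigma>) D f" and m: "\<And>p. p \<in> D \<Longrightarrow> m \<in> dom (f p)"
  shows "continuous_on D (\<lambda>p. character m (f p))"
proof (rule continuous_on_locallyI)
  fix p assume p: "p \<in> D"
  obtain c e where c: "c \<in> toric_atlas \<Sigma>" "e > 0" "f ` (D \<inter> ball p e) \<subseteq> fst c"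
    "continuous_on (D \<inter> ball p e) (snd c \<circ> f)" using cont_intoE[OF f p] by metis
  obtain \<sigma> A B J where g: "gross_frame \<Sigma> \<sigma> A B J \<nu> \<omega> \<mu>\<^sub>0 k0" "c = toric_chart.chart \<Sigma> \<sigma> A"
    using gross_frameE[OF c(1)] by metis
  interpret C: gross_frame \<Sigma> \<sigma> A B J \<nu> \<omega> \<mu>\<^sub>0 k0 by fact
  have ch: "regular_at B m ((snd c \<circ> f) q)" "mon B m ((snd c \<circ> f) q) = character m (f q)" if q: "q \<in> D \<inter> ball p e" for q
  proof -
    have "f q \<in> fst C.chart" "m \<in> dom (f q)" using c(3) g(2) m q by blast+
    from character_chart[OF C.toric_chart_axioms this]
    show "regular_at B m ((snd c \<circ> f) q)" "mon B m ((snd c \<circ> f) q) = character m (f q)"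
      by (simp_all add: g(2))
  qed
  have "continuous_on (D \<inter> ball p e) (\<lambda>q. mon B m ((snd c \<circ> f) q))"
    by (rule continuous_on_compose2[OF continuous_on_mon[of "(snd c \<circ> f) ` (D \<inter> ball p e)"] c(4)])
      (use ch(1) in auto)
  hence "continuous_on (D \<inter> ball p e) (\<lambda>q. character m (f q))"
    by (rule continuous_on_eq) (rule ch(2))
  thus "\<exists>e>0. continuous_on (D \<inter> ball p e) (\<lambda>q. character m (f q))" using c(2) by blast
qed

lemma character_holo:
  assumes f: "holo_into (toric_atlas \<Sigma>) D f" and m: "\<And>p. p \<in> D \<Longrightarrow> m \<in> dom (f p)"
  shows "(\<lambda>p. character m (f p)) holomorphic_on D"
proof (rule analytic_imp_holomorphic, unfold analytic_on_def, intro ballI)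
  fix p assume p: "p \<in> D"
  obtain c e where c: "c \<in> toric_atlas \<Sigma>" "e > 0" "ball p e \<subseteq> D" "f ` ball p e \<subseteq> fst c"
    "\<And>j. (\<lambda>z. snd c (f z) $ j) holomorphic_on ball p e"
    using f p unfolding holo_into_def by metis
  obtain \<sigma> A B J where g: "gross_frame \<Sigma> \<sigma> A B J \<nu> \<omega> \<mu>\<^sub>0 k0" "c = toric_chart.chart \<Sigma> \<sigma> A"
    using gross_frameE[OF c(1)] by metis
  interpret C: gross_frame \<Sigma> \<sigma> A B J \<nu> \<omega> \<mu>\<^sub>0 k0 by fact
  have ch: "regular_at B m (snd c (f q))" "mon B m (snd c (f q)) = character m (f q)" if q: "q \<in> ball p e" for q
  proof -
    have "f q \<in> fst C.chart" "m \<in> dom (f q)" using c(3,4) g(2) m q by blast+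
    from character_chart[OF C.toric_chart_axioms this]
    show "regular_at B m (snd c (f q))" "mon B m (snd c (f q)) = character m (f q)"
      by (simp_all add: g(2))
  qed
  have "(\<lambda>q. mon B m (snd c (f q))) holomorphic_on ball p e"
    unfolding mon_def
    by (intro holomorphic_on_prod holomorphic_on_powi c(5)) (use ch(1) in \<open>auto simp: regular_at_def\<close>)
  hence "(\<lambda>q. character m (f q)) holomorphic_on ball p e"
    by (rule holomorphic_transform) (rule ch(2))
  thus "\<exists>e>0. (\<lambda>q. character m (f q)) holomorphic_on ball p e" using c(2) by blast
qed

lemma holo_into_cont:
  assumes f: "holo_into At' D f" and "D' \<subseteq> D"
  shows "cont_into At' D' f"
  unfolding cont_into_def
proof
  fix p assume "p \<in> D'"
  then obtain c e where c: "c \<in> At'" "e > 0" "ball p e \<subseteq> D" "f ` ball p e \<subseteq> fst c"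
    "\<And>j. (\<lambda>z. snd c (f z) $ j) holomorphic_on ball p e"
    using assms unfolding holo_into_def by (metis subsetD)
  have "continuous_on (D' \<inter> ball p e) (\<lambda>z. snd c (f z) $ j)" for j
    using holomorphic_on_imp_continuous_on[OF c(5)] by (rule continuous_on_subset) auto
  hence "continuous_on (D' \<inter> ball p e) (\<lambda>z. \<chi> j. snd c (f z) $ j)" by (rule continuous_on_vec_lambda)
  hence "continuous_on (D' \<inter> ball p e) (snd c \<circ> f)" by (simp add: o_def)
  thus "\<exists>c\<in>At'. \<exists>e>0. f ` (D' \<inter> ball p e) \<subseteq> fst c \<and> continuous_on (D' \<inter> ball p e) (snd c \<circ> f)"
    using c by (intro bexI[of _ c] exI[of _ e]) auto
qed

lemma fiber_point:
  assumes x: "x \<in> fiber r" "r \<notin> disc" and c: "c \<in> toric_atlas \<Sigma>" "x \<in> fst c"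
  shows "character \<nu> x \<noteq> of_real K"
    and "\<exists>G \<rho>. real_basis G (tangent_at (fiber r) c x) \<and> \<rho> \<noteq> 0 \<and>
      atlas_vol \<Sigma> \<nu> c (snd c x) * det G = \<i> ^ CARD('n) * complex_of_real \<rho> * (character \<nu> x - of_real K)"
proof -
  obtain \<sigma> A B J where g: "gross_frame \<Sigma> \<sigma> A B J \<nu> \<omega> \<mu>\<^sub>0 k0" "c = toric_chart.chart \<Sigma> \<sigma> A"
    and vol: "atlas_vol \<Sigma> \<nu> c = vol A B \<nu>"
    using gross_frameE[OF c(1)] by metis
  interpret C: gross_frame \<Sigma> \<sigma> A B J \<nu> \<omega> \<mu>\<^sub>0 k0 by fact
  let ?z = "snd C.chart x"
  have xz: "pt B ?z = x" and z: "?z \<in> C.coord_range" using c g C.chart_mem by auto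
  have r: "gross_fibration \<nu> K \<mu>\<^sub>0 x = r" using x(1) by (simp add: gross_fiber_def)
  hence nc: "x \<notin> gross_critical_points \<Sigma> \<nu> K \<mu>\<^sub>0" using x(2) by (auto simp: discriminant_def)
  have w: "mon B \<nu> ?z = character \<nu> x" using C.regular_\<nu>_pt c g by simp
  show "character \<nu> x \<noteq> of_real K"
    using C.special_lagrangian(1)[of ?z K r] z nc r xz w by simp
  show "\<exists>G \<rho>. real_basis G (tangent_at (fiber r) c x) \<and> \<rho> \<noteq> 0 \<and>
      atlas_vol \<Sigma> \<nu> c (snd c x) * det G = \<i> ^ CARD('n) * complex_of_real \<rho> * (character \<nu> x - of_real K)"
    using C.special_lagrangian(2)[of ?z K r] z nc r xz w unfolding vol unfolding g(2) by simp
qed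

lemma disk_index:
  assumes f: "cont_into (toric_atlas \<Sigma>) (cball 0 1) f" and bd: "f ` sphere 0 1 \<subseteq> fiber r" and r: "r \<notin> disc"
    and k: "winding_number (\<lambda>t. character \<nu> (f (unit_circle t)) - of_real K) 0 = of_int k"
  shows "disk_maslov (toric_atlas \<Sigma>) (fiber r) f = 2 * k"
proof (rule disk_maslov_eq[OF f, of "\<i> ^ CARD('n)" "\<lambda>p. character \<nu> (f p) - of_real K"])
  show "continuous_on (sphere 0 1) (\<lambda>p. character \<nu> (f p) - of_real K)"
    by (intro continuous_intros continuous_on_subset[OF character_cont[OF f cont_into_\<nu>_dom[OF f]]]) auto
  fix p :: complex assume p: "p \<in> sphere 0 1"
  hence fp: "f p \<in> fiber r" using bd by blast
  have "p \<in> cball 0 1" using p by auto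
  then obtain c where c: "c \<in> toric_atlas \<Sigma>" "f p \<in> fst c" using cont_intoE[OF f] by metis
  from fiber_point(1)[OF fp r c] show "character \<nu> (f p) - of_real K \<noteq> 0" by simp
  show "\<exists>G \<rho>. real_basis G (tangent_at (fiber r) c (f p)) \<and> \<rho> \<noteq> 0 \<and>
      atlas_vol \<Sigma> \<nu> c (snd c (f p)) * det G = \<i> ^ CARD('n) * complex_of_real \<rho> * (character \<nu> (f p) - of_real K)"
    if "c \<in> toric_atlas \<Sigma>" "f p \<in> fst c" for c by (rule fiber_point(2)[OF fp r that])
qed (use k in auto)

text \<open>Nonnegativity of each single index prevents cancellation between the components in
  \<open>index_zero_constant\<close>, where only the total is known to vanish.\<close>

lemma disk_nonneg:
  assumes f: "cont_into (toric_atlas \<Sigma>) (cball 0 1) f" "holo_into (toric_atlas \<Sigma>) (ball 0 1) f"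
    and bd: "f ` sphere 0 1 \<subseteq> fiber (q1, q2)" and r: "(q1, q2) \<notin> disc"
  obtains k :: nat where "disk_maslov (toric_atlas \<Sigma>) (fiber (q1, q2)) f = 2 * int k"
    "k = 0 \<Longrightarrow> \<exists>y. \<forall>p\<in>cball 0 1. character \<nu> (f p) = y"
proof -
  define F where "F p = character \<nu> (f p) - of_real K" for p
  have cont: "continuous_on (cball 0 1) F"
    unfolding F_def by (intro continuous_intros character_cont[OF f(1)] cont_into_\<nu>_dom[OF f(1)])
  have hol: "F holomorphic_on ball 0 1"
    unfolding F_def using cont_into_\<nu>_dom[OF f(1)] by (intro holomorphic_intros character_holo[OF f(2)]) auto
  have nz: "F p \<noteq> 0" and md: "norm (F p) = sqrt (q2 + K\<^sup>2)" if p: "p \<in> sphere 0 1" for p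
  proof -
    have fp: "f p \<in> fiber (q1, q2)" using bd p by blast
    have "p \<in> cball 0 1" using p by auto
    then obtain c where c: "c \<in> toric_atlas \<Sigma>" "f p \<in> fst c" using cont_intoE[OF f(1)] by metis
    from fiber_point(1)[OF fp r c] show "F p \<noteq> 0" by (simp add: F_def)
    have "(norm (F p))\<^sup>2 - K\<^sup>2 = q2" using fp by (simp add: gross_fiber_def gross_fibration_def gross_height_def F_def)
    hence "(norm (F p))\<^sup>2 = q2 + K\<^sup>2" by simp
    thus "norm (F p) = sqrt (q2 + K\<^sup>2)" by (metis norm_ge_zero real_sqrt_unique)
  qed
  obtain k :: nat where k: "winding_number (\<lambda>t. F (unit_circle t)) 0 = of_nat k"
    "\<And>p. k = 0 \<Longrightarrow> p \<in> ball 0 1 \<Longrightarrow> F p \<noteq> 0"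
    using winding_number_counts_zeros[OF cont hol nz] by metis
  show ?thesis
  proof (rule that[of k])
    show "disk_maslov (toric_atlas \<Sigma>) (fiber (q1, q2)) f = 2 * int k"
      by (rule disk_index[OF f(1) bd r]) (use k(1) in \<open>simp add: F_def\<close>)
    assume "k = 0"
    hence "F p \<noteq> 0" if "p \<in> cball 0 1" for p
      using k(2)[of p] nz[of p] that by (cases "norm p = 1") auto
    then obtain y where y: "\<And>p. p \<in> cball 0 1 \<Longrightarrow> F p = y"
      using constant_modulus_imp_constant[OF cont hol md] by metis
    have "character \<nu> (f p) = y + of_real K" if "p \<in> cball 0 1" for p
      using y[OF that] by (simp add: F_def algebra_simps)
    thus "\<exists>y. \<forall>p\<in>cball 0 1. character \<nu> (f p) = y" by blast
  qed
qed

lemma ex_chart: obtains \<sigma> A B J where "gross_frame \<Sigma> \<sigma> A B J \<nu> \<omega> \<mu>\<^sub>0 k0"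
proof -
  obtain \<sigma> where "\<sigma> \<in> \<Sigma>" using smooth by (auto simp: smooth_fan_def fan_def)
  thus ?thesis using chart_of_cone[OF smooth] gross_frameI that by metis
qed

lemma sphere_into:
  assumes "holo_into (toric_atlas \<Sigma>) UNIV (g \<circ> Some)" "holo_into (toric_atlas \<Sigma>) UNIV (g \<circ> at_infinity_coord)"
  shows "g p \<in> toric_variety \<Sigma>" "\<nu> \<in> dom (g p)"
proof -
  have c: "cont_into (toric_atlas \<Sigma>) UNIV (g \<circ> Some)" "cont_into (toric_atlas \<Sigma>) UNIV (g \<circ> at_infinity_coord)"
    using holo_into_cont[OF assms(1)] holo_into_cont[OF assms(2)] by auto
  have "g p = (g \<circ> at_infinity_coord) 0 \<or> (\<exists>z. g p = (g \<circ> Some) z)"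
    by (cases p) (auto simp: at_infinity_coord_def)
  thus "g p \<in> toric_variety \<Sigma>" "\<nu> \<in> dom (g p)"
    using cont_into_toric[OF c(1)] cont_into_toric[OF c(2)] cont_into_\<nu>_dom[OF c(1)] cont_into_\<nu>_dom[OF c(2)]
    by (metis UNIV_I)+
qed

lemma sphere_character_constant:
  assumes "holo_into (toric_atlas \<Sigma>) UNIV (g \<circ> Some)" "holo_into (toric_atlas \<Sigma>) UNIV (g \<circ> at_infinity_coord)"
    and "\<And>p. m \<in> dom (g p)"
  obtains y where "\<And>p. character m (g p) = y"
  using sphere_function_constant[of "\<lambda>p. character m (g p)"]
    character_holo[OF assms(1), of m] character_holo[OF assms(2), of m] assms(3) by (simp add: o_def) metis

theorem index_zero_constant:
  assumes r: "(q1, q2) \<notin> disc" and q2: "q2 \<noteq> 0"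
    and st: "stable_disk (toric_atlas \<Sigma>) (fiber (q1, q2)) S u"
    and ind: "maslov_index (toric_atlas \<Sigma>) (fiber (q1, q2)) S u = 0"
  shows "\<not> nonconstant S u"
proof -
  have S: "semistable_disk S"
    using st unfolding stable_disk_def by (elim conjE)
  have disk: "\<forall>i \<in> disks S. cont_into (toric_atlas \<Sigma>) (cball 0 1) (u i \<circ> Some) \<and>
        holo_into (toric_atlas \<Sigma>) (ball 0 1) (u i \<circ> Some) \<and> u i ` Some ` sphere 0 1 \<subseteq> fiber (q1, q2)"
    using st unfolding stable_disk_def by (elim conjE)
  have sph: "\<forall>i \<in> spheres S. holo_into (toric_atlas \<Sigma>) UNIV (u i \<circ> Some) \<and>
        holo_into (toric_atlas \<Sigma>) UNIV (u i \<circ> at_infinity_coord)"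
    using st unfolding stable_disk_def by (elim conjE)
  have nodes: "\<forall>e \<in> nodes S. \<forall>(i, p) \<in> e. \<forall>(j, q) \<in> e. u i p = u j q"
    using st unfolding stable_disk_def by (elim conjE)
  have ne: "disks S \<noteq> {}"
    using S unfolding semistable_disk_def by (elim conjE)
  have "finite (comps_of S)"
    using S unfolding semistable_disk_def by (elim conjE)
  hence fin: "finite (disks S)" "finite (spheres S)" by (auto simp: comps_of_def)
  have dD: "cont_into (toric_atlas \<Sigma>) (cball 0 1) (u i \<circ> Some)" "holo_into (toric_atlas \<Sigma>) (ball 0 1) (u i \<circ> Some)"
    "(u i \<circ> Some) ` sphere 0 1 \<subseteq> fiber (q1, q2)" if "i \<in> disks S" for i
    using disk that by (auto simp: image_comp)
  have sD: "holo_into (toric_atlas \<Sigma>) UNIV (u i \<circ> Some)" "holo_into (toric_atlas \<Sigma>) UNIV (u i \<circ> at_infinity_coord)"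
    if "i \<in> spheres S" for i using sph that by auto
  have car: "carrier_of S i = Some ` cball 0 1" if "i \<in> disks S" for i using that by (simp add: carrier_of_def)
  have "\<exists>k::nat. disk_maslov (toric_atlas \<Sigma>) (fiber (q1, q2)) (u i \<circ> Some) = 2 * int k \<and>
      (k = 0 \<longrightarrow> (\<exists>y. \<forall>p\<in>cball 0 1. character \<nu> ((u i \<circ> Some) p) = y))" if "i \<in> disks S" for i
    using disk_nonneg[OF dD[OF that] r] by metis
  then obtain k :: "nat \<Rightarrow> nat" where
    k: "\<And>i. i \<in> disks S \<Longrightarrow> disk_maslov (toric_atlas \<Sigma>) (fiber (q1, q2)) (u i \<circ> Some) = 2 * int (k i)"
    and k0: "\<And>i. i \<in> disks S \<Longrightarrow> k i = 0 \<Longrightarrow> \<exists>y. \<forall>p\<in>cball 0 1. character \<nu> ((u i \<circ> Some) p) = y"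
    by metis
  have "sphere_chern (toric_atlas \<Sigma>) (u i) = 0" if "i \<in> spheres S" for i
    by (rule sphere_chern_eq_0; rule holo_into_cont) (use sD[OF that] in auto)
  hence "(\<Sum>i\<in>disks S. 2 * int (k i)) = 0"
    using ind k by (simp add: maslov_index_def)
  hence "\<forall>i\<in>disks S. 2 * int (k i) = 0" using fin by (subst (asm) sum_nonneg_eq_0_iff) auto
  hence const_d: "\<exists>y. \<forall>p \<in> carrier_of S i. character \<nu> (u i p) = y" if "i \<in> disks S" for i
    using k0[OF that] that by (auto simp: car)
  have "\<exists>y. \<forall>p \<in> carrier_of S i. character \<nu> (u i p) = y" if "i \<in> comps_of S" for i
  proof (cases "i \<in> disks S")
    case False
    hence "i \<in> spheres S" using that by (auto simp: comps_of_def)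
    from sphere_character_constant[OF sD[OF this] sphere_into(2)[OF sD[OF this]]]
    show ?thesis by metis
  qed (rule const_d)
  then obtain y where y: "\<And>i p. i \<in> comps_of S \<Longrightarrow> p \<in> carrier_of S i \<Longrightarrow> character \<nu> (u i p) = y"
    using semistable_constant[OF S nodes, of "character \<nu>"] by metis
  \<comment> \<open>At w = 0 the height is \<open>K\<^sup>2 - K\<^sup>2 = 0\<close>, which is
    excluded at a boundary point since \<open>q2 \<noteq> 0\<close>.\<close>
  have y0: "y \<noteq> 0"
  proof
    assume "y = 0"
    obtain i where i: "i \<in> disks S" using ne by blast
    have "u i (Some 1) \<in> fiber (q1, q2)" using dD(3)[OF i] by auto
    moreover have "character \<nu> (u i (Some 1)) = 0"
      using y[of i "Some 1"] i \<open>y = 0\<close> by (simp add: comps_of_def car)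
    ultimately show False using q2 by (simp add: gross_fiber_def gross_fibration_def gross_height_def)
  qed
  obtain \<sigma> A B J where "gross_frame \<Sigma> \<sigma> A B J \<nu> \<omega> \<mu>\<^sub>0 k0" using ex_chart .
  then interpret C: gross_frame \<Sigma> \<sigma> A B J \<nu> \<omega> \<mu>\<^sub>0 k0 .
  \<comment> \<open>The open orbit lies in every chart, so a single chart sees the whole stable
    disk.\<close>
  have torus: "dom x = UNIV \<and> x \<in> fst C.chart \<and> (\<forall>j. coords A x $ j \<noteq> 0)" if x: "x \<in> toric_variety \<Sigma>" "character \<nu> x = y" for x
  proof -
    have d: "dom x = UNIV" using open_orbit x y0 by simp
    hence c: "x \<in> fst C.chart" using x by (simp add: C.chart_def affine_piece_def)
    have "mon B \<nu> (snd C.chart x) \<noteq> 0" using C.regular_\<nu>_pt[OF c] x y0 by simp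
    hence "\<forall>j. snd C.chart x $ j \<noteq> 0" using C.mon_\<nu>_zero[OF C.chart_mem[OF c]] by blast
    thus ?thesis using c d by (simp add: C.chart_def)
  qed
  have eqI: "x = x'" if "x \<in> fst C.chart" "x' \<in> fst C.chart" "\<And>j. character (A $ j) x = character (A $ j) x'" for x x'
  proof -
    have "snd C.chart x = snd C.chart x'" using that(3) by (simp add: C.chart_def coords_def)
    thus ?thesis using C.inj_chart that by (auto dest: inj_onD)
  qed
  have "\<exists>x. \<forall>p \<in> carrier_of S i. u i p = x" if i: "i \<in> comps_of S" for i
  proof (cases "i \<in> disks S")
    case True
    let ?f = "u i \<circ> Some"
    note f = dD[OF True]
    have fy: "?f p \<in> toric_variety \<Sigma>" "character \<nu> (?f p) = y" if "p \<in> cball 0 1" for p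
      using cont_into_toric[OF f(1) that] y[OF i, of "Some p"] that by (auto simp: car[OF True])
    have ft: "dom (?f p) = UNIV" "?f p \<in> fst C.chart" "character (A $ j) (?f p) \<noteq> 0" if "p \<in> cball 0 1" for p j
      using torus[OF fy[OF that]] by (auto simp: coords_def)
    have "\<exists>c. \<forall>p\<in>cball 0 1. character (A $ j) (?f p) = c" for j
    proof -
      have "norm (character (A $ j) (?f p)) = norm (character (A $ j) (?f 1))" if p: "p \<in> sphere 0 1" for p
      proof -
        have pc: "p \<in> cball 0 1" "1 \<in> cball (0::complex) 1" using p by auto
        have fib: "?f p \<in> fiber (q1, q2)" "?f 1 \<in> fiber (q1, q2)" using f(3) p by auto
        have "norm (coords A (?f p) $ j) = norm (coords A (?f 1) $ j)"
        proof (rule C.same_moduli)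
          show "coords A (?f p) \<in> C.coord_range" using C.chart_mem[OF ft(2)[OF pc(1)]] by (simp add: C.chart_def)
          show "coords A (?f p) $ j \<noteq> 0" "coords A (?f 1) $ j \<noteq> 0" for j
            using ft(3) pc by (auto simp: coords_def)
          have "mon B \<nu> (coords A (?f p)) = y" "mon B \<nu> (coords A (?f 1)) = y"
            using C.regular_\<nu>_pt[OF ft(2)[OF pc(1)]] C.regular_\<nu>_pt[OF ft(2)[OF pc(2)]] fy(2) pc
            by (auto simp: C.chart_def)
          thus "norm (mon B \<nu> (coords A (?f p))) = norm (mon B \<nu> (coords A (?f 1)))" by simp
          have "pt B (coords A (?f p)) = ?f p" "pt B (coords A (?f 1)) = ?f 1"
            using C.pt_chart[OF ft(2)[OF pc(1)]] C.pt_chart[OF ft(2)[OF pc(2)]] by (simp_all add: C.chart_def)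
          thus "quot_class \<nu> (C.mu (coords A (?f p))) = quot_class \<nu> (C.mu (coords A (?f 1)))"
            using fib by (simp add: C.mu_def gross_fiber_def gross_fibration_def)
        qed
        thus ?thesis by (simp add: coords_def)
      qed
      moreover have "continuous_on (cball 0 1) (\<lambda>p. character (A $ j) (?f p))"
        by (rule character_cont[OF f(1)]) (simp only: ft(1) UNIV_I)
      moreover have "(\<lambda>p. character (A $ j) (?f p)) holomorphic_on ball 0 1"
        by (rule character_holo[OF f(2)]) (use ft(1) in auto)
      ultimately obtain c where "\<And>p. p \<in> cball 0 1 \<Longrightarrow> character (A $ j) (?f p) = c"
        using constant_modulus_imp_constant[of "\<lambda>p. character (A $ j) (?f p)"] ft(3) by metis
      thus ?thesis by blast
    qed
    hence *: "\<exists>c. \<forall>p\<in>cball 0 1. character (A $ j) (?f p) = c" for j .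
    have one: "(1::complex) \<in> cball 0 1" by simp
    have "?f p = ?f 1" if p: "p \<in> cball 0 1" for p
    proof (rule eqI[OF ft(2)[OF p] ft(2)[OF one]])
      fix j show "character (A $ j) (?f p) = character (A $ j) (?f 1)"
        using *[of j] p one by metis
    qed
    hence "u i q = u i (Some 1)" if "q \<in> carrier_of S i" for q
      using that unfolding car[OF True] comp_apply by blast
    thus ?thesis by blast
  next
    case False
    hence s: "i \<in> spheres S" using i by (auto simp: comps_of_def)
    have cr: "carrier_of S i = UNIV" using False by (simp add: carrier_of_def)
    have t: "dom (u i p) = UNIV" "u i p \<in> fst C.chart" for p
      using torus[OF sphere_into(1)[OF sD[OF s]], of p] y[OF i, of p] by (auto simp: cr)
    have "\<exists>c. \<forall>p. character (A $ j) (u i p) = c" for j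
      using sphere_character_constant[OF sD[OF s], of "A $ j"] t(1) by (metis UNIV_I)
    hence "u i p = u i None" for p by (intro eqI t(2)) metis
    thus ?thesis by blast
  qed
  then obtain x where x: "\<And>i p. i \<in> comps_of S \<Longrightarrow> p \<in> carrier_of S i \<Longrightarrow> u i p = x"
    using semistable_constant[OF S nodes, of "\<lambda>x. x"] by metis
  have "\<exists>x. \<forall>i \<in> comps_of S. \<forall>p \<in> carrier_of S i. u i p = x"
    by (intro exI[of _ x] ballI x)
  thus ?thesis unfolding nonconstant_def by (simp only: not_not)
qed

end

section \<open>Existence of a disk of index zero inside a toric divisor\<close>

lemma (in gross_frame) zero_coordinate_unique:
  assumes z: "z \<in> coord_range" and nc: "noncritical K z" and 0: "z $ i = 0" "z $ j = 0"
  shows "i = j"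
proof (rule ccontr)
  assume ne: "i \<noteq> j"
  have J: "i \<in> J" "j \<in> J" using z 0 by (auto simp: coord_range_def)
  \<comment> \<open>Both generators have height 1, so \<xi> is orthogonal to \<nu>; but its flow
    rotates only vanishing coordinates and thus fixes z. At a noncritical point this is
    impossible.\<close>
  define \<xi> where "\<xi> = rvec (B $ i) - rvec (B $ j)"
  have "rvec \<nu> \<bullet> \<xi> = 0" using height_1 J by (simp add: \<xi>_def inner_diff_right rvec_inner)
  moreover have A\<xi>: "rvec (A $ l) \<bullet> \<xi> = (if l = i then 1 else 0) - (if l = j then 1 else 0)" for l
    by (simp add: \<xi>_def inner_diff_right dual_bases_inner[OF dual])
  have "fund_vec \<xi> z = 0" using 0 by (auto simp: fund_vec_def vec_eq_iff A\<xi>)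
  ultimately have "\<xi> = 0" by (rule fund_vec_inj[OF nc z])
  thus False using A\<xi>[of i] ne by simp
qed

context gross_fan
begin

lemma closed_cone: "\<sigma> \<in> \<Sigma> \<Longrightarrow> closed \<sigma>"
  using smooth unfolding smooth_fan_def fan_def rational_polyhedral_cone_def
  by (metis closed_convex_cone_hull finite_imageI)

text \<open>Moving m0 along \<nu> raises its pairing with all generators equally and keeps the
  class. At the smallest shift into the polyhedron some facet inequality is sharp, and a point over
  this facet cannot lie in the open orbit, where stretching would push the moment map beyond the
  facet.\<close>

lemma boundary_point:
  assumes poly: "\<mu>\<^sub>0 ` toric_variety \<Sigma> = moment_polyhedron \<Sigma> a" and q1: "q1 \<in> range (quot_class \<nu>)"
  obtains x where "x \<in> toric_variety \<Sigma>" "character \<nu> x = 0" "quot_class \<nu> (\<mu>\<^sub>0 x) = q1"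
proof -
  obtain m0 where m0: "q1 = quot_class \<nu> m0" using q1 by blast
  let ?R = "ray_generators \<Sigma>"
  have fin: "finite ?R" using two_rays by (metis card.infinite not_numeral_le_zero)
  define s where "s = Max ((\<lambda>v. a v - m0 \<bullet> rvec v) ` ?R)"
  define m where "m = m0 + s *\<^sub>R rvec \<nu>"
  have mv: "m \<bullet> rvec v = m0 \<bullet> rvec v + s" if "v \<in> ?R" for v
    using cy[OF that] by (simp add: m_def inner_add_left)
  have "a v \<le> m \<bullet> rvec v" if "v \<in> ?R" for v
  proof -
    have "a v - m0 \<bullet> rvec v \<le> s" unfolding s_def using fin that by (intro Max_ge) auto
    thus ?thesis using mv[OF that] by linarith
  qed
  hence "m \<in> moment_polyhedron \<Sigma> a" by (simp add: moment_polyhedron_def)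
  then obtain x where x: "x \<in> toric_variety \<Sigma>" "\<mu>\<^sub>0 x = m" using poly by (metis imageE)
  have "s \<in> (\<lambda>v. a v - m0 \<bullet> rvec v) ` ?R" unfolding s_def using fin ex_ray by (intro Max_in) auto
  then obtain v where v: "v \<in> ?R" "s = a v - m0 \<bullet> rvec v" by blast
  have "character \<nu> x = 0"
  proof (rule ccontr)
    assume nz: "character \<nu> x \<noteq> 0"
    obtain \<sigma> A B J where "gross_frame \<Sigma> \<sigma> A B J \<nu> \<omega> \<mu>\<^sub>0 k0" using ex_chart .
    then interpret C: gross_frame \<Sigma> \<sigma> A B J \<nu> \<omega> \<mu>\<^sub>0 k0 .
    have c: "x \<in> fst C.chart" using open_orbit[OF x(1) nz] x(1) by (simp add: C.chart_def affine_piece_def)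
    define z where "z = snd C.chart x"
    have z: "z \<in> C.coord_range" "pt B z = x" using C.chart_mem[OF c] C.pt_chart[OF c] by (simp_all add: z_def)
    have z0: "z $ j \<noteq> 0" for j
      using nz C.regular_\<nu>_pt[OF c] C.mon_\<nu>_zero[OF z(1)] by (auto simp: z_def)
    have "C.fund_vec (rvec v) z \<noteq> 0"
    proof
      assume "C.fund_vec (rvec v) z = 0"
      hence "rvec (A $ j) \<bullet> rvec v = 0" for j using z0[of j] by (auto simp: C.fund_vec_def vec_eq_iff)
      hence "rvec v = 0" using dual_bases_expand[OF C.dual, of "rvec v"] by simp
      thus False using cy[OF v(1)] by simp
    qed
    from C.mu_stretch[OF z(1) this, of "-1" 0]
    have "C.mu (C.stretch (- rvec v) z) \<bullet> rvec v < C.mu z \<bullet> rvec v"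
      by (simp add: C.stretch_def)
    also have "C.mu z \<bullet> rvec v = a v" using mv[OF v(1)] v(2) x(2) by (simp add: C.mu_def z(2))
    finally have "\<mu>\<^sub>0 (pt B (C.stretch (- rvec v) z)) \<notin> moment_polyhedron \<Sigma> a"
      using v(1) by (auto simp: moment_polyhedron_def C.mu_def not_le)
    moreover have "pt B (C.stretch (- rvec v) z) \<in> toric_variety \<Sigma>"
      using C.chart_toric[OF C.pt_mem] C.stretch_range z(1) by simp
    ultimately show False using poly by blast
  qed
  moreover have "quot_class \<nu> (\<mu>\<^sub>0 x) = q1"
    unfolding x(2) m0 quot_class_eq_iff m_def by (simp add: inner_add_left)
  ultimately show ?thesis using that x by blast
qed

text \<open>Points on the segment from a second generator v to b stay in the support and tend to b.
  One of the finitely many closed cones contains infinitely many of them, hence also b; any of those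
  points serves as the second point of height 1.\<close>

lemma larger_cone:
  assumes conv: "convex (\<Union>\<Sigma>)" and b: "b \<in> ray_generators \<Sigma>"
  obtains \<sigma> y where "\<sigma> \<in> \<Sigma>" "rvec b \<in> \<sigma>" "y \<in> \<sigma>" "y \<noteq> rvec b" "rvec \<nu> \<bullet> y = 1"
proof -
  have fin: "finite \<Sigma>" using smooth by (simp add: smooth_fan_def fan_def)
  have "ray_generators \<Sigma> \<noteq> {b}" using two_rays by auto
  then obtain v where v: "v \<in> ray_generators \<Sigma>" "v \<noteq> b" using b by blast
  have ray_in: "rvec w \<in> \<Union>\<Sigma>" if "w \<in> ray_generators \<Sigma>" for w
    using that hull_inc[of "rvec w" "{rvec w}"] unfolding ray_generators_def by blast
  \<comment> \<open>Index 0 gives v itself, and no term equals b because its weight on v is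
    positive.\<close>
  define y where "y n = (1 - 1 / real (Suc n)) *\<^sub>R rvec b + (1 / real (Suc n)) *\<^sub>R rvec v" for n
  have y_eq: "y n = rvec b + (1 / real (Suc n)) *\<^sub>R (rvec v - rvec b)" for n
    by (simp add: y_def algebra_simps)
  have "y n \<in> \<Union>\<Sigma>" for n
    unfolding y_def by (rule convexD[OF conv ray_in[OF b] ray_in[OF v(1)]]) auto
  hence "(\<Union>\<sigma>\<in>\<Sigma>. {n. y n \<in> \<sigma>}) = UNIV" by auto
  hence "\<not> finite (\<Union>\<sigma>\<in>\<Sigma>. {n. y n \<in> \<sigma>})" by simp
  then obtain \<sigma> where \<sigma>: "\<sigma> \<in> \<Sigma>" "infinite {n. y n \<in> \<sigma>}" using fin by blast
  have "(\<lambda>n. rvec b + (1 / real (Suc n)) *\<^sub>R (rvec v - rvec b)) \<longlonglongrightarrow> rvec b + 0 *\<^sub>R (rvec v - rvec b)"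
    by (intro tendsto_intros LIMSEQ_Suc[OF lim_1_over_n])
  hence lim: "y \<longlonglongrightarrow> rvec b" unfolding y_eq[abs_def] by simp
  have "rvec b \<in> \<sigma>"
  proof (rule ccontr)
    assume "rvec b \<notin> \<sigma>"
    hence "\<forall>\<^sub>F n in sequentially. y n \<in> - \<sigma>"
      using topological_tendstoD[OF lim, of "- \<sigma>"] closed_cone[OF \<sigma>(1)] by (simp add: open_Compl)
    then obtain N where "\<And>n. n \<ge> N \<Longrightarrow> y n \<notin> \<sigma>" by (auto simp: eventually_sequentially)
    hence "{n. y n \<in> \<sigma>} \<subseteq> {..<N}" by (auto simp: not_le[symmetric])
    thus False using \<sigma>(2) finite_subset by blast
  qed
  moreover obtain n where "y n \<in> \<sigma>" using \<sigma>(2) by (metis (mono_tags, lifting) Collect_empty_eq finite.emptyI)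
  moreover have "y n \<noteq> rvec b" unfolding y_eq using v(2) by (simp add: rvec_inject)
  moreover have "rvec \<nu> \<bullet> y n = 1" unfolding y_eq using cy[OF b] cy[OF v(1)] by (simp add: inner_add_right inner_diff_right)
  ultimately show ?thesis using that \<sigma>(1) by blast
qed

text \<open>The disk moves one coordinate, with index i1, of a point x of the divisor given by the
  vanishing of another coordinate i0. This needs two generators of a common cone, which
  \<open>larger_cone\<close> provides.\<close>

theorem exists_index_zero_disk:
  assumes poly: "\<mu>\<^sub>0 ` toric_variety \<Sigma> = moment_polyhedron \<Sigma> a" and conv: "convex (\<Union>\<Sigma>)"
    and q1: "q1 \<in> range (quot_class \<nu>)" and r: "(q1, 0) \<notin> disc"
  shows "bounds_stable_disk_of_index (toric_atlas \<Sigma>) (fiber (q1, 0)) 0"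
proof -
  obtain x where x: "x \<in> toric_variety \<Sigma>" "character \<nu> x = 0" "quot_class \<nu> (\<mu>\<^sub>0 x) = q1"
    using boundary_point[OF poly q1] .
  have fib: "gross_fibration \<nu> K \<mu>\<^sub>0 x = (q1, 0)"
    using x by (simp add: gross_fibration_def gross_height_def)
  hence nc: "x \<notin> gross_critical_points \<Sigma> \<nu> K \<mu>\<^sub>0" using r by (force simp: discriminant_def)
  obtain \<tau> A0 B0 J0 where t: "toric_chart \<Sigma> \<tau> A0 B0 J0" "x \<in> fst (toric_chart.chart \<Sigma> \<tau> A0)"
    "\<And>j. j \<in> J0 \<longleftrightarrow> coords A0 x $ j = 0"
    using toric_variety_chart[OF smooth x(1)] by metis
  interpret T: gross_frame \<Sigma> \<tau> A0 B0 J0 \<nu> \<omega> \<mu>\<^sub>0 k0 using gross_frameI[OF t(1)] .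
  have zT: "snd T.chart x \<in> T.coord_range" "pt B0 (snd T.chart x) = x"
    using T.chart_mem[OF t(2)] T.pt_chart[OF t(2)] by auto
  have "\<exists>j. snd T.chart x $ j = 0"
    using T.mon_\<nu>_zero[OF zT(1)] T.regular_\<nu>_pt[OF t(2)] x(2) by simp
  then obtain j0 where j0: "snd T.chart x $ j0 = 0" by blast
  have j0_unique: "j = j0" if "snd T.chart x $ j = 0" for j
    using T.zero_coordinate_unique[OF zT(1) T.noncriticalI[OF zT(1)] that j0] nc zT(2) by simp
  have "snd T.chart x = coords A0 x" by (simp add: T.chart_def)
  hence "j \<in> J0 \<longleftrightarrow> j = j0" for j using t(3)[of j] j0 j0_unique[of j] by metis
  \<comment> \<open>In the chart of its orbit cone the point has exactly the coordinates in
    \<open>J0\<close> equal to zero, and noncriticality allows only one: x lies on a single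
    divisor.\<close>
  hence J0: "J0 = {j0}" by blast
  have b: "B0 $ j0 \<in> ray_generators \<Sigma>" by (rule ray_generators_of_cone[OF t(1)]) (simp add: J0)
  obtain \<sigma> y where \<sigma>: "\<sigma> \<in> \<Sigma>" "rvec (B0 $ j0) \<in> \<sigma>" "y \<in> \<sigma>" "y \<noteq> rvec (B0 $ j0)" "rvec \<nu> \<bullet> y = 1"
    using larger_cone[OF conv b] .
  obtain A B J where s: "toric_chart \<Sigma> \<sigma> A B J" using chart_of_cone[OF smooth \<sigma>(1)] .
  interpret C: gross_frame \<Sigma> \<sigma> A B J \<nu> \<omega> \<mu>\<^sub>0 k0 using gross_frameI[OF s] .
  have "\<tau> \<subseteq> \<sigma>" unfolding T.cone_eq J0 basis_cone_def C.cone_eq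
  proof (rule hull_minimal)
    show "(\<lambda>j. rvec (B0 $ j)) ` {j0} \<subseteq> convex_cone hull ((\<lambda>j. rvec (B $ j)) ` J)"
      using \<sigma>(2) by (simp add: C.cone_eq basis_cone_def)
  qed (rule convex_cone_convex_cone_hull)
  hence "dual_monoid \<sigma> \<subseteq> dual_monoid \<tau>" by (auto simp: dual_monoid_def)
  moreover have "dual_monoid \<tau> \<subseteq> dom x" using t(2) by (auto simp: T.chart_def affine_piece_def)
  ultimately have c: "x \<in> fst C.chart" using x(1) by (auto simp: C.chart_def affine_piece_def)
  define z where "z = snd C.chart x"
  have z: "z \<in> C.coord_range" "pt B z = x" using C.chart_mem[OF c] C.pt_chart[OF c] by (auto simp: z_def)
  have w0: "mon B \<nu> z = 0" using C.regular_\<nu>_pt[OF c] x(2) by (simp add: z_def)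
  then obtain i0 where i0: "z $ i0 = 0" using C.mon_\<nu>_zero[OF z(1)] by blast
  have i0_unique: "i = i0" if "z $ i = 0" for i
    using C.zero_coordinate_unique[OF z(1) C.noncriticalI[OF z(1)] that i0] nc z(2) by simp
  have "i0 \<in> J" using i0 z(1) by (auto simp: C.coord_range_def)
  \<comment> \<open>Otherwise \<sigma> would be a ray, with a single point of height 1, whereas it
    contains both y and the generator \<open>B0 $ j0\<close>.\<close>
  have "\<exists>i1\<in>J. i1 \<noteq> i0"
  proof (rule ccontr)
    assume "\<not> (\<exists>i1\<in>J. i1 \<noteq> i0)"
    hence J: "J = {i0}" using \<open>i0 \<in> J\<close> by blast
    have one: "p = rvec (B $ i0)" if "p \<in> \<sigma>" "rvec \<nu> \<bullet> p = 1" for p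
    proof -
      have "p = (\<Sum>j\<in>UNIV. (rvec (A $ j) \<bullet> p) *\<^sub>R rvec (B $ j))" by (rule dual_bases_expand[OF C.dual])
      also have "\<dots> = (\<Sum>j\<in>UNIV. if j = i0 then (rvec (A $ i0) \<bullet> p) *\<^sub>R rvec (B $ i0) else 0)"
        using that(1) unfolding C.cone_eq basis_cone_eq[OF C.dual] J by (intro sum.cong) auto
      finally have p: "p = (rvec (A $ i0) \<bullet> p) *\<^sub>R rvec (B $ i0)" by simp
      have "rvec \<nu> \<bullet> p = rvec (A $ i0) \<bullet> p"
        using C.height_1[of i0] J by (subst p) (simp add: rvec_inner)
      thus ?thesis using p that(2) by simp
    qed
    show False using one[OF \<sigma>(2) cy[OF b]] one[OF \<sigma>(3,5)] \<sigma>(4) by simp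
  qed
  then obtain i1 where i1: "i1 \<in> J" "i1 \<noteq> i0" by blast
  have zi1: "z $ i1 \<noteq> 0" using i0_unique i1(2) by blast
  \<comment> \<open>Since i1 belongs to \<open>J\<close>, this coordinate may pass through 0 without
    leaving the chart.\<close>
  define \<zeta> where "\<zeta> p = (\<chi> j. if j = i1 then p * z $ i1 else z $ j)" for p :: complex
  define f where "f p = pt B (\<zeta> p)" for p
  have \<zeta>: "\<zeta> p \<in> C.coord_range" for p using z(1) i1(1) by (auto simp: \<zeta>_def C.coord_range_def)
  have fc: "f p \<in> fst C.chart" "snd C.chart (f p) = \<zeta> p" for p
    using C.pt_mem[OF \<zeta>] by (auto simp: f_def)
  have wf: "character \<nu> (f p) = 0" for p
  proof -
    have "\<zeta> p $ i0 = 0" using i0 i1(2) by (simp add: \<zeta>_def)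
    hence "mon B \<nu> (\<zeta> p) = 0" using C.mon_\<nu>_zero[OF \<zeta>] by blast
    thus ?thesis using C.regular_\<nu>_pt[OF fc(1)] fc(2) by simp
  qed
  have cont: "cont_into (toric_atlas \<Sigma>) (cball 0 1) f"
    unfolding cont_into_def
  proof (intro ballI bexI[OF _ C.chart_in_atlas] exI[of _ 1] conjI)
    fix p
    show "f ` (cball 0 1 \<inter> ball p 1) \<subseteq> fst C.chart" using fc by auto
    have "continuous_on S (\<lambda>p. if j = i1 then p * z $ i1 else z $ j)" for S j
      by (cases "j = i1") (auto intro!: continuous_intros)
    thus "continuous_on (cball 0 1 \<inter> ball p 1) (snd C.chart \<circ> f)"
      unfolding o_def fc(2) \<zeta>_def by (intro continuous_on_vec_lambda)
  qed simp
  have holo: "holo_into (toric_atlas \<Sigma>) (ball 0 1) f"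
    unfolding holo_into_def
  proof
    fix p :: complex assume "p \<in> ball 0 1"
    then obtain e where e: "e > 0" "ball p e \<subseteq> ball 0 1" using open_ball openE by blast
    have "(\<lambda>p. \<zeta> p $ j) holomorphic_on ball p e" for j
      unfolding \<zeta>_def by (cases "j = i1") (auto intro!: holomorphic_intros)
    thus "\<exists>c\<in>toric_atlas \<Sigma>. \<exists>e>0. ball p e \<subseteq> ball 0 1 \<and> f ` ball p e \<subseteq> fst c \<and>
        (\<forall>j. (\<lambda>z. snd c (f z) $ j) holomorphic_on ball p e)"
      using e fc by (intro bexI[OF _ C.chart_in_atlas] exI[of _ e]) auto
  qed
  have bd: "f p \<in> fiber (q1, 0)" if p: "norm p = 1" for p
  proof -
    \<comment> \<open>For p on the unit circle this is the action of the circle generated by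
      \<open>B $ i1\<close>, which preserves the moment map.\<close>
    have "\<zeta> p = C.rot (Arg p *\<^sub>R rvec (B $ i1)) z"
    proof (subst vec_eq_iff, intro allI)
      fix j
      have "p = cis (Arg p)" using rcis_cmod_Arg[of p] p by (simp add: rcis_def)
      thus "\<zeta> p $ j = C.rot (Arg p *\<^sub>R rvec (B $ i1)) z $ j"
        by (simp add: \<zeta>_def C.rot_def dual_bases_inner[OF C.dual])
    qed
    hence "C.mu (\<zeta> p) = C.mu z" using C.mu_rot[OF z(1)] by simp
    hence "\<mu>\<^sub>0 (f p) = \<mu>\<^sub>0 x" by (simp add: C.mu_def f_def z(2))
    thus ?thesis using x(3) wf C.chart_toric[OF fc(1)]
      by (simp add: gross_fiber_def gross_fibration_def gross_height_def)
  qed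
  have "disk_maslov (toric_atlas \<Sigma>) (fiber (q1, 0)) f = 2 * 0"
  proof (rule disk_index[OF cont _ r])
    show "f ` sphere 0 1 \<subseteq> fiber (q1, 0)" using bd by auto
    \<comment> \<open>On the disk w - K is the constant -K, which is nonzero by
      \<open>K_pos\<close>.\<close>
    show "winding_number (\<lambda>t. character \<nu> (f (unit_circle t)) - of_real K) 0 = of_int 0"
      using winding_number_loop_on_disk[of "\<lambda>p. - of_real K"] K_pos by (simp add: wf)
  qed
  define S :: nodal_disk where "S = \<lparr>disks = {0}, spheres = {}, nodes = {}, marked = {}\<rparr>"
  \<comment> \<open>The point \<open>None\<close> lies outside the carrier of the disk component; x
    is a default value there.\<close>
  define u where "u i p = (case p of Some s \<Rightarrow> f s | None \<Rightarrow> x)" for i :: nat and p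
  have uf: "u i \<circ> Some = f" for i by (auto simp: u_def)
  have ne: "f 0 \<noteq> f 1"
  proof
    assume "f 0 = f 1"
    hence "\<zeta> 0 $ i1 = \<zeta> 1 $ i1" using fc(2) by metis
    thus False using zi1 by (simp add: \<zeta>_def)
  qed
  have car: "carrier_of S 0 = Some ` cball 0 1" by (simp add: carrier_of_def S_def)
  have comps: "comps_of S = {0}" by (simp add: comps_of_def S_def)
  have ne': "u 0 (Some 0) \<noteq> u 0 (Some 1)" using ne by (simp add: u_def)
  have in_car: "Some 0 \<in> carrier_of S 0" "Some 1 \<in> carrier_of S 0" by (auto simp: car)
  have "semistable_disk S"
    unfolding semistable_disk_def comps by (simp add: S_def disjoint_def)
  moreover have "\<not> u 0 constant_on carrier_of S 0"
    using ne' in_car unfolding constant_on_def by metis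
  ultimately have "stable_disk (toric_atlas \<Sigma>) (fiber (q1, 0)) S u"
    unfolding stable_disk_def comps using cont holo bd
    by (simp add: S_def uf) (auto simp: u_def)
  moreover have "nonconstant S u"
    unfolding nonconstant_def comps using ne' in_car by (metis singletonI)
  moreover have "maslov_index (toric_atlas \<Sigma>) (fiber (q1, 0)) S u = 0"
    using \<open>disk_maslov _ _ f = 2 * 0\<close> by (simp add: maslov_index_def S_def uf)
  ultimately show ?thesis unfolding bounds_stable_disk_of_index_def by blast
qed

end

theorem lemma4p27:
  fixes \<Sigma> :: "(real ^ 'n::finite) set set"
    and \<nu> :: "int ^ 'n"
    and \<omega> :: "('n tpoint, 'n) two_form"
    and \<mu>\<^sub>0 :: "'n tpoint \<Rightarrow> real ^ 'n"
    and a :: "int ^ 'n \<Rightarrow> real"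
    and K\<^sub>2 :: real
    and q\<^sub>1 :: "(real ^ 'n) set"
    and q\<^sub>2 :: real
  assumes "smooth_fan \<Sigma>"
    and "convex (\<Union>\<Sigma>)"
    and "\<not> (\<exists>p d. d \<noteq> 0 \<and> (\<forall>t::real. p + t *\<^sub>R d \<in> \<Union>\<Sigma>))"
    and "card (ray_generators \<Sigma>) \<ge> 2"
    and "\<forall>v \<in> ray_generators \<Sigma>. rvec \<nu> \<bullet> rvec v = 1"
    and "toric_kaehler_form \<Sigma> \<omega>"
    and "moment_map \<Sigma> \<omega> \<mu>\<^sub>0"
    and "\<mu>\<^sub>0 ` toric_variety \<Sigma> = moment_polyhedron \<Sigma> a"
    and "K\<^sub>2 > 0"
    and "(q\<^sub>1, q\<^sub>2) \<in> gross_base \<nu> K\<^sub>2 - discriminant \<Sigma> \<nu> K\<^sub>2 \<mu>\<^sub>0"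
  shows "bounds_stable_disk_of_index (toric_atlas \<Sigma>)
           (gross_fiber \<Sigma> \<nu> K\<^sub>2 \<mu>\<^sub>0 (q\<^sub>1, q\<^sub>2)) 0 \<longleftrightarrow> q\<^sub>2 = 0"
proof -
  interpret gross_fan \<Sigma> \<nu> \<omega> \<mu>\<^sub>0 K\<^sub>2
    using assms by unfold_locales auto
  have r: "(q\<^sub>1, q\<^sub>2) \<notin> disc" and q1: "q\<^sub>1 \<in> range (quot_class \<nu>)"
    using assms(10) by (auto simp: gross_base_def)
  show ?thesis
  proof
    assume "bounds_stable_disk_of_index (toric_atlas \<Sigma>) (fiber (q\<^sub>1, q\<^sub>2)) 0"
    thus "q\<^sub>2 = 0"
      unfolding bounds_stable_disk_of_index_def using index_zero_constant[OF r] by metis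
  next
    assume "q\<^sub>2 = 0"
    thus "bounds_stable_disk_of_index (toric_atlas \<Sigma>) (fiber (q\<^sub>1, q\<^sub>2)) 0"
      using exists_index_zero_disk[OF assms(8,2) q1] r by simp
  qed
qed

end
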